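(* Let $C$ be a $(d-1)$-dimensional connected closed (i.e. compact, without boundary) polytopal premanifold in $\mathbb{R}^d$ or $S^d$, $d\ge 3$, which is in locally convex position. Then $C$ is in convex position.
   Context: Let $K$ be an abstract polytopal complex (polytopes glued along isometries of faces) and $f$ an immersion of $K$ into $\mathbb{R}^d$ (resp. $S^d$) that is an isometry on every face, such that for every face $\sigma$ of $K$ the image $f(\mathrm{St}(\sigma,K))$ of its star is a (geometric) polytopal complex combinatorially equivalent to $\mathrm{St}(\sigma,K)$. Then $f(K)$ is a precomplex; its faces are the images of faces of $K$ and $\mathrm{St}(f(\sigma),f(K)):=f(\mathrm{St}(\sigma,K))$. A polytopal complex is an $m$-manifold if the star of every vertex is PL-homeomorphic to an $m$-simplex; if $K$ is a manifold, $f(K)$ is a premanifold. A pure (pre)complex $C$ is in convex position if for every facet $\sigma$ there is a closed halfspace (resp. closed hemisphere) $H(\sigma)$ containing $C$ whose boundary contains the vertices of $\sigma$ but no other vertices of $C$; it is in locally convex position if for every vertex $v$ the star $\mathrm{St}(v,C)$ is in convex position. *)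

theory Defs
  imports "HOL-Analysis.Analysis"
begin

text \<open>The two ambient geometries are treated uniformly. The predicate \<open>ghalfspace H B\<close> says
  that \<open>H\<close> is a closed halfspace (closed hemisphere) with boundary \<open>B\<close>. Polytopes, faces and
  simplices are nonempty throughout: the empty face is not counted as a face of a complex.\<close>

record 'a geometry =
  gspace :: "'a set"
  gdist :: "'a \<Rightarrow> 'a \<Rightarrow> real"
  gpolytope :: "'a set \<Rightarrow> bool"
  gface :: "'a set \<Rightarrow> 'a set \<Rightarrow> bool"
  gsimplex :: "'a set \<Rightarrow> bool"
  gdim :: "'a set \<Rightarrow> int"
  ghalfspace :: "'a set \<Rightarrow> 'a set \<Rightarrow> bool"

definition euclidean_geometry :: "'a::euclidean_space geometry" where
  "euclidean_geometry = \<lparr>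
     gspace = UNIV,
     gdist = dist,
     gpolytope = (\<lambda>P. polytope P \<and> P \<noteq> {}),
     gface = (\<lambda>F P. F face_of P \<and> F \<noteq> {}),
     gsimplex = (\<lambda>P. P \<noteq> {} \<and> (\<exists>n. n simplex P)),
     gdim = aff_dim,
     ghalfspace = (\<lambda>H B. \<exists>u c. u \<noteq> 0 \<and> H = {x. u \<bullet> x \<le> c} \<and> B = {x. u \<bullet> x = c})\<rparr>"

text \<open>The sphere is the unit sphere with its angular metric. The spherical convex hull of a set
  contained in an open hemisphere is the radial projection of its Euclidean convex hull, and
  spherical polytopes are the spherical convex hulls of finite sets contained in an open
  hemisphere. Faces are cut out by supporting great spheres; \<open>u = 0\<close> gives the polytope itself.\<close>

definition spherical_hull :: "'a::euclidean_space set \<Rightarrow> 'a set" where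
  "spherical_hull V = sgn ` (convex hull V)"

definition spherical_geometry :: "'a::euclidean_space geometry" where
  "spherical_geometry = \<lparr>
     gspace = sphere 0 1,
     gdist = (\<lambda>x y. arccos (x \<bullet> y)),
     gpolytope = (\<lambda>P. \<exists>V u. finite V \<and> V \<noteq> {} \<and> V \<subseteq> sphere 0 1 \<and> (\<forall>v\<in>V. u \<bullet> v > 0) \<and>
                    P = spherical_hull V),
     gface = (\<lambda>F P. F \<noteq> {} \<and> (\<exists>u. P \<subseteq> {x. u \<bullet> x \<le> 0} \<and> F = P \<inter> {x. u \<bullet> x = 0})),
     gsimplex = (\<lambda>P. \<exists>V. V \<noteq> {} \<and> V \<subseteq> sphere 0 1 \<and> independent V \<and> P = spherical_hull V),
     gdim = (\<lambda>P. int (dim P) - 1),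
     ghalfspace = (\<lambda>H B. \<exists>u. u \<noteq> 0 \<and> H = {x \<in> sphere 0 1. u \<bullet> x \<le> 0} \<and>
                              B = {x \<in> sphere 0 1. u \<bullet> x = 0})\<rparr>"

definition geometric_complex :: "'a geometry \<Rightarrow> 'a set set \<Rightarrow> bool" where
  "geometric_complex G S \<longleftrightarrow>
     finite S \<and>
     (\<forall>P\<in>S. gpolytope G P) \<and>
     (\<forall>P\<in>S. \<forall>F. gface G F P \<longrightarrow> F \<in> S) \<and>
     (\<forall>P\<in>S. \<forall>Q\<in>S. P \<inter> Q \<noteq> {} \<longrightarrow> gface G (P \<inter> Q) P \<and> gface G (P \<inter> Q) Q)"

text \<open>An abstract polytopal complex is given by its cells, as subsets of the glued space, and by
  the distances between points that lie in a common cell. That polytopes are glued along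
  isometries of faces means that these distances do not depend on the cell. The values of
  \<open>cdist\<close> on pairs of points without a common cell are irrelevant.\<close>

record 'p polycomplex =
  cells :: "'p set set"
  cdist :: "'p \<Rightarrow> 'p \<Rightarrow> real"

definition chart ::
  "'a geometry \<Rightarrow> 'p polycomplex \<Rightarrow> 'p set \<Rightarrow> 'a set \<Rightarrow> ('p \<Rightarrow> 'a) \<Rightarrow> bool" where
  "chart G K \<sigma> P \<phi> \<longleftrightarrow>
     gpolytope G P \<and> bij_betw \<phi> \<sigma> P \<and>
     (\<forall>x\<in>\<sigma>. \<forall>y\<in>\<sigma>. gdist G (\<phi> x) (\<phi> y) = cdist K x y) \<and>
     (\<forall>\<tau>. \<tau> \<subseteq> \<sigma> \<longrightarrow> (\<tau> \<in> cells K \<longleftrightarrow> gface G (\<phi> ` \<tau>) P))"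

definition abstract_complex :: "'a geometry \<Rightarrow> 'p polycomplex \<Rightarrow> bool" where
  "abstract_complex G K \<longleftrightarrow>
     (\<forall>\<sigma>\<in>cells K. \<exists>P \<phi>. chart G K \<sigma> P \<phi>) \<and>
     (\<forall>\<sigma>\<in>cells K. \<forall>\<tau>\<in>cells K. \<sigma> \<inter> \<tau> \<noteq> {} \<longrightarrow> \<sigma> \<inter> \<tau> \<in> cells K)"

definition has_cell_dim :: "'a geometry \<Rightarrow> 'p polycomplex \<Rightarrow> 'p set \<Rightarrow> int \<Rightarrow> bool" where
  "has_cell_dim G K \<sigma> n \<longleftrightarrow> (\<exists>P \<phi>. chart G K \<sigma> P \<phi> \<and> gdim G P = n)"

definition vertices :: "'p polycomplex \<Rightarrow> 'p set" where
  "vertices K = {v. {v} \<in> cells K}"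

definition facets :: "'p polycomplex \<Rightarrow> 'p set set" where
  "facets K = {\<sigma> \<in> cells K. \<forall>\<tau>\<in>cells K. \<sigma> \<subseteq> \<tau> \<longrightarrow> \<tau> = \<sigma>}"

definition pure :: "'a geometry \<Rightarrow> 'p polycomplex \<Rightarrow> bool" where
  "pure G K \<longleftrightarrow> (\<exists>n. \<forall>\<sigma>\<in>facets K. has_cell_dim G K \<sigma> n)"

definition star :: "'p set \<Rightarrow> 'p polycomplex \<Rightarrow> 'p polycomplex" where
  "star \<sigma> K = K\<lparr>cells := {\<tau> \<in> cells K. \<exists>\<rho>\<in>cells K. \<sigma> \<subseteq> \<rho> \<and> \<tau> \<subseteq> \<rho>}\<rparr>"

text \<open>The quotient topology of the glued space.\<close>

definition complex_open :: "'p polycomplex \<Rightarrow> 'p set \<Rightarrow> bool" where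
  "complex_open K U \<longleftrightarrow>
     U \<subseteq> \<Union>(cells K) \<and>
     (\<forall>\<sigma>\<in>cells K. \<forall>x\<in>U \<inter> \<sigma>. \<exists>e>0. \<forall>y\<in>\<sigma>. cdist K x y < e \<longrightarrow> y \<in> U)"

definition complex_topology :: "'p polycomplex \<Rightarrow> 'p topology" where
  "complex_topology K = topology (complex_open K)"

lemma complex_openD:
  assumes "complex_open K U" "\<sigma> \<in> cells K" "x \<in> U" "x \<in> \<sigma>"
  obtains e where "e > 0" "\<And>y. y \<in> \<sigma> \<Longrightarrow> cdist K x y < e \<Longrightarrow> y \<in> U"
proof -
  have "\<exists>e>0. \<forall>y\<in>\<sigma>. cdist K x y < e \<longrightarrow> y \<in> U"
    using assms unfolding complex_open_def by (blast intro: IntI)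
  then show thesis using that by blast
qed

lemma istopology_complex_open: "istopology (complex_open K)"
  unfolding istopology_def
proof (intro conjI allI impI)
  fix S T assume S: "complex_open K S" and T: "complex_open K T"
  show "complex_open K (S \<inter> T)"
    unfolding complex_open_def
  proof (intro conjI ballI)
    show "S \<inter> T \<subseteq> \<Union>(cells K)" using S unfolding complex_open_def by blast
  next
    fix \<sigma> x assume \<sigma>: "\<sigma> \<in> cells K" and x: "x \<in> S \<inter> T \<inter> \<sigma>"
    obtain a where a: "a > 0" "\<And>y. y \<in> \<sigma> \<Longrightarrow> cdist K x y < a \<Longrightarrow> y \<in> S"
      using complex_openD[OF S \<sigma>] x by blast
    obtain b where b: "b > 0" "\<And>y. y \<in> \<sigma> \<Longrightarrow> cdist K x y < b \<Longrightarrow> y \<in> T"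
      using complex_openD[OF T \<sigma>] x by blast
    show "\<exists>e>0. \<forall>y\<in>\<sigma>. cdist K x y < e \<longrightarrow> y \<in> S \<inter> T"
      using a b by (intro exI[of _ "min a b"]) simp
  qed
next
  fix \<K> assume op: "\<forall>S\<in>\<K>. complex_open K S"
  show "complex_open K (\<Union>\<K>)"
    unfolding complex_open_def
  proof (intro conjI ballI)
    show "\<Union>\<K> \<subseteq> \<Union>(cells K)" using op unfolding complex_open_def by blast
  next
    fix \<sigma> x assume \<sigma>: "\<sigma> \<in> cells K" and x: "x \<in> \<Union>\<K> \<inter> \<sigma>"
    then obtain S where S: "S \<in> \<K>" "x \<in> S" by blast
    then have "complex_open K S" using op by blast
    from complex_openD[OF this \<sigma> S(2)] x
    obtain e where "e > 0" "\<And>y. y \<in> \<sigma> \<Longrightarrow> cdist K x y < e \<Longrightarrow> y \<in> S" by blast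
    with S show "\<exists>e>0. \<forall>y\<in>\<sigma>. cdist K x y < e \<longrightarrow> y \<in> \<Union>\<K>" by blast
  qed
qed

lemma openin_complex_topology: "openin (complex_topology K) = complex_open K"
  by (simp add: complex_topology_def istopology_complex_open)

definition comb_equiv :: "'p set set \<Rightarrow> 'q set set \<Rightarrow> bool" where
  "comb_equiv A B \<longleftrightarrow> (\<exists>h. bij_betw h A B \<and> (\<forall>\<sigma>\<in>A. \<forall>\<tau>\<in>A. \<sigma> \<subseteq> \<tau> \<longleftrightarrow> h \<sigma> \<subseteq> h \<tau>))"

text \<open>PL-homeomorphism: existence of isomorphic simplicial subdivisions. This is meaningful
  also between complexes of different geometries.\<close>

definition simplicial_subdivision :: "'a geometry \<Rightarrow> 'p polycomplex \<Rightarrow> 'p set set \<Rightarrow> bool" where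
  "simplicial_subdivision G K S \<longleftrightarrow>
     finite S \<and> abstract_complex G (K\<lparr>cells := S\<rparr>) \<and>
     (\<forall>\<sigma>\<in>S. \<exists>P \<phi>. chart G (K\<lparr>cells := S\<rparr>) \<sigma> P \<phi> \<and> gsimplex G P) \<and>
     \<Union>S = \<Union>(cells K) \<and> (\<forall>\<sigma>\<in>S. \<exists>\<tau>\<in>cells K. \<sigma> \<subseteq> \<tau>)"

definition pl_homeomorphic ::
  "'a geometry \<Rightarrow> 'p polycomplex \<Rightarrow> 'b geometry \<Rightarrow> 'q polycomplex \<Rightarrow> bool" where
  "pl_homeomorphic G K G' L \<longleftrightarrow>
     (\<exists>S T. simplicial_subdivision G K S \<and> simplicial_subdivision G' L T \<and> comb_equiv S T)"

definition simplex_complex :: "'a::euclidean_space set \<Rightarrow> 'a polycomplex" where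
  "simplex_complex \<Delta> = \<lparr>cells = {F. F face_of \<Delta> \<and> F \<noteq> {}}, cdist = dist\<rparr>"

definition pl_manifold ::
  "'a::euclidean_space geometry \<Rightarrow> nat \<Rightarrow> 'p polycomplex \<Rightarrow> bool" where
  "pl_manifold G m K \<longleftrightarrow>
     abstract_complex G K \<and>
     (\<forall>v\<in>vertices K. \<exists>\<Delta>::'a set. int m simplex \<Delta> \<and>
        pl_homeomorphic G (star {v} K) (euclidean_geometry :: 'a geometry) (simplex_complex \<Delta>))"

definition boundary_complex :: "'a geometry \<Rightarrow> nat \<Rightarrow> 'p polycomplex \<Rightarrow> 'p set set" where
  "boundary_complex G m K =
     {\<tau> \<in> cells K. \<exists>\<rho>\<in>cells K. \<tau> \<subseteq> \<rho> \<and> has_cell_dim G K \<rho> (int m - 1) \<and>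
                      (\<exists>!\<sigma>. \<sigma> \<in> facets K \<and> \<rho> \<subseteq> \<sigma>)}"

definition complex_immersion ::
  "'a::euclidean_space geometry \<Rightarrow> 'p polycomplex \<Rightarrow> ('p \<Rightarrow> 'a) \<Rightarrow> bool" where
  "complex_immersion G K f \<longleftrightarrow>
     f ` \<Union>(cells K) \<subseteq> gspace G \<and>
     (\<forall>x\<in>\<Union>(cells K). \<exists>U. openin (complex_topology K) U \<and> x \<in> U \<and>
        embedding_map (subtopology (complex_topology K) U) (top_of_set (gspace G)) f)"

text \<open>A precomplex is represented by the pair of the abstract complex \<open>K\<close> and the immersion \<open>f\<close>;
  its faces are the images of the cells of \<open>K\<close>.\<close>

definition precomplex ::
  "'a::euclidean_space geometry \<Rightarrow> 'p polycomplex \<Rightarrow> ('p \<Rightarrow> 'a) \<Rightarrow> bool" where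
  "precomplex G K f \<longleftrightarrow>
     abstract_complex G K \<and> complex_immersion G K f \<and>
     (\<forall>\<sigma>\<in>cells K. \<forall>x\<in>\<sigma>. \<forall>y\<in>\<sigma>. gdist G (f x) (f y) = cdist K x y) \<and>
     (\<forall>\<sigma>\<in>cells K. geometric_complex G ((`) f ` cells (star \<sigma> K)) \<and>
        comb_equiv (cells (star \<sigma> K)) ((`) f ` cells (star \<sigma> K)))"

definition premanifold ::
  "'a::euclidean_space geometry \<Rightarrow> nat \<Rightarrow> 'p polycomplex \<Rightarrow> ('p \<Rightarrow> 'a) \<Rightarrow> bool" where
  "premanifold G m K f \<longleftrightarrow> precomplex G K f \<and> pl_manifold G m K"

definition closed_complex :: "'a geometry \<Rightarrow> nat \<Rightarrow> 'p polycomplex \<Rightarrow> bool" where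
  "closed_complex G m K \<longleftrightarrow>
     compact_space (complex_topology K) \<and> boundary_complex G m K = {}"

definition convex_position ::
  "'a geometry \<Rightarrow> 'p polycomplex \<Rightarrow> ('p \<Rightarrow> 'a) \<Rightarrow> bool" where
  "convex_position G K f \<longleftrightarrow>
     pure G K \<and>
     (\<forall>\<sigma>\<in>facets K. \<exists>H B. ghalfspace G H B \<and> f ` \<Union>(cells K) \<subseteq> H \<and>
        f ` vertices K \<inter> B = f ` (vertices K \<inter> \<sigma>))"

definition locally_convex_position ::
  "'a geometry \<Rightarrow> 'p polycomplex \<Rightarrow> ('p \<Rightarrow> 'a) \<Rightarrow> bool" where
  "locally_convex_position G K f \<longleftrightarrow> (\<forall>v\<in>vertices K. convex_position G (star {v} K) f)"

end

theory Submission imports Defs begin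

text \<open>The map is only an immersion, so no inside or outside of the surface is available and
  far apart vertices may a priori have the same image. Global statements therefore concern paths of
  vertices, and geometry enters through single stars only. Two kinds of paths are needed: those in
  \<open>g > 0\<close> survive a small change of \<open>g\<close>, those in \<open>g \<ge> 0\<close>
  survive a limit. Between vertices with \<open>g > 0\<close> they are equivalent as long as no two
  distinct adjacent vertices lie on \<open>g = 0\<close> together, which a segment of functionals in
  general position ensures. Antipodal pairs are a genuine obstacle: no functional is positive at
  both, so being joined would say nothing about them. Closedness makes the star of \<open>x\<close>
  the whole boundary of its tangent cone, since each ridge at \<open>x\<close> has a second facet
  across it; the PL type of the stars gives the facets their dimension. The limit argument at the
  end yields only \<open>n \<le> 0\<close>. That no vertex outside a facet lies on its hyperplane
  takes a second isolation argument, with the vertex set of the facet in place of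
  \<open>v\<close>.\<close>

text \<open>Both geometries are lifted to linear algebra in dimension \<open>d + 1\<close>: a point of the sphere is a
  vector already, and a point \<open>x\<close> of Euclidean space becomes \<open>(x, 1)\<close>. Halfspaces and hemispheres are
  then given by linear functionals \<open>g\<close>. Call two vertices joined by \<open>g\<close> if a path of vertices, any two
  consecutive ones in a common cell, connects them inside \<open>g > 0\<close>. If \<open>g\<close> varies and a vertex \<open>x\<close>
  crosses \<open>g = 0\<close>, the paths through \<open>x\<close> can be rerouted through the part of the link of \<open>x\<close> in
  \<open>g > 0\<close>. This part is connected because the star of \<open>x\<close> is the boundary of a convex cone of
  dimension at least 3. As the functionals positive at two given vertices form a convex set,
  whether the two are joined does not depend on the functional. Induction along a path shows that
  any two vertices are joined, antipodal pairs being excluded on the way. But if \<open>h\<close> supports the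
  star of \<open>v\<close> at \<open>v\<close> only, a small perturbation of \<open>h\<close> isolates \<open>v\<close> from every other vertex, so all
  other vertices satisfy \<open>h < 0\<close>. The supporting functionals of the facets are limits of such \<open>h\<close>.\<close>

subsection \<open>Vertex graphs of locally convex surfaces\<close>

lemma ex_in_open_avoiding_hyperplanes:
  fixes U :: "'e::euclidean_space set"
  assumes "open U" "U \<noteq> {}" "finite A" "0 \<notin> A"
  obtains g where "g \<in> U" "\<And>a. a \<in> A \<Longrightarrow> g \<bullet> a \<noteq> 0"
proof -
  have "negligible (\<Union>a\<in>A. {g. a \<bullet> g = 0})"
    using assms by (intro negligible_Union) (auto intro!: negligible_hyperplane)
  then have "\<not> U \<subseteq> (\<Union>a\<in>A. {g. a \<bullet> g = 0})"
    using open_not_negligible[OF assms(1,2)] negligible_subset by blast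
  then obtain g where "g \<in> U" "g \<notin> (\<Union>a\<in>A. {g. a \<bullet> g = 0})" by blast
  then show thesis using that[of g] by (auto simp: inner_commute)
qed

text \<open>Zero values are left unconstrained: this makes the set open and allows a functional to
  be moved off its zeros.\<close>

lemma open_same_signs:
  fixes F :: "'v \<Rightarrow> 'e::euclidean_space"
  assumes "finite V"
  shows "open {g'. \<forall>x\<in>V. (0 < g \<bullet> F x \<longrightarrow> 0 < g' \<bullet> F x) \<and> (g \<bullet> F x < 0 \<longrightarrow> g' \<bullet> F x < 0)}"
proof -
  have "open {g'. (0 < g \<bullet> F x \<longrightarrow> 0 < g' \<bullet> F x) \<and> (g \<bullet> F x < 0 \<longrightarrow> g' \<bullet> F x < 0)}" for x
  proof (cases "0 < g \<bullet> F x")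
    case True
    then show ?thesis using open_halfspace_gt[of 0 "F x"] by (auto simp: inner_commute)
  next
    case False
    then show ?thesis using open_halfspace_lt[of "F x" 0]
      by (cases "g \<bullet> F x < 0") (auto simp: inner_commute)
  qed
  then have "open (\<Inter>x\<in>V. {g'. (0 < g \<bullet> F x \<longrightarrow> 0 < g' \<bullet> F x) \<and> (g \<bullet> F x < 0 \<longrightarrow> g' \<bullet> F x < 0)})"
    using assms by (intro open_INT) auto
  moreover have "(\<Inter>x\<in>V. {g'. (0 < g \<bullet> F x \<longrightarrow> 0 < g' \<bullet> F x) \<and> (g \<bullet> F x < 0 \<longrightarrow> g' \<bullet> F x < 0)})
    = {g'. \<forall>x\<in>V. (0 < g \<bullet> F x \<longrightarrow> 0 < g' \<bullet> F x) \<and> (g \<bullet> F x < 0 \<longrightarrow> g' \<bullet> F x < 0)}" by auto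
  ultimately show ?thesis by simp
qed

lemma ex_small_perturbation_same_signs:
  fixes F :: "'v \<Rightarrow> 'e::euclidean_space"
  assumes "finite V"
  obtains e where "e > 0"
    "\<And>x. x \<in> V \<Longrightarrow> 0 < g \<bullet> F x \<Longrightarrow> 0 < (g + e *\<^sub>R k) \<bullet> F x"
    "\<And>x. x \<in> V \<Longrightarrow> g \<bullet> F x < 0 \<Longrightarrow> (g + e *\<^sub>R k) \<bullet> F x < 0"
proof -
  let ?U = "{g'. \<forall>x\<in>V. (0 < g \<bullet> F x \<longrightarrow> 0 < g' \<bullet> F x) \<and> (g \<bullet> F x < 0 \<longrightarrow> g' \<bullet> F x < 0)}"
  have "open ?U" "g \<in> ?U" using open_same_signs[OF assms] by auto
  then obtain r where r: "r > 0" "ball g r \<subseteq> ?U" by (meson openE)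
  have k1: "norm k + 1 > 0" by (simp add: add_nonneg_pos)
  \<comment> \<open>The summand 1 covers \<open>k = 0\<close>; the factor 1/2 puts the perturbed
    functional strictly inside the ball.\<close>
  define e where "e = r / (norm k + 1) / 2"
  have "e > 0" unfolding e_def using r k1 by simp
  have "dist g (g + e *\<^sub>R k) = e * norm k" using \<open>e > 0\<close> by (simp add: dist_norm)
  also have "\<dots> \<le> e * (norm k + 1)" using \<open>e > 0\<close> by simp
  also have "\<dots> = r / 2" unfolding e_def using k1 by (simp add: field_simps)
  also have "\<dots> < r" using r by simp
  finally have "g + e *\<^sub>R k \<in> ?U" using r by auto
  with \<open>e > 0\<close> show thesis using that by blast
qed

text \<open>The sum of the unit vectors is the angle bisector, acute to both unless they point in
  opposite directions; that is the equality case of Cauchy-Schwarz excluded by the last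
  hypothesis.\<close>

lemma inner_sgn_add_sgn_pos:
  fixes v w :: "'e::real_inner"
  assumes "v \<noteq> 0" "w \<noteq> 0" "\<And>t. t \<ge> 0 \<Longrightarrow> w \<noteq> - t *\<^sub>R v"
  shows "(sgn v + sgn w) \<bullet> v > 0" "(sgn v + sgn w) \<bullet> w > 0"
proof -
  have "\<not> v \<bullet> w \<le> - (norm v * norm w)"
  proof
    assume "v \<bullet> w \<le> - (norm v * norm w)"
    then have "(- v) \<bullet> w = norm (- v) * norm w"
      using Cauchy_Schwarz_ineq2[of v w] by simp
    then have "norm v *\<^sub>R w = - norm w *\<^sub>R v"
      unfolding norm_cauchy_schwarz_eq by simp
    then have "inverse (norm v) *\<^sub>R norm v *\<^sub>R w = inverse (norm v) *\<^sub>R (- norm w *\<^sub>R v)" by simp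
    then have "w = - (norm w / norm v) *\<^sub>R v" using assms(1) by (simp add: field_simps)
    with assms(3)[of "norm w / norm v"] show False by simp
  qed
  then have *: "v \<bullet> w > - (norm v * norm w)" by simp
  have sgn: "sgn x \<bullet> x = norm x" for x :: 'e
    by (cases "x = 0") (simp_all add: sgn_div_norm power2_norm_eq_inner[symmetric] power2_eq_square)
  have "(sgn v + sgn w) \<bullet> v = (norm v * norm w + v \<bullet> w) / norm w"
    using assms(2) by (simp add: inner_add_left sgn) (simp add: sgn_div_norm inner_commute field_simps)
  then show "(sgn v + sgn w) \<bullet> v > 0" using * assms by simp
  have "(sgn v + sgn w) \<bullet> w = (norm v * norm w + v \<bullet> w) / norm v"
    using assms(1) by (simp add: inner_add_left sgn) (simp add: sgn_div_norm field_simps)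
  then show "(sgn v + sgn w) \<bullet> w > 0" using * assms by simp
qed

text \<open>All that the joining argument needs. \<open>F\<close> is not assumed injective, because
  images of far apart vertices may coincide. The restrictions \<open>y \<noteq> x\<close> leave room
  for \<open>adj x x\<close>, which holds when adjacency means lying in a common cell.\<close>

locale locally_convex_graph =
  fixes V :: "'v set" and F :: "'v \<Rightarrow> 'e::euclidean_space" and adj :: "'v \<Rightarrow> 'v \<Rightarrow> bool"
  assumes finite_V: "finite V"
    and adj_V: "adj x y \<Longrightarrow> x \<in> V \<and> y \<in> V"
    and adj_sym: "adj x y \<Longrightarrow> adj y x"
    and F_nonzero: "x \<in> V \<Longrightarrow> F x \<noteq> 0"
    and exposed: "x \<in> V \<Longrightarrow> \<exists>h. h \<bullet> F x = 0 \<and> (\<forall>y. adj x y \<longrightarrow> y \<noteq> x \<longrightarrow> h \<bullet> F y < 0)"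
    and upper_link: "\<lbrakk>x \<in> V; g \<bullet> F x = 0; \<And>y. adj x y \<Longrightarrow> y \<noteq> x \<Longrightarrow> g \<bullet> F y \<noteq> 0;
        adj x a; adj x b; 0 < g \<bullet> F a; 0 < g \<bullet> F b\<rbrakk>
      \<Longrightarrow> (\<lambda>u w. adj u w \<and> 0 < g \<bullet> F u \<and> 0 < g \<bullet> F w)\<^sup>*\<^sup>* a b"
    and connected: "x \<in> V \<Longrightarrow> y \<in> V \<Longrightarrow> adj\<^sup>*\<^sup>* x y"
begin

definition positively_joined :: "'e \<Rightarrow> 'v \<Rightarrow> 'v \<Rightarrow> bool" where
  "positively_joined g = (\<lambda>u w. adj u w \<and> 0 < g \<bullet> F u \<and> 0 < g \<bullet> F w)\<^sup>*\<^sup>*"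

definition nonneg_joined :: "'e \<Rightarrow> 'v \<Rightarrow> 'v \<Rightarrow> bool" where
  "nonneg_joined g = (\<lambda>u w. adj u w \<and> 0 \<le> g \<bullet> F u \<and> 0 \<le> g \<bullet> F w)\<^sup>*\<^sup>*"

text \<open>Paths in \<open>g \<ge> 0\<close>, because \<open>g\<close> is arbitrary and may vanish
  at adjacent vertices; a nearby generic functional provides a path in its positive part, of which
  only the weak inequalities carry over to \<open>g\<close>.\<close>

definition always_joined :: "'v \<Rightarrow> 'v \<Rightarrow> bool" where
  "always_joined v w \<longleftrightarrow> (\<forall>g. 0 < g \<bullet> F v \<longrightarrow> 0 < g \<bullet> F w \<longrightarrow> nonneg_joined g v w)"

lemma positively_joinedI_nonneg:
  assumes generic: "\<And>x y. adj x y \<Longrightarrow> x \<noteq> y \<Longrightarrow> g \<bullet> F x \<noteq> 0 \<or> g \<bullet> F y \<noteq> 0"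
    and "nonneg_joined g v y" "0 < g \<bullet> F v" "0 < g \<bullet> F y"
  shows "positively_joined g v y"
proof -
  \<comment> \<open>Strengthened for the induction: at a vertex on \<open>g = 0\<close>, keep a
    neighbour in \<open>g > 0\<close> that is already joined to \<open>v\<close>. By
    \<open>generic\<close> the next vertex is positive, or the same one, and the upper link connects
    the kept neighbour to it.\<close>
  have "(0 < g \<bullet> F y \<longrightarrow> positively_joined g v y) \<and>
    (g \<bullet> F y = 0 \<longrightarrow> (\<exists>a. adj y a \<and> 0 < g \<bullet> F a \<and> positively_joined g v a))"
    using assms(2) unfolding nonneg_joined_def
  proof (induction rule: rtranclp_induct)
    case base
    then show ?case using assms(3) by (simp add: positively_joined_def)
  next
    case (step u w)
    consider "0 < g \<bullet> F u" "0 < g \<bullet> F w" | "0 < g \<bullet> F u" "g \<bullet> F w = 0" | "g \<bullet> F u = 0" "u = w"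
      | "g \<bullet> F u = 0" "u \<noteq> w" using step.hyps by linarith
    then show ?case
    proof cases
      case 1
      then have "positively_joined g v w" unfolding positively_joined_def
        using step by (auto simp: positively_joined_def intro: rtranclp.rtrancl_into_rtrancl)
      with 1 show ?thesis by simp
    next
      case 2
      then show ?thesis using step adj_sym by auto
    next
      case 3
      then show ?thesis using step by simp
    next
      case 4
      then have w: "0 < g \<bullet> F w" using generic[of u w] step.hyps by auto
      obtain a where a: "adj u a" "0 < g \<bullet> F a" "positively_joined g v a" using 4 step by auto
      have "positively_joined g a w" unfolding positively_joined_def
        by (rule upper_link[of u]) (use 4 a w step.hyps generic adj_V in auto)
      then have "positively_joined g v w" using a unfolding positively_joined_def by simp
      with w show ?thesis by simp
    qed
  qed
  then show ?thesis using assms(4) by simp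
qed

lemma positively_joined_mono:
  assumes "positively_joined g v y" "\<And>x. x \<in> V \<Longrightarrow> 0 < g \<bullet> F x \<Longrightarrow> 0 < g' \<bullet> F x"
  shows "positively_joined g' v y"
  using assms(1) unfolding positively_joined_def
  by (rule rtranclp_mono[THEN predicate2D, rotated]) (use assms(2) adj_V in auto)

lemma positively_imp_nonneg_joined:
  assumes "positively_joined g v y" "\<And>x. x \<in> V \<Longrightarrow> g' \<bullet> F x < 0 \<Longrightarrow> g \<bullet> F x < 0"
  shows "nonneg_joined g' v y"
  using assms(1) unfolding positively_joined_def nonneg_joined_def
proof (rule rtranclp_mono[THEN predicate2D, rotated], intro predicate2I)
  fix u w assume *: "adj u w \<and> 0 < g \<bullet> F u \<and> 0 < g \<bullet> F w"
  then show "adj u w \<and> 0 \<le> g' \<bullet> F u \<and> 0 \<le> g' \<bullet> F w"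
    using assms(2)[of u] assms(2)[of w] adj_V[of u w] by force
qed

lemma adjacent_not_parallel:
  assumes "adj x y" "x \<noteq> y" "F y = t *\<^sub>R F x" shows False
proof -
  obtain h where "h \<bullet> F x = 0" "\<forall>y. adj x y \<longrightarrow> y \<noteq> x \<longrightarrow> h \<bullet> F y < 0"
    using exposed assms(1) adj_V by meson
  then show False using assms by auto
qed

text \<open>Along a generic segment of functionals being joined is locally constant: a vertex that leaves
  the positive side can be bypassed through its upper link, which is connected.\<close>

lemma always_joinedI:
  assumes nz: "\<And>x. x \<in> V \<Longrightarrow> g0 \<bullet> F x \<noteq> 0"
    and joined: "nonneg_joined g0 v y" and pos0: "0 < g0 \<bullet> F v" "0 < g0 \<bullet> F y"
  shows "always_joined v y"
  unfolding always_joined_def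
proof (intro allI impI)
  fix g assume posg: "0 < g \<bullet> F v" "0 < g \<bullet> F y"
  show "nonneg_joined g v y"
  proof (cases "v = y")
    case True
    then show ?thesis by (simp add: nonneg_joined_def)
  next
    case False
    have joined': "positively_joined g0 v y"
      using positively_joinedI_nonneg joined pos0 nz adj_V by blast
    then have vyV: "v \<in> V" "y \<in> V"
      using False adj_V unfolding positively_joined_def
      by (metis (no_types, lifting) converse_rtranclpE, metis (no_types, lifting) rtranclp.cases)
    \<comment> \<open>The target \<open>g\<close> may be degenerate, so the segment ends at a
      generic \<open>g1\<close> with the same nonzero signs; a path in \<open>g1 > 0\<close> is then
      one in \<open>g \<ge> 0\<close>.\<close>
    let ?U = "{g'. \<forall>x\<in>V. (0 < g \<bullet> F x \<longrightarrow> 0 < g' \<bullet> F x) \<and> (g \<bullet> F x < 0 \<longrightarrow> g' \<bullet> F x < 0)}"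
    \<comment> \<open>\<open>g1\<close> paired with such a vector is the determinant of the values
      of \<open>g0\<close> and \<open>g1\<close> at \<open>x\<close> and \<open>y\<close>; if it is
      nonzero, no functional on the segment vanishes at both. The vector is nonzero because adjacent
      images are not parallel.\<close>
    let ?A = "(\<lambda>(x, y). (g0 \<bullet> F x) *\<^sub>R F y - (g0 \<bullet> F y) *\<^sub>R F x) ` {(x, y). adj x y \<and> x \<noteq> y}"
    have "finite {(x, y). adj x y \<and> x \<noteq> y}"
      by (rule finite_subset[of _ "V \<times> V"]) (use finite_V adj_V in auto)
    moreover have "0 \<notin> ?A"
    proof clarsimp
      fix x y assume xy: "adj x y" "x \<noteq> y" "(g0 \<bullet> F x) *\<^sub>R F y = (g0 \<bullet> F y) *\<^sub>R F x"
      have "F y = ((g0 \<bullet> F y) / (g0 \<bullet> F x)) *\<^sub>R F x"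
        using xy(3) nz[of x] adj_V[OF xy(1)]
        by (metis (no_types, lifting) divide_inverse_commute right_inverse scaleR_one scaleR_scaleR mult.commute)
      then show False using adjacent_not_parallel[OF xy(1,2)] by blast
    qed
    moreover have "open ?U" "?U \<noteq> {}" using open_same_signs[OF finite_V] by auto
    ultimately obtain g1 where g1U: "g1 \<in> ?U" and g1: "\<And>a. a \<in> ?A \<Longrightarrow> g1 \<bullet> a \<noteq> 0"
      using ex_in_open_avoiding_hyperplanes[of ?U ?A] by (metis (no_types, lifting) finite_imageI)
    define s where "s t = (1 - t) *\<^sub>R g0 + t *\<^sub>R g1" for t :: real
    have s_inner: "s t \<bullet> F x = (1 - t) * (g0 \<bullet> F x) + t * (g1 \<bullet> F x)" for t x
      by (simp add: s_def inner_add_left)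
    have generic: "s t \<bullet> F x \<noteq> 0 \<or> s t \<bullet> F y \<noteq> 0" if xy: "adj x y" "x \<noteq> y" for t x y
    proof (rule ccontr)
      assume bad: "\<not> ?thesis"
      then have "(1 - t) * (g0 \<bullet> F x) + t * (g1 \<bullet> F x) = 0" "(1 - t) * (g0 \<bullet> F y) + t * (g1 \<bullet> F y) = 0"
        by (simp_all add: s_inner)
      then have "t * ((g0 \<bullet> F x) * (g1 \<bullet> F y) - (g0 \<bullet> F y) * (g1 \<bullet> F x)) = 0" by algebra
      moreover have "g1 \<bullet> ((g0 \<bullet> F x) *\<^sub>R F y - (g0 \<bullet> F y) *\<^sub>R F x) \<noteq> 0"
        by (rule g1) (use xy in auto)
      ultimately have "t = 0" by (simp add: inner_diff_right)
      then show False using bad nz adj_V[OF xy(1)] by (simp add: s_def)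
    qed
    have pos: "0 < s t \<bullet> F x" if "t \<in> {0..1}" "0 < g0 \<bullet> F x" "0 < g1 \<bullet> F x" for t x
    proof (cases "t = 0")
      case True
      then show ?thesis using that by (simp add: s_inner)
    next
      case False
      then have "0 < t * (g1 \<bullet> F x)" "0 \<le> (1 - t) * (g0 \<bullet> F x)" using that by auto
      then show ?thesis by (simp add: s_inner)
    qed
    \<comment> \<open>A path positive for \<open>s t\<close> stays positive for nearby
      \<open>t'\<close>. Conversely a path positive for \<open>s t'\<close> is nonnegative for
      \<open>s t\<close>, and \<open>positively_joinedI_nonneg\<close> makes it strict.\<close>
    have "eventually (\<lambda>t'. positively_joined (s t) v y = positively_joined (s t') v y) (at t within {0..1})"
      if t: "t \<in> {0..1}" for t
    proof -
      have lim: "((\<lambda>t'. s t' \<bullet> F x) \<longlongrightarrow> s t \<bullet> F x) (at t within {0..1})" for x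
        unfolding s_inner by (intro tendsto_intros)
      have "eventually (\<lambda>t'. (0 < s t \<bullet> F x \<longrightarrow> 0 < s t' \<bullet> F x) \<and> (s t \<bullet> F x < 0 \<longrightarrow> s t' \<bullet> F x < 0))
          (at t within {0..1})" for x
        using order_tendstoD(1)[OF lim, of 0 x] order_tendstoD(2)[OF lim, of x 0]
        by (cases "0 < s t \<bullet> F x"; cases "s t \<bullet> F x < 0") (auto elim: eventually_mono)
      then have "eventually (\<lambda>t'. \<forall>x\<in>V. (0 < s t \<bullet> F x \<longrightarrow> 0 < s t' \<bullet> F x) \<and> (s t \<bullet> F x < 0 \<longrightarrow> s t' \<bullet> F x < 0))
          (at t within {0..1})"
        using finite_V by (simp add: eventually_ball_finite)
      then show ?thesis
      proof (rule eventually_mono, intro iffI)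
        fix t' assume near: "\<forall>x\<in>V. (0 < s t \<bullet> F x \<longrightarrow> 0 < s t' \<bullet> F x) \<and> (s t \<bullet> F x < 0 \<longrightarrow> s t' \<bullet> F x < 0)"
        show "positively_joined (s t') v y" if "positively_joined (s t) v y"
          using positively_joined_mono[OF that] near by blast
        show "positively_joined (s t) v y" if "positively_joined (s t') v y"
        proof (rule positively_joinedI_nonneg[OF generic])
          show "nonneg_joined (s t) v y" using positively_imp_nonneg_joined[OF that] near by blast
        qed (use pos t pos0 posg g1U vyV in auto)
      qed
    qed
    then have "positively_joined (s 0) v y = positively_joined (s 1) v y"
      by (intro connected_local_const[where f = "\<lambda>t. positively_joined (s t) v y" and A = "{0..1}"]) auto
    then have "positively_joined g1 v y" using joined' by (simp add: s_def)
    then show ?thesis using positively_imp_nonneg_joined g1U by blast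
  qed
qed

lemma nonneg_joined_sym: "nonneg_joined g v w \<Longrightarrow> nonneg_joined g w v"
  unfolding nonneg_joined_def
  by (rule sympD[OF symp_rtranclp]) (auto simp: symp_def intro: adj_sym)

lemma always_joined_sym: "always_joined v w \<Longrightarrow> always_joined w v"
  unfolding always_joined_def using nonneg_joined_sym by blast

lemma always_joined_exposed_neg:
  assumes "always_joined v w" "v \<in> V" "w \<in> V" "w \<noteq> v"
    and antipodal: "\<And>t. t \<ge> 0 \<Longrightarrow> F w \<noteq> - t *\<^sub>R F v"
    and h: "h \<bullet> F v = 0" "\<And>y. adj v y \<Longrightarrow> y \<noteq> v \<Longrightarrow> h \<bullet> F y < 0"
  shows "h \<bullet> F w < 0"
proof (rule ccontr)
  assume *: "\<not> h \<bullet> F w < 0"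
  \<comment> \<open>The tilt has to be positive at \<open>v\<close> and also at \<open>w\<close>,
    where \<open>h\<close> may vanish; the bisector does this because \<open>F v\<close> and
    \<open>F w\<close> are not opposite.\<close>
  define k where "k = sgn (F v) + sgn (F w)"
  have k: "k \<bullet> F v > 0" "k \<bullet> F w > 0"
    unfolding k_def using inner_sgn_add_sgn_pos[of "F v" "F w"] F_nonzero antipodal assms(2,3) by auto
  obtain e where e: "e > 0" "\<And>x. x \<in> V \<Longrightarrow> h \<bullet> F x < 0 \<Longrightarrow> (h + e *\<^sub>R k) \<bullet> F x < 0"
    using ex_small_perturbation_same_signs[OF finite_V] by metis
  let ?g = "h + e *\<^sub>R k"
  have "0 < ?g \<bullet> F v" using h e k by (simp add: inner_add_left)
  moreover have "0 < ?g \<bullet> F w"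
    using * mult_pos_pos[OF e(1) k(2)] unfolding inner_add_left inner_scaleR_left by linarith
  ultimately have "nonneg_joined ?g v w" using assms(1) unfolding always_joined_def by blast
  \<comment> \<open>Every other neighbour of \<open>v\<close> stays negative after the tilt, so a
    nonnegative path never leaves \<open>v\<close>.\<close>
  then have "w = v" unfolding nonneg_joined_def
  proof (induction rule: rtranclp_induct)
    case (step y z)
    then show ?case using h(2)[of z] e(2)[of z] adj_V by force
  qed simp
  then show False using assms by simp
qed

text \<open>If an edge \<open>y z\<close> leads from a vertex joined to \<open>v\<close>, the functional exposing \<open>y\<close> is negative at
  both \<open>v\<close> and \<open>z\<close>; a slight tilt of its negative is then positive at all three vertices.\<close>

lemma always_joined_all:
  assumes "v \<in> V" "w \<in> V"
  shows "always_joined v w \<and> (\<forall>t\<ge>0. F w \<noteq> - t *\<^sub>R F v)"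
  using connected[OF assms]
proof (induction rule: rtranclp_induct)
  case base
  have "F v \<noteq> - t *\<^sub>R F v" if "t \<ge> 0" for t
  proof
    assume "F v = - t *\<^sub>R F v"
    from arg_cong[OF this, of "\<lambda>x. x + t *\<^sub>R F v"] have "(1 + t) *\<^sub>R F v = 0"
      by (simp add: scaleR_left_distrib)
    then show False using F_nonzero assms(1) that by auto
  qed
  then show ?case by (auto simp: always_joined_def nonneg_joined_def)
next
  case (step y z)
  note yz = adj_V[OF \<open>adj y z\<close>]
  obtain h where h: "h \<bullet> F y = 0" "\<And>u. adj y u \<Longrightarrow> u \<noteq> y \<Longrightarrow> h \<bullet> F u < 0"
    using exposed yz by meson
  show ?case
  proof (cases "z = y \<or> y = v")
    case True
    have "always_joined v z" if "y = v"
      using step.hyps that unfolding always_joined_def nonneg_joined_def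
      by (auto intro!: r_into_rtranclp)
    moreover have "F z \<noteq> - t *\<^sub>R F v" if "y = v" "z \<noteq> y" for t
      using adjacent_not_parallel[of v z "- t"] step.hyps that by blast
    ultimately show ?thesis using True step.IH by auto
  next
    case False
    \<comment> \<open>\<open>always_joined_exposed_neg\<close> is applied at \<open>y\<close> with
      target \<open>v\<close>, so the exclusion of antipodality is needed with the roles
      exchanged.\<close>
    have anti: "F v \<noteq> - t *\<^sub>R F y" if "t \<ge> 0" for t
    proof
      assume eq: "F v = - t *\<^sub>R F y"
      then have "t \<noteq> 0" using F_nonzero assms by auto
      then have "F y = - (1 / t) *\<^sub>R F v" using eq by simp
      moreover have "1 / t \<ge> 0" using that by simp
      ultimately show False using step.IH by blast
    qed
    have hv: "h \<bullet> F v < 0"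
      using always_joined_exposed_neg[of y v h] always_joined_sym step.IH False h anti assms yz by blast
    have hz: "h \<bullet> F z < 0" using h False step.hyps by auto
    \<comment> \<open>\<open>h\<close> is negative at both vertices, which opposite vectors do not
      allow.\<close>
    have "F z \<noteq> - t *\<^sub>R F v" if "t \<ge> 0" for t
    proof
      assume "F z = - t *\<^sub>R F v"
      then have "h \<bullet> F z = - t * (h \<bullet> F v)" by simp
      moreover have "t * (h \<bullet> F v) \<le> 0" using hv that by (simp add: mult_nonneg_nonpos)
      ultimately show False using hz by simp
    qed
    moreover have "always_joined v z"
    proof -
      obtain e where e: "e > 0" "\<And>x. x \<in> V \<Longrightarrow> 0 < - h \<bullet> F x \<Longrightarrow> 0 < (- h + e *\<^sub>R F y) \<bullet> F x"
        using ex_small_perturbation_same_signs[OF finite_V] by metis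
      define k where "k = - h + e *\<^sub>R F y"
      have k: "0 < k \<bullet> F v" "0 < k \<bullet> F z" "0 < k \<bullet> F y"
        using e(2)[of v] e(2)[of z] hv hz assms yz e(1) h F_nonzero[of y]
        by (auto simp: k_def inner_add_left inner_diff_left)
      \<comment> \<open>\<open>always_joinedI\<close> starts from a functional vanishing at no
        vertex, so \<open>k\<close> is moved within its sign class.\<close>
      let ?U = "{g'. \<forall>x\<in>V. (0 < k \<bullet> F x \<longrightarrow> 0 < g' \<bullet> F x) \<and> (k \<bullet> F x < 0 \<longrightarrow> g' \<bullet> F x < 0)}"
      have "open ?U" by (rule open_same_signs[OF finite_V])
      moreover have "k \<in> ?U" by simp
      moreover have "0 \<notin> F ` V" using F_nonzero by force
      ultimately obtain g where g: "g \<in> ?U" "\<And>x. x \<in> V \<Longrightarrow> g \<bullet> F x \<noteq> 0"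
        using ex_in_open_avoiding_hyperplanes[of ?U "F ` V"] finite_V
        by (metis (no_types, lifting) empty_iff finite_imageI imageI)
      have g_pos: "0 < g \<bullet> F v" "0 < g \<bullet> F z" "0 < g \<bullet> F y" using g k assms yz by auto
      then have "nonneg_joined g v y" using step.IH unfolding always_joined_def by blast
      then have "nonneg_joined g v z" using step.hyps g_pos unfolding nonneg_joined_def
        by (auto intro: rtranclp.rtrancl_into_rtrancl)
      then show ?thesis using always_joinedI g g_pos by blast
    qed
    ultimately show ?thesis by blast
  qed
qed

lemma exposed_neg:
  assumes "v \<in> V" "w \<in> V" "w \<noteq> v" "h \<bullet> F v = 0" "\<And>y. adj v y \<Longrightarrow> y \<noteq> v \<Longrightarrow> h \<bullet> F y < 0"
  shows "h \<bullet> F w < 0"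
  using always_joined_exposed_neg always_joined_all assms by blast

text \<open>The isolation argument with a set in place of one vertex: after the tilt no nonnegative
  path leaves \<open>S\<close>. It serves to exclude further vertices on the hyperplane of a
  facet.\<close>

lemma exposed_set_neg:
  assumes "S \<subseteq> V" "v \<in> S" "w \<in> V" "w \<notin> S" "\<And>y. y \<in> S \<Longrightarrow> n \<bullet> F y = 0"
    and n: "\<And>x y. x \<in> S \<Longrightarrow> adj x y \<Longrightarrow> y \<notin> S \<Longrightarrow> n \<bullet> F y < 0"
  shows "n \<bullet> F w < 0"
proof (rule ccontr)
  assume *: "\<not> n \<bullet> F w < 0"
  have vV: "v \<in> V" using assms by auto
  define k where "k = sgn (F v) + sgn (F w)"
  have k: "k \<bullet> F v > 0" "k \<bullet> F w > 0"
    unfolding k_def using inner_sgn_add_sgn_pos[of "F v" "F w"] F_nonzero always_joined_all vV assms(3) by auto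
  obtain e where e: "e > 0" "\<And>x. x \<in> V \<Longrightarrow> n \<bullet> F x < 0 \<Longrightarrow> (n + e *\<^sub>R k) \<bullet> F x < 0"
    using ex_small_perturbation_same_signs[OF finite_V] by metis
  let ?g = "n + e *\<^sub>R k"
  have "0 < ?g \<bullet> F v" using assms e k by (simp add: inner_add_left)
  moreover have "0 < ?g \<bullet> F w"
    using * mult_pos_pos[OF e(1) k(2)] unfolding inner_add_left inner_scaleR_left by linarith
  ultimately have "nonneg_joined ?g v w" using always_joined_all[OF vV assms(3)] unfolding always_joined_def by blast
  then have "w \<in> S" unfolding nonneg_joined_def
  proof (induction rule: rtranclp_induct)
    case (step y z)
    then show ?case using n[of y z] e(2)[of z] adj_V by force
  qed (use assms in simp)
  then show False using assms by simp
qed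

end

subsection \<open>Upper links\<close>

text \<open>Coefficients are attached to indices rather than to vectors, so \<open>F\<close> need
  not be injective on \<open>S\<close>.\<close>

definition conic_span :: "('v \<Rightarrow> 'e::real_vector) \<Rightarrow> 'v set \<Rightarrow> 'e set" where
  "conic_span F S = {p. \<exists>c. (\<forall>v\<in>S. 0 \<le> c v) \<and> p = (\<Sum>v\<in>S. c v *\<^sub>R F v)}"

lemma conic_spanE:
  assumes "p \<in> conic_span F S"
  obtains c where "\<And>v. v \<in> S \<Longrightarrow> (0::real) \<le> c v" "p = (\<Sum>v\<in>S. c v *\<^sub>R F v)"
  using assms unfolding conic_span_def by auto

lemma conic_span_add_generator:
  assumes "p \<in> conic_span F S" "finite S" "x \<in> S" "0 \<le> t"
  shows "p + t *\<^sub>R F x \<in> conic_span F S"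
proof -
  obtain c where c: "\<And>v. v \<in> S \<Longrightarrow> (0::real) \<le> c v" "p = (\<Sum>v\<in>S. c v *\<^sub>R F v)"
    using assms(1) by (rule conic_spanE) blast
  have "(\<Sum>v\<in>S. (c v + (if v = x then t else 0)) *\<^sub>R F v) = p + (\<Sum>v\<in>S. (if v = x then t else 0) *\<^sub>R F v)"
    by (simp add: scaleR_left_distrib sum.distrib c(2))
  also have "(\<Sum>v\<in>S. (if v = x then t else 0) *\<^sub>R F v) = t *\<^sub>R F x"
    using assms by (simp add: if_distrib[of "\<lambda>r. r *\<^sub>R _"] sum.delta cong: if_cong)
  finally have "p + t *\<^sub>R F x = (\<Sum>v\<in>S. (c v + (if v = x then t else 0)) *\<^sub>R F v)" ..
  moreover have "\<forall>v\<in>S. 0 \<le> c v + (if v = x then t else 0)" using c assms by auto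
  ultimately show ?thesis unfolding conic_span_def
    by (intro CollectI exI[of _ "\<lambda>v. c v + (if v = x then t else 0)"]) auto
qed

text \<open>The sets in \<open>T\<close> are the vertex sets of the facets around \<open>x\<close>. A segment \<open>a b\<close> is pushed off the
  cone spanned by the star along the direction \<open>-z\<close> for an interior point \<open>z\<close> until it reaches the
  boundary. Choosing \<open>z\<close> outside the span of \<open>a\<close>, \<open>b\<close>, \<open>x\<close>, which requires dimension at least 4,
  keeps the resulting path away from the line through \<open>x\<close>.\<close>

lemma upper_link_connected:
  fixes F :: "'v \<Rightarrow> 'e::euclidean_space"
  assumes dim: "DIM('e) \<ge> 4"
    and fin: "finite T" "\<And>\<tau>. \<tau> \<in> T \<Longrightarrow> finite \<tau>" and xT: "\<And>\<tau>. \<tau> \<in> T \<Longrightarrow> x \<in> \<tau>"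
    and n0: "\<And>\<tau> y. \<tau> \<in> T \<Longrightarrow> y \<in> \<tau> \<Longrightarrow> n \<tau> \<bullet> F y = 0"
    and nneg: "\<And>\<tau> y. \<tau> \<in> T \<Longrightarrow> y \<in> \<Union>T \<Longrightarrow> y \<notin> \<tau> \<Longrightarrow> n \<tau> \<bullet> F y < 0"
    and opp: "\<And>\<tau>. \<tau> \<in> T \<Longrightarrow> \<exists>y\<in>\<Union>T. y \<notin> \<tau>"
    and cover: "\<And>\<tau> q. \<tau> \<in> T \<Longrightarrow> n \<tau> \<bullet> q = 0 \<Longrightarrow> (\<And>\<tau>'. \<tau>' \<in> T \<Longrightarrow> n \<tau>' \<bullet> q \<le> 0) \<Longrightarrow>
      \<exists>l\<ge>0. q + l *\<^sub>R F x \<in> conic_span F \<tau>"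
    and inter: "\<And>\<tau> \<tau>' p. \<tau> \<in> T \<Longrightarrow> \<tau>' \<in> T \<Longrightarrow> p \<in> conic_span F \<tau> \<Longrightarrow> p \<in> conic_span F \<tau>' \<Longrightarrow>
      p \<in> conic_span F (\<tau> \<inter> \<tau>')"
    and g: "g \<bullet> F x = 0" "\<And>y. y \<in> \<Union>T \<Longrightarrow> y \<noteq> x \<Longrightarrow> g \<bullet> F y \<noteq> 0"
    and ab: "a \<in> \<Union>T" "b \<in> \<Union>T" "0 < g \<bullet> F a" "0 < g \<bullet> F b"
  shows "(\<lambda>u w. (\<exists>\<tau>\<in>T. u \<in> \<tau> \<and> w \<in> \<tau>) \<and> 0 < g \<bullet> F u \<and> 0 < g \<bullet> F w)\<^sup>*\<^sup>* a b"
    (is "?R\<^sup>*\<^sup>* a b")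
proof -
  have nle: "n \<tau> \<bullet> F y \<le> 0" if "\<tau> \<in> T" "y \<in> \<Union>T" for \<tau> y
    using n0[of \<tau> y] nneg[of \<tau> y] that by (cases "y \<in> \<tau>") auto
  have finU: "finite (\<Union>T)" using fin by auto
  \<comment> \<open>Interior to the cone cut out by the normals, since every facet misses some
    vertex of the star.\<close>
  define z0 where "z0 = (\<Sum>y\<in>\<Union>T. F y)"
  have z0: "n \<tau> \<bullet> z0 < 0" if "\<tau> \<in> T" for \<tau>
  proof -
    have "(\<Sum>y\<in>\<Union>T. n \<tau> \<bullet> F y) < (\<Sum>y\<in>\<Union>T. 0)"
      using finU nle[OF that] nneg[OF that] opp[OF that] by (intro sum_strict_mono_ex1) blast+
    then show ?thesis unfolding z0_def inner_sum_right by simp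
  qed
  \<comment> \<open>\<open>w\<close> certifies that \<open>z\<close>, chosen below with
    \<open>z \<bullet> w \<noteq> 0\<close>, lies outside the span of \<open>F a\<close>,
    \<open>F b\<close>, \<open>F x\<close>.\<close>
  obtain w where w: "w \<noteq> 0" "w \<bullet> F a = 0" "w \<bullet> F b = 0" "w \<bullet> F x = 0"
  proof -
    have "dim {F a, F b, F x} \<le> card {F a, F b, F x}" by (rule dim_le_card') simp
    also have "\<dots> \<le> 3" by (simp add: card_insert_if)
    finally have "dim {F a, F b, F x} < DIM('e)" using dim by simp
    then obtain w where "w \<noteq> 0" "\<And>y. y \<in> span {F a, F b, F x} \<Longrightarrow> orthogonal w y"
      by (rule orthogonal_to_subspace_exists) blast
    then show thesis using that by (auto simp: orthogonal_def span_base)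
  qed
  \<comment> \<open>If some vertex lies below \<open>g = 0\<close>, then \<open>z\<close> can also
    be taken there, and pushing along \<open>-z\<close> does not decrease \<open>g\<close>.
    Otherwise all vertices of the star but \<open>x\<close> are in \<open>g > 0\<close>, and it
    suffices that two facets meet in more than \<open>x\<close>.\<close>
  define low where "low \<longleftrightarrow> (\<exists>c\<in>\<Union>T. g \<bullet> F c < 0)"
  let ?U = "{z. (\<forall>\<tau>\<in>T. n \<tau> \<bullet> z < 0) \<and> (low \<longrightarrow> g \<bullet> z < 0)}"
  have "?U \<noteq> {}"
  proof (cases low)
    case True
    then obtain c where c: "c \<in> \<Union>T" "g \<bullet> F c < 0" unfolding low_def by blast
    obtain e where e: "e > 0" "(F c + e *\<^sub>R z0) \<bullet> g < 0"
      using ex_small_perturbation_same_signs[of "{()}" "F c" "\<lambda>_. g" z0] c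
      by (auto simp: inner_commute)
    have 1: "n \<tau> \<bullet> (F c + e *\<^sub>R z0) < 0" if "\<tau> \<in> T" for \<tau>
      using nle[OF that c(1)] mult_pos_neg[OF e(1) z0[OF that]]
      unfolding inner_add_right inner_scaleR_right by linarith
    have 2: "g \<bullet> (F c + e *\<^sub>R z0) < 0" using e(2) by (simp only: inner_commute)
    have "F c + e *\<^sub>R z0 \<in> ?U" using 1 2 by simp
    then show ?thesis by blast
  next
    case False
    then show ?thesis using z0 by blast
  qed
  moreover have "open ?U"
  proof -
    have "?U = (\<Inter>\<tau>\<in>T. {z. n \<tau> \<bullet> z < 0}) \<inter> (if low then {z. g \<bullet> z < 0} else UNIV)" by auto
    moreover have "open \<dots>"
      using fin(1) by (intro open_Int open_INT) (auto simp: open_halfspace_lt)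
    ultimately show ?thesis by simp
  qed
  ultimately obtain z where zU: "z \<in> ?U" and zw: "z \<bullet> w \<noteq> 0"
    using ex_in_open_avoiding_hyperplanes[of ?U "{w}"] w(1) by auto
  have z: "n \<tau> \<bullet> z < 0" if "\<tau> \<in> T" for \<tau> using zU that by blast
  define y where "y t = (1 - t) *\<^sub>R F a + t *\<^sub>R F b" for t :: real
  have ny: "n \<tau> \<bullet> y t \<le> 0" if "\<tau> \<in> T" "t \<in> {0..1}" for \<tau> t
  proof -
    have "(1 - t) * (n \<tau> \<bullet> F a) \<le> 0" "t * (n \<tau> \<bullet> F b) \<le> 0"
      using nle[OF that(1)] ab that by (auto intro!: mult_nonneg_nonpos)
    then show ?thesis by (simp add: y_def inner_add_right)
  qed
  have gy: "0 < g \<bullet> y t" if "t \<in> {0..1}" for t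
  proof (cases "t = 0")
    case True
    then show ?thesis using ab by (simp add: y_def)
  next
    case False
    then have "0 < t * (g \<bullet> F b)" "0 \<le> (1 - t) * (g \<bullet> F a)" using that ab by auto
    then show ?thesis by (simp add: y_def inner_add_right)
  qed
  \<comment> \<open>The time at which a point moving from \<open>y t\<close> along \<open>-z\<close>
    meets the hyperplane of \<tau>. It leaves the cone at the facet with the least time, and
    \<open>I \<tau>\<close> collects the \<open>t\<close> for which \<tau> attains it.\<close>
  define r where "r \<tau> t = (n \<tau> \<bullet> y t) / (n \<tau> \<bullet> z)" for \<tau> t
  have r_nonneg: "0 \<le> r \<tau> t" if "\<tau> \<in> T" "t \<in> {0..1}" for \<tau> t
    unfolding r_def using ny[OF that] z[OF that(1)] by (simp add: divide_nonpos_neg)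
  define I where "I \<tau> = {t. \<forall>\<tau>'\<in>T. r \<tau> t \<le> r \<tau>' t}" for \<tau>
  have contr: "continuous_on UNIV (r \<tau>)" for \<tau>
    unfolding r_def y_def divide_inverse by (intro continuous_intros)
  have closedI: "closed (I \<tau>)" for \<tau>
    unfolding I_def Ball_def Collect_all_eq
    by (intro closed_INT ballI closed_Collect_imp open_Collect_const closed_Collect_le contr)
  have common: "\<exists>c\<in>\<tau> \<inter> \<tau>'. 0 < g \<bullet> F c"
    if t: "t \<in> {0..1}" and \<tau>: "\<tau> \<in> T" "\<tau>' \<in> T" "t \<in> I \<tau>" "t \<in> I \<tau>'" for t \<tau> \<tau>'
  proof -
    define q where "q = y t - r \<tau> t *\<^sub>R z"
    have eq: "r \<tau>' t = r \<tau> t" using \<tau> by (auto simp: I_def intro: antisym)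
    have nq: "n \<rho> \<bullet> q = (r \<rho> t - r \<tau> t) * (n \<rho> \<bullet> z)" if "\<rho> \<in> T" for \<rho>
      using z[OF that] by (simp add: q_def r_def inner_diff_right field_simps)
    have nq_le: "n \<rho> \<bullet> q \<le> 0" if "\<rho> \<in> T" for \<rho>
      unfolding nq[OF that] using z[OF that] \<tau>(3) that by (auto simp: I_def intro!: mult_nonneg_nonpos)
    obtain l where l: "l \<ge> 0" "q + l *\<^sub>R F x \<in> conic_span F \<tau>"
      using cover[of \<tau> q] nq[of \<tau>] nq_le \<tau> by auto
    obtain l' where l': "l' \<ge> 0" "q + l' *\<^sub>R F x \<in> conic_span F \<tau>'"
      using cover[of \<tau>' q] nq[of \<tau>'] nq_le \<tau> eq by auto
    \<comment> \<open>\<open>cover\<close> gives each cone its own shift along \<open>F x\<close>.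
      The sum of the shifts puts one point into both cones, without changing \<open>g\<close>
      because \<open>g \<bullet> F x = 0\<close>.\<close>
    define p where "p = q + (l + l') *\<^sub>R F x"
    have "p \<in> conic_span F \<tau>"
      using conic_span_add_generator[OF l(2) fin(2) xT l'(1)] \<tau>
      by (simp add: p_def scaleR_left_distrib add.assoc)
    moreover have "p \<in> conic_span F \<tau>'"
      using conic_span_add_generator[OF l'(2) fin(2) xT l(1)] \<tau>
      by (simp add: p_def scaleR_left_distrib add_ac)
    ultimately have "p \<in> conic_span F (\<tau> \<inter> \<tau>')" using inter \<tau> by blast
    then obtain c where c: "\<And>v. v \<in> \<tau> \<inter> \<tau>' \<Longrightarrow> (0::real) \<le> c v" "p = (\<Sum>v\<in>\<tau> \<inter> \<tau>'. c v *\<^sub>R F v)"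
      by (rule conic_spanE) blast
    have gp: "g \<bullet> p = (\<Sum>v\<in>\<tau> \<inter> \<tau>'. c v * (g \<bullet> F v))" by (simp add: c(2) inner_sum_right)
    have gpq: "g \<bullet> p = g \<bullet> q" by (simp add: p_def inner_add_right g)
    show ?thesis
    proof (cases low)
      case True
      then have "r \<tau> t * (g \<bullet> z) \<le> 0"
        using zU r_nonneg[OF \<tau>(1) t] by (intro mult_nonneg_nonpos) (auto intro: less_imp_le)
      then have "0 < g \<bullet> p" using gy[OF t] unfolding gpq by (simp add: q_def inner_diff_right)
      show ?thesis
      proof (rule ccontr)
        assume "\<not> ?thesis"
        then have "g \<bullet> p \<le> 0" unfolding gp using c(1) by (intro sum_nonpos mult_nonneg_nonpos) (auto simp: not_less)
        with \<open>0 < g \<bullet> p\<close> show False by simp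
      qed
    next
      case False
      have pos: "0 < g \<bullet> F v" if "v \<in> \<Union>T" "v \<noteq> x" for v
        using False g(2)[OF that] that unfolding low_def by force
      show ?thesis
      proof (rule ccontr)
        assume "\<not> ?thesis"
        then have "\<tau> \<inter> \<tau>' \<subseteq> {x}" using pos \<tau> by blast
        then have "\<tau> \<inter> \<tau>' = {x}" using xT \<tau> by blast
        then have "p = c x *\<^sub>R F x" using c(2) by simp
        \<comment> \<open>Now \<open>q\<close> is a multiple of \<open>F x\<close>, hence killed by
          \<open>w\<close>, as is \<open>y t\<close>. So no push took place and
          \<open>q = y t\<close>, although \<open>g\<close> is positive at \<open>y t\<close> and
          zero at \<open>q\<close>.\<close>
        then have q: "q = (c x - (l + l')) *\<^sub>R F x" by (simp add: p_def algebra_simps)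
        have "w \<bullet> y t = 0" by (simp add: y_def inner_add_right w)
        moreover have "w \<bullet> q = 0" by (simp add: q w)
        ultimately have "r \<tau> t * (w \<bullet> z) = 0" by (simp add: q_def inner_diff_right)
        then have "r \<tau> t = 0" using zw by (simp add: inner_commute)
        then have "g \<bullet> y t = g \<bullet> q" by (simp add: q_def)
        then show False using gy[OF t] by (simp add: q g)
      qed
    qed
  qed
  \<comment> \<open>Facets are sorted by whether all their positive vertices are reached from
    \<open>a\<close>. The closed parameter sets \<open>A\<close> and \<open>B\<close> do not meet in
    the unit interval, by \<open>common\<close>, so connectedness leaves only one of them.\<close>
  define P where "P \<tau> \<longleftrightarrow> (\<forall>u\<in>\<tau>. 0 < g \<bullet> F u \<longrightarrow> ?R\<^sup>*\<^sup>* a u)" for \<tau>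
  define A where "A = (\<Union>\<tau>\<in>{\<tau>\<in>T. P \<tau>}. I \<tau>)"
  define B where "B = (\<Union>\<tau>\<in>{\<tau>\<in>T. \<not> P \<tau>}. I \<tau>)"
  have "closed A" "closed B" unfolding A_def B_def using fin closedI by auto
  moreover have "{0..1} \<subseteq> A \<union> B"
  proof
    fix t :: real
    have "T \<noteq> {}" using ab by auto
    then obtain \<tau> where "\<tau> \<in> T" "\<And>\<tau>'. \<tau>' \<in> T \<Longrightarrow> r \<tau> t \<le> r \<tau>' t"
      using arg_min_if_finite[OF fin(1), of "\<lambda>\<tau>. r \<tau> t"] by (meson not_le)
    then show "t \<in> A \<union> B" unfolding A_def B_def I_def by blast
  qed
  moreover have "A \<inter> B \<inter> {0..1} = {}"
  proof (rule ccontr)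
    assume "A \<inter> B \<inter> {0..1} \<noteq> {}"
    then obtain t \<tau> \<tau>' where t: "t \<in> {0..1}" "\<tau> \<in> T" "\<tau>' \<in> T" "t \<in> I \<tau>" "t \<in> I \<tau>'" "P \<tau>" "\<not> P \<tau>'"
      unfolding A_def B_def by blast
    obtain c where c: "c \<in> \<tau>" "c \<in> \<tau>'" "0 < g \<bullet> F c" using common[OF t(1-5)] by blast
    then have ac: "?R\<^sup>*\<^sup>* a c" using t(6) P_def by blast
    have "?R\<^sup>*\<^sup>* a u" if "u \<in> \<tau>'" "0 < g \<bullet> F u" for u
    proof -
      have "?R c u" using c that t(3) by blast
      with ac show ?thesis by (rule rtranclp.rtrancl_into_rtrancl)
    qed
    then show False using t(7) P_def by blast
  qed
  ultimately have dis: "A \<inter> {0..1} = {} \<or> B \<inter> {0..1} = {}"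
    using connected_closedD[of "{0..1::real}" A B] by (simp add: Int_ac)
  \<comment> \<open>\<open>a\<close> and \<open>b\<close> already lie on the boundary, so their exit
    time is 0, the least possible.\<close>
  have end_in: "t \<in> I \<tau>" if "\<tau> \<in> T" "n \<tau> \<bullet> y t = 0" "t \<in> {0..1}" for \<tau> t
    using r_nonneg that by (simp add: I_def r_def)
  obtain \<tau>a \<tau>b where \<tau>ab: "\<tau>a \<in> T" "a \<in> \<tau>a" "\<tau>b \<in> T" "b \<in> \<tau>b" using ab by blast
  have "P \<tau>a" unfolding P_def using \<tau>ab ab by (auto intro!: r_into_rtranclp)
  moreover have "0 \<in> I \<tau>a" by (rule end_in) (use \<tau>ab n0 in \<open>auto simp: y_def\<close>)
  ultimately have "A \<inter> {0..1} \<noteq> {}" using \<tau>ab unfolding A_def by auto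
  then have "B \<inter> {0..1} = {}" using dis by blast
  moreover have "1 \<in> I \<tau>b" by (rule end_in) (use \<tau>ab n0 in \<open>auto simp: y_def\<close>)
  ultimately have "P \<tau>b" using \<tau>ab unfolding B_def by auto
  then show ?thesis using \<tau>ab ab unfolding P_def by blast
qed

subsection \<open>Polytopes as cross-sections of cones\<close>

lemma convex_conic_span: "convex (conic_span F S)"
proof (rule convexI)
  fix p q and s t :: real
  assume "p \<in> conic_span F S" "q \<in> conic_span F S" and st: "0 \<le> s" "0 \<le> t" "s + t = 1"
  then obtain c d where c: "\<And>v. v \<in> S \<Longrightarrow> (0::real) \<le> c v" "p = (\<Sum>v\<in>S. c v *\<^sub>R F v)"
    and d: "\<And>v. v \<in> S \<Longrightarrow> (0::real) \<le> d v" "q = (\<Sum>v\<in>S. d v *\<^sub>R F v)"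
    by (metis conic_spanE)
  have "s *\<^sub>R p + t *\<^sub>R q = (\<Sum>v\<in>S. (s * c v + t * d v) *\<^sub>R F v)"
    by (simp add: c(2) d(2) scaleR_sum_right sum.distrib scaleR_left_distrib)
  moreover have "\<forall>v\<in>S. 0 \<le> s * c v + t * d v" using c(1) d(1) st by auto
  ultimately show "s *\<^sub>R p + t *\<^sub>R q \<in> conic_span F S" unfolding conic_span_def
    by (intro CollectI exI[of _ "\<lambda>v. s * c v + t * d v"]) auto
qed

lemma conic_span_scaleR:
  assumes "p \<in> conic_span F S" "0 \<le> t"
  shows "t *\<^sub>R p \<in> conic_span F S"
proof -
  obtain c where c: "\<And>v. v \<in> S \<Longrightarrow> (0::real) \<le> c v" "p = (\<Sum>v\<in>S. c v *\<^sub>R F v)"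
    using assms(1) by (rule conic_spanE) blast
  have "t *\<^sub>R p = (\<Sum>v\<in>S. (t * c v) *\<^sub>R F v)" by (simp add: c(2) scaleR_sum_right)
  moreover have "\<forall>v\<in>S. 0 \<le> t * c v" using c(1) assms(2) by auto
  ultimately show ?thesis unfolding conic_span_def
    by (intro CollectI exI[of _ "\<lambda>v. t * c v"]) auto
qed

lemma conic_span_generator:
  assumes "finite S" "v \<in> S"
  shows "F v \<in> conic_span F S"
proof -
  have "0 \<in> conic_span F S" unfolding conic_span_def by (intro CollectI exI[of _ "\<lambda>_. 0"]) simp
  from conic_span_add_generator[OF this assms, of 1] show ?thesis by simp
qed

lemma span_Int_hyperplane_in_affine_hull:
  fixes Q :: "'e::euclidean_space set"
  assumes "\<And>q. q \<in> Q \<Longrightarrow> u \<bullet> q = 1" "y \<in> span Q" "u \<bullet> y = 1" "Q \<noteq> {}"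
  shows "y \<in> affine hull Q"
proof -
  obtain q0 where q0: "q0 \<in> Q" using assms by blast
  let ?D = "(\<lambda>x. - q0 + x) ` (Q - {q0})"
  \<comment> \<open>Subtracting \<open>q0\<close> with the factor \<open>u \<bullet> y\<close>
    instead of 1 makes the condition linear in \<open>y\<close>, so that induction over the span
    applies.\<close>
  have "y - (u \<bullet> y) *\<^sub>R q0 \<in> span ?D"
    using assms(2)
  proof (induction rule: span_induct)
    case base
    show ?case
    proof (rule subspaceI)
      show "0 \<in> {y. y - (u \<bullet> y) *\<^sub>R q0 \<in> span ?D}" by (simp add: span_0)
    next
      fix x y assume "x \<in> {y. y - (u \<bullet> y) *\<^sub>R q0 \<in> span ?D}" "y \<in> {y. y - (u \<bullet> y) *\<^sub>R q0 \<in> span ?D}"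
      then have "(x - (u \<bullet> x) *\<^sub>R q0) + (y - (u \<bullet> y) *\<^sub>R q0) \<in> span ?D" by (auto intro: span_add)
      then show "x + y \<in> {y. y - (u \<bullet> y) *\<^sub>R q0 \<in> span ?D}" by (simp add: inner_add_right algebra_simps)
    next
      fix c x assume "x \<in> {y. y - (u \<bullet> y) *\<^sub>R q0 \<in> span ?D}"
      then have "c *\<^sub>R (x - (u \<bullet> x) *\<^sub>R q0) \<in> span ?D" by (auto intro: span_scale)
      then show "c *\<^sub>R x \<in> {y. y - (u \<bullet> y) *\<^sub>R q0 \<in> span ?D}" by (simp add: algebra_simps)
    qed
  next
    case (step x)
    then show ?case using assms(1)
      by (cases "x = q0") (auto simp: span_0 intro!: span_base)
  qed
  then have "- q0 + y \<in> span ?D" using assms(3) by simp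
  then have "q0 + (- q0 + y) \<in> affine hull Q" unfolding affine_hull_span2[OF q0] by (rule imageI)
  then show ?thesis by simp
qed

text \<open>The hyperplane misses 0, so adjoining 0 raises the affine dimension by one and turns it
  into the linear one.\<close>

lemma aff_dim_eq_dim_minus_1:
  fixes Q :: "'e::euclidean_space set"
  assumes "\<And>q. q \<in> Q \<Longrightarrow> u \<bullet> q = 1"
  shows "aff_dim Q = int (dim Q) - 1"
proof -
  have "affine hull Q \<subseteq> {q. u \<bullet> q = 1}"
    using assms by (intro hull_minimal) (auto simp: affine_hyperplane)
  then have "0 \<notin> affine hull Q" by auto
  then have "aff_dim (insert 0 Q) = aff_dim Q + 1" by (simp add: aff_dim_insert)
  moreover have "aff_dim (insert 0 Q) = int (dim (insert 0 Q))"
    by (intro aff_dim_zero hull_inc) simp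
  moreover have "dim (insert 0 Q) = dim Q" by (metis dim_span span_insert_0)
  ultimately show ?thesis by simp
qed

text \<open>\<open>L\<close> turns points into rays. In \<open>polytope_section\<close>,
  \<open>Q\<close> is the section of the cone over \<open>P\<close> by \<open>u = 1\<close>, through
  which facts on Euclidean polytopes reach both geometries. The boundary point in
  \<open>ghalfspaceI\<close> excludes functionals \<open>(0, c)\<close> of the Euclidean lift, which
  define no halfspace.\<close>

locale lifted_geometry =
  fixes G :: "'a::euclidean_space geometry" and L :: "'a \<Rightarrow> 'e::euclidean_space"
  assumes gpolytope_subset: "gpolytope G P \<Longrightarrow> P \<subseteq> gspace G"
    and gdist_nonneg: "x \<in> gspace G \<Longrightarrow> y \<in> gspace G \<Longrightarrow> 0 \<le> gdist G x y"
    and gdist_eq_0: "x \<in> gspace G \<Longrightarrow> y \<in> gspace G \<Longrightarrow> gdist G x y = 0 \<longleftrightarrow> x = y"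
    and ray_inj: "x \<in> gspace G \<Longrightarrow> y \<in> gspace G \<Longrightarrow> 0 < t \<Longrightarrow> L x = t *\<^sub>R L y \<Longrightarrow> x = y"
    and polytope_section: "gpolytope G P \<Longrightarrow> \<exists>u Q. polytope Q \<and> Q \<noteq> {} \<and> (\<forall>q\<in>Q. u \<bullet> q = 1) \<and>
      (\<forall>x\<in>P. 0 < u \<bullet> L x \<and> L x /\<^sub>R (u \<bullet> L x) \<in> Q) \<and> (\<forall>q\<in>Q. \<exists>x\<in>P. \<exists>t>0. L x = t *\<^sub>R q)"
    and gface_iff: "gpolytope G P \<Longrightarrow> gface G R P \<longleftrightarrow>
      R \<noteq> {} \<and> (\<exists>a. (\<forall>x\<in>P. a \<bullet> L x \<le> 0) \<and> R = {x \<in> P. a \<bullet> L x = 0})"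
    and gdim_eq: "P \<subseteq> gspace G \<Longrightarrow> P \<noteq> {} \<Longrightarrow> gdim G P = int (dim (L ` P)) - 1"
    and ghalfspaceD: "ghalfspace G H B \<Longrightarrow>
      \<exists>n. n \<noteq> 0 \<and> H = {x \<in> gspace G. n \<bullet> L x \<le> 0} \<and> B = {x \<in> gspace G. n \<bullet> L x = 0}"
    and ghalfspaceI: "n \<noteq> 0 \<Longrightarrow> x \<in> gspace G \<Longrightarrow> n \<bullet> L x = 0 \<Longrightarrow>
      ghalfspace G {x \<in> gspace G. n \<bullet> L x \<le> 0} {x \<in> gspace G. n \<bullet> L x = 0}"
    and isometry_dim: "A \<subseteq> gspace G \<Longrightarrow> g ` A \<subseteq> gspace G \<Longrightarrow>
      (\<And>x y. x \<in> A \<Longrightarrow> y \<in> A \<Longrightarrow> gdist G (g x) (g y) = gdist G x y) \<Longrightarrow> dim (L ` g ` A) = dim (L ` A)"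
begin

lemma gfaceE:
  assumes "gpolytope G P" "gface G R P"
  obtains a where "\<And>y. y \<in> P \<Longrightarrow> a \<bullet> L y \<le> 0" "R = {y \<in> P. a \<bullet> L y = 0}"
proof -
  have "\<exists>a. (\<forall>x\<in>P. a \<bullet> L x \<le> 0) \<and> R = {x \<in> P. a \<bullet> L x = 0}"
    using assms gface_iff by simp
  then show thesis using that by metis
qed

lemma gface_subset: "gpolytope G P \<Longrightarrow> gface G R P \<Longrightarrow> R \<subseteq> P"
  using gface_iff by blast

lemma gface_refl:
  assumes "gpolytope G P" shows "gface G P P"
proof -
  have "P \<noteq> {}" using polytope_section[OF assms] by blast
  then show ?thesis using gface_iff[OF assms] by (auto intro!: exI[of _ 0])
qed

lemma gpolytope_nonempty: "gpolytope G P \<Longrightarrow> P \<noteq> {}"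
  using gface_refl gface_iff by blast

text \<open>Krein-Milman in the section: extreme points of a polytope are exposed, and an exposed
  point of \<open>Q\<close> spans the ray of a vertex of \<open>P\<close>.\<close>

lemma gpolytope_vertex_cone:
  assumes P: "gpolytope G P" and x: "x \<in> P" and fin: "finite {v. gface G {v} P}"
  shows "L x \<in> conic_span L {v. gface G {v} P}"
proof -
  obtain u Q where Q: "polytope Q" "\<forall>q\<in>Q. u \<bullet> q = 1"
    and PQ: "\<And>x. x \<in> P \<Longrightarrow> 0 < u \<bullet> L x \<and> L x /\<^sub>R (u \<bullet> L x) \<in> Q"
    and QP: "\<And>q. q \<in> Q \<Longrightarrow> \<exists>x\<in>P. \<exists>t>0. L x = t *\<^sub>R q"
    using polytope_section[OF P] by metis
  have "e \<in> conic_span L {v. gface G {v} P}" if e: "e extreme_point_of Q" for e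
  proof -
    have eQ: "e \<in> Q" using e by (simp add: extreme_point_of_def)
    obtain v t where v: "v \<in> P" "t > 0" "L v = t *\<^sub>R e" using QP[OF eQ] by blast
    have "{e} face_of Q" using e by (simp add: face_of_singleton)
    then have "{e} exposed_face_of Q"
      using exposed_face_of_polyhedron polytope_imp_polyhedron Q(1) by blast
    then obtain a b where ab: "\<And>q. q \<in> Q \<Longrightarrow> a \<bullet> q \<le> b" "{e} = Q \<inter> {x. a \<bullet> x = b}"
      unfolding exposed_face_of_def by blast
    \<comment> \<open>As \<open>u = 1\<close> on \<open>Q\<close>, this linear functional expresses
      the affine condition \<open>a \<bullet> q \<le> b\<close> and extends it to the cone.\<close>
    let ?a = "a - b *\<^sub>R u"
    have m: "?a \<bullet> L y = (u \<bullet> L y) * (a \<bullet> (L y /\<^sub>R (u \<bullet> L y)) - b)" if "y \<in> P" for y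
      using PQ[OF that] by (simp add: inner_diff_left field_simps)
    have "?a \<bullet> L y \<le> 0" if "y \<in> P" for y
      unfolding m[OF that] using PQ[OF that] ab(1)[of "L y /\<^sub>R (u \<bullet> L y)"]
      by (intro mult_nonneg_nonpos) auto
    moreover have "{v} = {y \<in> P. ?a \<bullet> L y = 0}"
    proof (intro equalityI subsetI)
      fix y assume "y \<in> {v}"
      moreover have "a \<bullet> e = b" using ab(2) by blast
      ultimately show "y \<in> {y \<in> P. ?a \<bullet> L y = 0}" using v Q(2) eQ by (simp add: inner_diff_left)
    next
      fix y assume y: "y \<in> {y \<in> P. ?a \<bullet> L y = 0}"
      then have "a \<bullet> (L y /\<^sub>R (u \<bullet> L y)) = b" using m[of y] PQ[of y] by auto
      then have "L y /\<^sub>R (u \<bullet> L y) = e" using ab(2) PQ y by blast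
      moreover have "u \<bullet> L y \<noteq> 0" using PQ[of y] y by auto
      ultimately have "L y = (u \<bullet> L y) *\<^sub>R e" by auto
      then have "L y = ((u \<bullet> L y) / t) *\<^sub>R L v" using v by simp
      moreover have "0 < (u \<bullet> L y) / t" using PQ y v by simp
      ultimately show "y \<in> {v}" using ray_inj[of y v] gpolytope_subset[OF P] y v by blast
    qed
    ultimately have "gface G {v} P" unfolding gface_iff[OF P] by blast
    then have "L v \<in> conic_span L {v. gface G {v} P}" using conic_span_generator[OF fin] by blast
    then have "(1 / t) *\<^sub>R L v \<in> conic_span L {v. gface G {v} P}" using v by (intro conic_span_scaleR) auto
    then show ?thesis using v by simp
  qed
  then have "convex hull {e. e extreme_point_of Q} \<subseteq> conic_span L {v. gface G {v} P}"
    by (intro hull_minimal) (auto simp: convex_conic_span)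
  then have "Q \<subseteq> conic_span L {v. gface G {v} P}"
    using Krein_Milman_Minkowski[of Q] polytope_imp_compact polytope_imp_convex Q(1) by blast
  then have "L x /\<^sub>R (u \<bullet> L x) \<in> conic_span L {v. gface G {v} P}" using PQ[OF x] by blast
  from conic_span_scaleR[OF this, of "u \<bullet> L x"] show ?thesis using PQ[OF x] by simp
qed

text \<open>Dividing a conic combination by its value under \<open>u\<close> turns it into a convex
  combination of points of the section \<open>Q\<close>.\<close>

lemma conic_span_in_gpolytope:
  assumes P: "gpolytope G P" and S: "finite S" "F ` S \<subseteq> P" and p: "p \<in> conic_span (\<lambda>v. L (F v)) S" "p \<noteq> 0"
  obtains t y where "t > 0" "y \<in> P" "p = t *\<^sub>R L y"
proof -
  obtain u Q where Q: "polytope Q"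
    and PQ: "\<And>x. x \<in> P \<Longrightarrow> 0 < u \<bullet> L x \<and> L x /\<^sub>R (u \<bullet> L x) \<in> Q"
    and QP: "\<And>q. q \<in> Q \<Longrightarrow> \<exists>x\<in>P. \<exists>t>0. L x = t *\<^sub>R q"
    using polytope_section[OF P] by metis
  obtain c where c: "\<And>v. v \<in> S \<Longrightarrow> (0::real) \<le> c v" "p = (\<Sum>v\<in>S. c v *\<^sub>R L (F v))"
    using p(1) by (rule conic_spanE) blast
  define w where "w v = c v * (u \<bullet> L (F v))" for v
  have uF: "0 < u \<bullet> L (F v)" if "v \<in> S" for v using PQ S(2) that by blast
  have w: "0 \<le> w v" if "v \<in> S" for v using uF[OF that] c(1)[OF that] by (simp add: w_def)
  have up: "u \<bullet> p = sum w S" by (simp add: c(2) inner_sum_right w_def)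
  have "sum w S \<noteq> 0"
  proof
    assume "sum w S = 0"
    then have "\<forall>v\<in>S. w v = 0" using sum_nonneg_eq_0_iff[OF S(1)] w by blast
    then have "\<forall>v\<in>S. c v = 0" using uF unfolding w_def by fastforce
    then have "p = 0" by (simp add: c(2))
    then show False using p(2) by simp
  qed
  then have s: "0 < sum w S" using sum_nonneg[of S w] w by force
  have "(\<Sum>v\<in>S. (w v / sum w S) *\<^sub>R (L (F v) /\<^sub>R (u \<bullet> L (F v)))) \<in> Q"
  proof (rule convex_sum)
    show "convex Q" using Q polytope_imp_convex by blast
    show "sum (\<lambda>v. w v / sum w S) S = 1" using s by (simp add: sum_divide_distrib[symmetric])
  qed (use S PQ w s in auto)
  moreover have "(\<Sum>v\<in>S. (w v / sum w S) *\<^sub>R (L (F v) /\<^sub>R (u \<bullet> L (F v)))) = p /\<^sub>R sum w S"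
    unfolding c(2) scaleR_sum_right
    by (rule sum.cong) (use uF in \<open>force simp: w_def divide_inverse\<close>)+
  ultimately obtain y t where y: "y \<in> P" "t > 0" "L y = t *\<^sub>R (p /\<^sub>R sum w S)" using QP by metis
  then have "p = (sum w S / t) *\<^sub>R L y" using s by simp
  then show thesis using that[of "sum w S / t" y] y s by simp
qed

lemma gpolytope_has_vertex:
  assumes P: "gpolytope G P" and fin: "finite {v. gface G {v} P}"
  obtains v where "gface G {v} P"
proof -
  obtain x where x: "x \<in> P" using gpolytope_nonempty[OF P] by blast
  have "{v. gface G {v} P} \<noteq> {}"
  proof
    assume "{v. gface G {v} P} = {}"
    then have "L x = 0" using gpolytope_vertex_cone[OF P x fin] by (auto elim: conic_spanE)
    then show False using polytope_section[OF P] x by (metis inner_zero_right less_irrefl)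
  qed
  then show thesis using that by blast
qed

text \<open>Up to adding multiples of \<open>L x\<close>, the cone over \<open>P\<close> is
  described by its facet inequalities at \<open>x\<close> alone, since a large multiple makes the
  others true. The inequality at a ridge may be replaced by any functional supporting
  \<open>P\<close> exactly along it: on the span of \<open>P\<close> the two differ by a positive
  factor.\<close>

lemma tangent_cone_cover:
  assumes P: "gpolytope G P" and x: "x \<in> P" and q: "q \<in> span (L ` P)"
    and ridge: "\<And>R. gface G R P \<Longrightarrow> x \<in> R \<Longrightarrow> dim (L ` R) + 1 = dim (L ` P) \<Longrightarrow>
      \<exists>n. (\<forall>y\<in>R. n \<bullet> L y = 0) \<and> (\<forall>y\<in>P. n \<bullet> L y \<le> 0) \<and> (\<exists>y\<in>P. n \<bullet> L y < 0) \<and> n \<bullet> q \<le> 0"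
  shows "\<exists>l\<ge>0. \<exists>t\<ge>0. \<exists>y\<in>P. q + l *\<^sub>R L x = t *\<^sub>R L y"
proof -
  obtain u Q where Q: "polytope Q" "Q \<noteq> {}" "\<And>q. q \<in> Q \<Longrightarrow> u \<bullet> q = 1"
    and PQ: "\<And>x. x \<in> P \<Longrightarrow> 0 < u \<bullet> L x \<and> L x /\<^sub>R (u \<bullet> L x) \<in> Q"
    and QP: "\<And>q. q \<in> Q \<Longrightarrow> \<exists>x\<in>P. \<exists>t>0. L x = t *\<^sub>R q"
    using polytope_section[OF P] by metis
  have span_eq: "span (L ` {y \<in> P. a \<bullet> L y = 0}) = span {q \<in> Q. a \<bullet> q = 0}" for a
  proof (rule antisym; rule span_minimal)
    show "L ` {y \<in> P. a \<bullet> L y = 0} \<subseteq> span {q \<in> Q. a \<bullet> q = 0}"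
    proof clarify
      fix y assume y: "y \<in> P" "a \<bullet> L y = 0"
      then have "L y /\<^sub>R (u \<bullet> L y) \<in> span {q \<in> Q. a \<bullet> q = 0}" using PQ by (auto intro: span_base)
      then have "(u \<bullet> L y) *\<^sub>R (L y /\<^sub>R (u \<bullet> L y)) \<in> span {q \<in> Q. a \<bullet> q = 0}" by (rule span_scale)
      then show "L y \<in> span {q \<in> Q. a \<bullet> q = 0}" using PQ[OF y(1)] by simp
    qed
    show "{q \<in> Q. a \<bullet> q = 0} \<subseteq> span (L ` {y \<in> P. a \<bullet> L y = 0})"
    proof clarify
      fix q assume q: "q \<in> Q" "a \<bullet> q = 0"
      then obtain y t where y: "y \<in> P" "t > 0" "L y = t *\<^sub>R q" using QP by blast
      then have "L y \<in> span (L ` {y \<in> P. a \<bullet> L y = 0})" 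
        using q by (intro span_base imageI) simp
      then have "(1 / t) *\<^sub>R L y \<in> span (L ` {y \<in> P. a \<bullet> L y = 0})" by (rule span_scale)
      then show "q \<in> span (L ` {y \<in> P. a \<bullet> L y = 0})" using y by simp
    qed
  qed auto
  have span_eq0: "span (L ` P) = span Q" using span_eq[of 0] by simp
  have "polyhedron Q" using Q polytope_imp_polyhedron by blast
  \<comment> \<open>An irredundant description, so that each halfspace in \<open>F\<close> cuts out
    a facet of \<open>Q\<close>, hence a ridge of \<open>P\<close>.\<close>
  then obtain F where F: "finite F" "Q = affine hull Q \<inter> \<Inter>F"
    "\<forall>h\<in>F. \<exists>a b. a \<noteq> 0 \<and> h = {x. a \<bullet> x \<le> b}" "\<And>F'. F' \<subset> F \<Longrightarrow> Q \<subset> affine hull Q \<inter> \<Inter>F'"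
    using polyhedron_Int_affine_minimal[of Q] by auto
  then obtain a b where ab: "\<And>h. h \<in> F \<Longrightarrow> a h \<noteq> 0 \<and> h = {x. a h \<bullet> x \<le> b h}" by metis
  define m where "m h = a h - b h *\<^sub>R u" for h
  have m_Q: "m h \<bullet> q = a h \<bullet> q - b h" if "q \<in> Q" for h q using Q(3)[OF that] by (simp add: m_def inner_diff_left)
  have m_le: "m h \<bullet> q \<le> 0" if "h \<in> F" "q \<in> Q" for h q
    using m_Q[OF that(2)] ab[OF that(1)] F(2) that by auto
  have m_le_L: "m h \<bullet> L y \<le> 0" if "h \<in> F" "y \<in> P" for h y
  proof -
    have "m h \<bullet> (L y /\<^sub>R (u \<bullet> L y)) \<le> 0" using m_le that PQ by blast
    then show ?thesis using PQ[OF that(2)] by (simp add: mult_le_0_iff)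
  qed
  have tight: "m h \<bullet> q \<le> 0" if h: "h \<in> F" and 0: "m h \<bullet> L x = 0" for h
  proof -
    define R where "R = {y \<in> P. m h \<bullet> L y = 0}"
    have "x \<in> R" using x 0 by (simp add: R_def)
    moreover have "gface G R P" unfolding gface_iff[OF P] using m_le_L[OF h] \<open>x \<in> R\<close> R_def by blast
    moreover have dimR: "dim (L ` R) + 1 = dim (L ` P)"
    proof -
      have "Q \<inter> {x. a h \<bullet> x = b h} facet_of Q"
        using facet_of_polyhedron_explicit[OF F(1,2) ab F(4)] h by blast
      moreover have "Q \<inter> {x. a h \<bullet> x = b h} = {q \<in> Q. m h \<bullet> q = 0}" using m_Q by auto
      ultimately have "aff_dim {q \<in> Q. m h \<bullet> q = 0} = aff_dim Q - 1" by (simp add: facet_of_def)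
      then have "dim {q \<in> Q. m h \<bullet> q = 0} + 1 = dim Q"
        using aff_dim_eq_dim_minus_1[of Q u] aff_dim_eq_dim_minus_1[of "{q \<in> Q. m h \<bullet> q = 0}" u] Q(3) by auto
      then show ?thesis
        using arg_cong[OF span_eq[of "m h"], of dim] arg_cong[OF span_eq0, of dim] by (simp add: R_def)
    qed
    ultimately obtain n where n: "\<And>y. y \<in> R \<Longrightarrow> n \<bullet> L y = 0" "\<exists>y\<in>P. n \<bullet> L y < 0" "n \<bullet> q \<le> 0"
      using ridge by blast
    then obtain p where p: "p \<in> P" "n \<bullet> L p < 0" by blast
    have n0: "n \<bullet> y = 0" if "y \<in> span (L ` R)" for y
    proof -
      have "span (L ` R) \<subseteq> {y. n \<bullet> y = 0}" using n by (intro span_minimal) (auto simp: subspace_hyperplane)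
      then show ?thesis using that by blast
    qed
    have m0: "m h \<bullet> y = 0" if "y \<in> span (L ` R)" for y
    proof -
      have "span (L ` R) \<subseteq> {y. m h \<bullet> y = 0}" by (intro span_minimal) (auto simp: subspace_hyperplane R_def)
      then show ?thesis using that by blast
    qed
    have "L p \<notin> span (L ` R)" using n0 p by force
    then have "dim (insert (L p) (L ` R)) = dim (L ` P)" using dimR by (simp add: dim_insert)
    then have "span (insert (L p) (L ` R)) = span (L ` P)"
      using p by (intro dim_eq_span) (auto simp: R_def)
    \<comment> \<open>Modulo the span of the ridge, \<open>q\<close> is a multiple of the point
      \<open>p\<close> off the ridge; \<open>n\<close> determines the sign of the factor, and this
      gives the sign of \<open>m h\<close>.\<close>
    then obtain \<alpha> where \<alpha>: "q - \<alpha> *\<^sub>R L p \<in> span (L ` R)" using q span_breakdown_eq by metis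
    have "n \<bullet> q = \<alpha> * (n \<bullet> L p)" using n0[OF \<alpha>] by (simp add: inner_diff_right)
    then have "\<alpha> \<ge> 0" using n(3) p(2) by (simp add: mult_le_0_iff)
    moreover have "m h \<bullet> q = \<alpha> * (m h \<bullet> L p)" using m0[OF \<alpha>] by (simp add: inner_diff_right)
    ultimately show ?thesis using m_le_L[OF h p(1)] by (simp add: mult_nonneg_nonpos)
  qed
  have "eventually (\<lambda>l. m h \<bullet> (q + l *\<^sub>R L x) \<le> 0) at_top" if h: "h \<in> F" for h
  proof (cases "m h \<bullet> L x = 0")
    case True
    then show ?thesis using tight[OF h] by (simp add: inner_add_right)
  next
    case False
    then have neg: "m h \<bullet> L x < 0" using m_le_L[OF h x] by simp
    show ?thesis
      using eventually_ge_at_top[of "- (m h \<bullet> q) / (m h \<bullet> L x)"]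
      by eventually_elim (use neg in \<open>simp add: inner_add_right field_simps\<close>)
  qed
  then have "eventually (\<lambda>l. \<forall>h\<in>F. m h \<bullet> (q + l *\<^sub>R L x) \<le> 0) at_top"
    using F(1) by (simp add: eventually_ball_finite)
  moreover have "eventually (\<lambda>l. 0 < u \<bullet> (q + l *\<^sub>R L x)) at_top"
    using eventually_gt_at_top[of "- (u \<bullet> q) / (u \<bullet> L x)"]
    by eventually_elim (use PQ[OF x] in \<open>simp add: inner_add_right field_simps\<close>)
  ultimately have "eventually (\<lambda>l. 0 \<le> l \<and> 0 < u \<bullet> (q + l *\<^sub>R L x) \<and> (\<forall>h\<in>F. m h \<bullet> (q + l *\<^sub>R L x) \<le> 0)) at_top"
    using eventually_ge_at_top[of "0::real"] by eventually_elim auto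
  then obtain l where l: "0 \<le> l" "0 < u \<bullet> (q + l *\<^sub>R L x)" "\<And>h. h \<in> F \<Longrightarrow> m h \<bullet> (q + l *\<^sub>R L x) \<le> 0"
    using eventually_happens'[OF trivial_limit_at_top_linorder] by blast
  define p where "p = q + l *\<^sub>R L x"
  let ?s = "u \<bullet> p"
  have s: "0 < ?s" using l(2) by (simp add: p_def)
  have u1: "u \<bullet> (p /\<^sub>R ?s) = 1" using s by simp
  have "p \<in> span Q" unfolding p_def span_eq0[symmetric] 
    using x by (intro span_add[OF q] span_scale span_base imageI)
  then have "p /\<^sub>R ?s \<in> affine hull Q"
    by (intro span_Int_hyperplane_in_affine_hull[OF Q(3)] span_scale u1 Q(2))
  moreover have "p /\<^sub>R ?s \<in> h" if "h \<in> F" for h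
  proof -
    have "a h \<bullet> p \<le> b h * ?s" using l(3)[OF that] by (simp add: m_def p_def inner_diff_left)
    then have "a h \<bullet> (p /\<^sub>R ?s) \<le> b h" using s by (simp add: field_simps)
    then show ?thesis using ab[OF that] by blast
  qed
  ultimately have "p /\<^sub>R ?s \<in> Q" using F(2) by blast
  then obtain y t where y: "y \<in> P" "t > 0" "L y = t *\<^sub>R (p /\<^sub>R ?s)" using QP by blast
  then have "p = (?s / t) *\<^sub>R L y" using s by simp
  then have "q + l *\<^sub>R L x = (?s / t) *\<^sub>R L y" using p_def by simp
  moreover have "0 \<le> ?s / t" using s y(2) by simp
  ultimately show ?thesis using l(1) y(1) by blast
qed

text \<open>With no ridge at \<open>x\<close>, \<open>tangent_cone_cover\<close> would apply
  vacuously and put the negative of \<open>L y0\<close> into the tangent cone, against the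
  functional \<open>a\<close> that exposes \<open>x\<close>.\<close>

lemma ex_ridge_at_vertex:
  assumes P: "gpolytope G P" and x: "gface G {x} P" and dim: "dim (L ` P) \<ge> 2"
  obtains R where "gface G R P" "x \<in> R" "dim (L ` R) + 1 = dim (L ` P)"
proof (rule ccontr)
  assume "\<not> thesis"
  then have none: "\<not> (gface G R P \<and> x \<in> R \<and> dim (L ` R) + 1 = dim (L ` P))" for R using that by blast
  have xP: "x \<in> P" using gface_subset[OF P x] by simp
  obtain a where a: "\<And>y. y \<in> P \<Longrightarrow> a \<bullet> L y \<le> 0" "{x} = {y \<in> P. a \<bullet> L y = 0}"
    using gfaceE[OF P x] by metis
  have "P \<noteq> {x}"
  proof
    assume "P = {x}"
    then have "dim (L ` P) \<le> card {L x}" using dim_le_card'[of "{L x}"] by simp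
    then show False using dim by simp
  qed
  then obtain y0 where y0: "y0 \<in> P" "y0 \<noteq> x" using xP by blast
  then have "a \<bullet> L y0 \<noteq> 0" using a(2) by blast
  then have a0: "a \<bullet> L y0 < 0" using a(1)[OF y0(1)] by simp
  have "\<exists>l\<ge>0. \<exists>t\<ge>0. \<exists>y\<in>P. - L y0 + l *\<^sub>R L x = t *\<^sub>R L y"
  proof (rule tangent_cone_cover[OF P xP])
    show "- L y0 \<in> span (L ` P)" using y0 by (intro span_neg span_base imageI)
  qed (use none in blast)
  then obtain l t y where "t \<ge> 0" "y \<in> P" "- L y0 + l *\<^sub>R L x = t *\<^sub>R L y" by blast
  moreover have "a \<bullet> L x = 0" using a(2) by blast
  ultimately have "- (a \<bullet> L y0) = t * (a \<bullet> L y)"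
    by (metis (no_types, lifting) add.right_neutral inner_add_right inner_minus_right inner_scaleR_right mult_zero_right)
  moreover have "t * (a \<bullet> L y) \<le> 0" using \<open>t \<ge> 0\<close> a(1)[OF \<open>y \<in> P\<close>] by (simp add: mult_nonneg_nonpos)
  ultimately show False using a0 by simp
qed

end

subsection \<open>Precomplexes\<close>

text \<open>A combinatorial equivalence between the cells and their images makes the map induced by \<open>f\<close>
  itself an order isomorphism, by counting cells and pairs of nested cells.\<close>

lemma comb_equiv_image:
  assumes "finite A" "comb_equiv A ((`) f ` A)"
  shows "inj_on ((`) f) A"
    and "\<sigma> \<in> A \<Longrightarrow> \<tau> \<in> A \<Longrightarrow> f ` \<sigma> \<subseteq> f ` \<tau> \<Longrightarrow> \<sigma> \<subseteq> \<tau>"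
proof -
  let ?f = "(`) f"
  obtain h where h: "bij_betw h A (?f ` A)" "\<forall>\<sigma>\<in>A. \<forall>\<tau>\<in>A. \<sigma> \<subseteq> \<tau> \<longleftrightarrow> h \<sigma> \<subseteq> h \<tau>"
    using assms(2) unfolding comb_equiv_def by blast
  show inj: "inj_on ?f A" using bij_betw_same_card[OF h(1)] assms(1) by (intro eq_card_imp_inj_on) auto
  let ?A = "{(\<sigma>, \<tau>) \<in> A \<times> A. \<sigma> \<subseteq> \<tau>}"
  let ?B = "{(\<sigma>, \<tau>) \<in> (?f ` A) \<times> (?f ` A). \<sigma> \<subseteq> \<tau>}"
  have finB: "finite ?B" by (rule finite_subset[of _ "(?f ` A) \<times> (?f ` A)"]) (use assms in auto)
  have "inj_on (map_prod h h) ?A"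
    using h(1) unfolding bij_betw_def by (auto simp: inj_on_def)
  moreover have "map_prod h h ` ?A = ?B"
  proof (intro equalityI subsetI)
    fix p assume "p \<in> map_prod h h ` ?A"
    then show "p \<in> ?B" using h(2) bij_betwE[OF h(1)] by auto
  next
    fix p assume "p \<in> ?B"
    then obtain S T where p: "p = (S, T)" "S \<in> ?f ` A" "T \<in> ?f ` A" "S \<subseteq> T" by auto
    then obtain \<sigma> \<tau> where st: "\<sigma> \<in> A" "\<tau> \<in> A" "S = h \<sigma>" "T = h \<tau>"
      using bij_betw_imp_surj_on[OF h(1)] by (metis imageE)
    then have "\<sigma> \<subseteq> \<tau>" using h(2) p by blast
    then show "p \<in> map_prod h h ` ?A" using st p by (intro image_eqI[of _ _ "(\<sigma>, \<tau>)"]) auto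
  qed
  ultimately have card: "card ?A = card ?B" using card_image[of "map_prod h h" ?A] by simp
  have "inj_on (map_prod ?f ?f) ?A" using inj unfolding inj_on_def by auto
  then have "card (map_prod ?f ?f ` ?A) = card ?B" using card card_image[of "map_prod ?f ?f" ?A] by simp
  moreover have "map_prod ?f ?f ` ?A \<subseteq> ?B" by auto
  ultimately have img: "map_prod ?f ?f ` ?A = ?B" by (intro card_subset_eq[OF finB])
  show "\<sigma> \<subseteq> \<tau>" if "\<sigma> \<in> A" "\<tau> \<in> A" "f ` \<sigma> \<subseteq> f ` \<tau>"
  proof -
    have "(f ` \<sigma>, f ` \<tau>) \<in> map_prod ?f ?f ` ?A" unfolding img using that by auto
    then obtain \<sigma>' \<tau>' where *: "\<sigma>' \<in> A" "\<tau>' \<in> A" "\<sigma>' \<subseteq> \<tau>'" "f ` \<sigma> = f ` \<sigma>'" "f ` \<tau> = f ` \<tau>'" by auto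
    then have "\<sigma> = \<sigma>'" "\<tau> = \<tau>'" using inj that by (auto simp: inj_on_def)
    with * show ?thesis by simp
  qed
qed

lemma cells_star: "\<tau> \<in> cells (star \<sigma> K) \<longleftrightarrow> \<tau> \<in> cells K \<and> (\<exists>\<rho>\<in>cells K. \<sigma> \<subseteq> \<rho> \<and> \<tau> \<subseteq> \<rho>)"
  by (simp add: star_def)

lemma topspace_complex_topology: "topspace (complex_topology K) = \<Union>(cells K)"
proof -
  have "complex_open K (\<Union>(cells K))" unfolding complex_open_def by (auto intro!: exI[of _ 1])
  then have "openin (complex_topology K) (\<Union>(cells K))" by (simp add: openin_complex_topology)
  moreover have "\<And>U. openin (complex_topology K) U \<Longrightarrow> U \<subseteq> \<Union>(cells K)"
    by (simp add: openin_complex_topology complex_open_def)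
  ultimately show ?thesis unfolding topspace_def by blast
qed

locale lifted_precomplex = lifted_geometry G L
  for G :: "'a::euclidean_space geometry" and L :: "'a \<Rightarrow> 'e::euclidean_space" +
  fixes K :: "'p polycomplex" and f :: "'p \<Rightarrow> 'a"
  assumes precomplex: "precomplex G K f"
begin

definition F :: "'p \<Rightarrow> 'e" where "F v = L (f v)"

abbreviation verts :: "'p set \<Rightarrow> 'p set" where "verts \<sigma> \<equiv> vertices K \<inter> \<sigma>"

section \<open>Faces, intersections and vertices of cells within a star\<close>

lemma star_geometric: "\<sigma> \<in> cells K \<Longrightarrow> geometric_complex G ((`) f ` cells (star \<sigma> K))"
  and star_comb_equiv: "\<sigma> \<in> cells K \<Longrightarrow> comb_equiv (cells (star \<sigma> K)) ((`) f ` cells (star \<sigma> K))"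
  and f_isometry: "\<sigma> \<in> cells K \<Longrightarrow> x \<in> \<sigma> \<Longrightarrow> y \<in> \<sigma> \<Longrightarrow> gdist G (f x) (f y) = cdist K x y"
  and f_gspace: "\<sigma> \<in> cells K \<Longrightarrow> x \<in> \<sigma> \<Longrightarrow> f x \<in> gspace G"
  and ex_chart: "\<sigma> \<in> cells K \<Longrightarrow> \<exists>P \<phi>. chart G K \<sigma> P \<phi>"
  and cells_Int: "\<sigma> \<in> cells K \<Longrightarrow> \<tau> \<in> cells K \<Longrightarrow> \<sigma> \<inter> \<tau> \<noteq> {} \<Longrightarrow> \<sigma> \<inter> \<tau> \<in> cells K"
  using precomplex unfolding precomplex_def abstract_complex_def complex_immersion_def
  by (simp, simp, simp, fastforce, simp, simp)

lemma star_subcell: "\<sigma> \<in> cells K \<Longrightarrow> \<rho> \<in> cells K \<Longrightarrow> \<rho> \<subseteq> \<sigma> \<Longrightarrow> \<rho> \<in> cells (star \<sigma> K)"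
  unfolding cells_star by blast

lemma finite_star: "\<sigma> \<in> cells K \<Longrightarrow> finite (cells (star \<sigma> K))"
proof -
  assume "\<sigma> \<in> cells K"
  then have "comb_equiv (cells (star \<sigma> K)) ((`) f ` cells (star \<sigma> K))" "finite ((`) f ` cells (star \<sigma> K))"
    using star_comb_equiv star_geometric unfolding geometric_complex_def by blast+
  then show ?thesis unfolding comb_equiv_def using bij_betw_finite by blast
qed

lemma star_gface_Int:
  assumes "\<pi> \<in> cells K" "\<sigma> \<in> cells (star \<pi> K)" "\<tau> \<in> cells (star \<pi> K)" "f ` \<sigma> \<inter> f ` \<tau> \<noteq> {}"
  shows "gface G (f ` \<sigma> \<inter> f ` \<tau>) (f ` \<sigma>)"
  using star_geometric[OF assms(1)] assms(2-) unfolding geometric_complex_def by simp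

lemma star_gface:
  assumes "\<pi> \<in> cells K" "\<sigma> \<in> cells (star \<pi> K)" "gface G R (f ` \<sigma>)"
  obtains \<rho> where "\<rho> \<in> cells (star \<pi> K)" "R = f ` \<rho>"
proof -
  have "R \<in> (`) f ` cells (star \<pi> K)"
    using star_geometric[OF assms(1)] assms(2-) unfolding geometric_complex_def by simp
  then show thesis using that by blast
qed

lemma gpolytope_cell: "\<sigma> \<in> cells K \<Longrightarrow> gpolytope G (f ` \<sigma>)"
  using star_geometric[of \<sigma>] star_subcell[of \<sigma> \<sigma>] unfolding geometric_complex_def by simp

lemma cell_nonempty: "\<sigma> \<in> cells K \<Longrightarrow> \<sigma> \<noteq> {}"
  using gpolytope_nonempty[OF gpolytope_cell] by blast

lemma gface_subcell:
  assumes "\<sigma> \<in> cells K" "\<rho> \<in> cells K" "\<rho> \<subseteq> \<sigma>"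
  shows "gface G (f ` \<rho>) (f ` \<sigma>)"
proof -
  have "f ` \<rho> \<inter> f ` \<sigma> = f ` \<rho>" "f ` \<sigma> \<inter> f ` \<rho> = f ` \<rho>" "f ` \<rho> \<noteq> {}" using assms cell_nonempty by auto
  then show ?thesis
    using star_gface_Int[of \<sigma> \<sigma> \<rho>] star_subcell[of \<sigma>] assms by simp
qed

lemma f_inj_on_cell: "\<sigma> \<in> cells K \<Longrightarrow> inj_on f \<sigma>"
proof (rule inj_onI)
  fix x y assume s: "\<sigma> \<in> cells K" "x \<in> \<sigma>" "y \<in> \<sigma>" "f x = f y"
  obtain P \<phi> where \<phi>: "chart G K \<sigma> P \<phi>" using ex_chart s by blast
  have "\<phi> x \<in> gspace G" "\<phi> y \<in> gspace G"
    using \<phi> s gpolytope_subset unfolding chart_def bij_betw_def by blast+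
  moreover have "gdist G (\<phi> x) (\<phi> y) = 0"
    using \<phi> s f_isometry[OF s(1-3)] gdist_eq_0[of "f x" "f y"] f_gspace unfolding chart_def by auto
  ultimately have "\<phi> x = \<phi> y" using gdist_eq_0 by blast
  then show "x = y" using \<phi> s unfolding chart_def bij_betw_def inj_on_def by blast
qed

text \<open>The face is the image of some cell of the star; the combinatorial equivalence turns the
  inclusion of images into one of cells.\<close>

lemma gface_cellE:
  assumes "\<sigma> \<in> cells K" "gface G R (f ` \<sigma>)"
  obtains \<rho> where "\<rho> \<in> cells K" "\<rho> \<subseteq> \<sigma>" "R = f ` \<rho>"
proof -
  have \<sigma>: "\<sigma> \<in> cells (star \<sigma> K)" using assms star_subcell by blast
  obtain \<rho> where \<rho>: "\<rho> \<in> cells (star \<sigma> K)" "R = f ` \<rho>" 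
    using star_gface[OF assms(1) \<sigma> assms(2)] by blast
  have "f ` \<rho> \<subseteq> f ` \<sigma>" using gface_subset[OF gpolytope_cell] assms \<rho> by blast
  then have "\<rho> \<subseteq> \<sigma>"
    using comb_equiv_image(2)[OF finite_star star_comb_equiv] assms(1) \<rho> \<sigma> by blast
  then show thesis using that \<rho> by (auto simp: cells_star)
qed

lemma chart_f: "\<sigma> \<in> cells K \<Longrightarrow> chart G K \<sigma> (f ` \<sigma>) f"
  unfolding chart_def
proof (intro conjI allI impI)
  assume s: "\<sigma> \<in> cells K"
  show "gpolytope G (f ` \<sigma>)" using gpolytope_cell s by blast
  show "bij_betw f \<sigma> (f ` \<sigma>)" using f_inj_on_cell s by (simp add: bij_betw_def)
  show "\<forall>x\<in>\<sigma>. \<forall>y\<in>\<sigma>. gdist G (f x) (f y) = cdist K x y" using f_isometry s by blast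
  fix \<tau> assume t: "\<tau> \<subseteq> \<sigma>"
  show "(\<tau> \<in> cells K) = gface G (f ` \<tau>) (f ` \<sigma>)"
  proof
    show "\<tau> \<in> cells K" if face: "gface G (f ` \<tau>) (f ` \<sigma>)"
    proof -
      obtain \<rho> where \<rho>: "\<rho> \<in> cells K" "\<rho> \<subseteq> \<sigma>" "f ` \<tau> = f ` \<rho>" using gface_cellE[OF s face] by blast
      then have "\<tau> = \<rho>" using inj_on_image_eq_iff[OF f_inj_on_cell[OF s]] t by blast
      with \<rho> show ?thesis by simp
    qed
  qed (use gface_subcell s t in blast)
qed

text \<open>The common face is the image of a cell, and this cell lies in both because inclusions of
  images come from inclusions of cells. Injectivity of \<open>f\<close> on stars follows.\<close>

lemma star_image_Int:
  assumes "\<pi> \<in> cells K" "\<sigma> \<in> cells (star \<pi> K)" "\<tau> \<in> cells (star \<pi> K)"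
  shows "f ` \<sigma> \<inter> f ` \<tau> = f ` (\<sigma> \<inter> \<tau>)"
proof (intro equalityI subsetI)
  fix p assume p: "p \<in> f ` \<sigma> \<inter> f ` \<tau>"
  then have "gface G (f ` \<sigma> \<inter> f ` \<tau>) (f ` \<sigma>)" by (intro star_gface_Int[OF assms]) blast
  then obtain \<rho> where \<rho>: "\<rho> \<in> cells (star \<pi> K)" "f ` \<sigma> \<inter> f ` \<tau> = f ` \<rho>"
    using star_gface[OF assms(1,2)] by blast
  have "f ` \<rho> \<subseteq> f ` \<sigma>" "f ` \<rho> \<subseteq> f ` \<tau>" using \<rho>(2) by auto
  then have "\<rho> \<subseteq> \<sigma>" "\<rho> \<subseteq> \<tau>"
    using comb_equiv_image(2)[OF finite_star star_comb_equiv] assms \<rho>(1) by blast+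
  then show "p \<in> f ` (\<sigma> \<inter> \<tau>)" using p \<rho> by blast
qed auto

lemma f_inj_on_star:
  assumes "\<pi> \<in> cells K" "\<sigma> \<in> cells (star \<pi> K)" "\<tau> \<in> cells (star \<pi> K)" "x \<in> \<sigma>" "y \<in> \<tau>" "f x = f y"
  shows "x = y"
proof -
  have st: "\<sigma> \<in> cells K" "\<tau> \<in> cells K" using assms by (auto simp: cells_star)
  have "f x \<in> f ` (\<sigma> \<inter> \<tau>)" using star_image_Int[OF assms(1-3)] assms(4-6) by (metis IntI imageI)
  then obtain z where "z \<in> \<sigma>" "z \<in> \<tau>" "f z = f x" by auto
  then show ?thesis using f_inj_on_cell[OF st(1)] f_inj_on_cell[OF st(2)] assms unfolding inj_on_def by metis
qed

lemma finite_verts: "\<sigma> \<in> cells K \<Longrightarrow> finite (verts \<sigma>)"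
proof -
  assume "\<sigma> \<in> cells K"
  then have "(\<lambda>v. {v}) ` verts \<sigma> \<subseteq> cells (star \<sigma> K)" by (auto simp: vertices_def intro: star_subcell)
  then have "finite ((\<lambda>v. {v}) ` verts \<sigma>)" using finite_star[OF \<open>\<sigma> \<in> cells K\<close>] finite_subset by blast
  then show ?thesis by (rule finite_imageD) simp
qed

lemma gface_vertices: "\<sigma> \<in> cells K \<Longrightarrow> {p. gface G {p} (f ` \<sigma>)} = f ` verts \<sigma>"
proof (intro equalityI subsetI)
  fix p assume s: "\<sigma> \<in> cells K" and "p \<in> {p. gface G {p} (f ` \<sigma>)}"
  then obtain \<rho> where \<rho>: "\<rho> \<in> cells K" "\<rho> \<subseteq> \<sigma>" "{p} = f ` \<rho>" using gface_cellE[OF s] by blast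
  then have "is_singleton \<rho>"
    using f_inj_on_cell[OF \<rho>(1)] card_image[of f \<rho>] by (metis is_singletonI is_singleton_altdef)
  then obtain v where "\<rho> = {v}" by (auto simp: is_singleton_def)
  then show "p \<in> f ` verts \<sigma>" using \<rho> by (auto simp: vertices_def)
next
  fix p assume s: "\<sigma> \<in> cells K" and "p \<in> f ` verts \<sigma>"
  then obtain v where "{v} \<in> cells K" "v \<in> \<sigma>" "p = f v" by (auto simp: vertices_def)
  then show "p \<in> {p. gface G {p} (f ` \<sigma>)}" using gface_subcell[OF s, of "{v}"] by simp
qed

lemma cell_conic_span:
  assumes "\<sigma> \<in> cells K" "x \<in> \<sigma>"
  shows "F x \<in> conic_span F (verts \<sigma>)"
proof -
  have "L (f x) \<in> conic_span L (f ` verts \<sigma>)"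
    using gpolytope_vertex_cone[OF gpolytope_cell[OF assms(1)], of "f x"] gface_vertices[OF assms(1)]
      finite_verts assms by simp
  then obtain c where c: "\<And>v. v \<in> f ` verts \<sigma> \<Longrightarrow> (0::real) \<le> c v" "L (f x) = (\<Sum>v\<in>f ` verts \<sigma>. c v *\<^sub>R L v)"
    by (rule conic_spanE) blast
  have "inj_on f (verts \<sigma>)" using f_inj_on_cell[OF assms(1)] by (meson Int_lower2 inj_on_subset)
  then have "F x = (\<Sum>v\<in>verts \<sigma>. c (f v) *\<^sub>R F v)" using c(2) by (simp add: sum.reindex F_def)
  then show ?thesis unfolding conic_span_def using c(1) by (intro CollectI exI[of _ "\<lambda>v. c (f v)"]) auto
qed

lemma ex_vertex:
  assumes "\<sigma> \<in> cells K"
  obtains v where "v \<in> verts \<sigma>"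
  using gpolytope_has_vertex[OF gpolytope_cell[OF assms]] gface_vertices[OF assms] finite_verts[OF assms]
  by (metis (no_types, lifting) finite_imageI imageE mem_Collect_eq)

text \<open>The intersection with \<tau> is a face of \<sigma>; the functional cutting it out
  vanishes at all vertices of \<sigma>, hence on \<sigma>, whose cone they generate.\<close>

lemma cell_subset_if_verts_subset:
  assumes "\<sigma> \<in> cells K" "\<tau> \<in> cells K" "verts \<sigma> \<subseteq> \<tau>"
  shows "\<sigma> \<subseteq> \<tau>"
proof -
  obtain v where "v \<in> verts \<sigma>" using ex_vertex assms by blast
  then have "\<sigma> \<inter> \<tau> \<in> cells K" using cells_Int assms by blast
  then obtain a where a: "\<And>y. y \<in> f ` \<sigma> \<Longrightarrow> a \<bullet> L y \<le> 0" "f ` (\<sigma> \<inter> \<tau>) = {y \<in> f ` \<sigma>. a \<bullet> L y = 0}"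
    using gfaceE[OF gpolytope_cell[OF assms(1)] gface_subcell[OF assms(1) _ Int_lower1]] by blast
  have "a \<bullet> L (f x) = 0" if x: "x \<in> \<sigma>" for x
  proof -
    obtain c where "F x = (\<Sum>v\<in>verts \<sigma>. c v *\<^sub>R F v)"
      using cell_conic_span[OF assms(1) x] by (rule conic_spanE) blast
    then have "a \<bullet> L (f x) = (\<Sum>v\<in>verts \<sigma>. c v * (a \<bullet> L (f v)))" by (simp add: F_def inner_sum_right)
    also have "\<dots> = 0"
    proof (rule sum.neutral, rule ballI)
      fix v assume "v \<in> verts \<sigma>"
      then have "f v \<in> f ` (\<sigma> \<inter> \<tau>)" using assms by blast
      then show "c v * (a \<bullet> L (f v)) = 0" unfolding a(2) by simp
    qed
    finally show ?thesis .
  qed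
  then have "f ` \<sigma> \<subseteq> f ` (\<sigma> \<inter> \<tau>)" unfolding a(2) by blast
  then have "\<sigma> \<subseteq> \<sigma> \<inter> \<tau>" using inj_on_image_subset_iff[OF f_inj_on_cell[OF assms(1)]] by blast
  then show ?thesis by blast
qed

text \<open>Stated for subsets of cells because it is also applied to simplices of a subdivision,
  which need not be cells.\<close>

lemma isometric_chart_dim:
  assumes "\<sigma> \<in> cells K" "\<rho> \<subseteq> \<sigma>" and bij: "bij_betw \<phi> \<rho> P" and P: "P \<subseteq> gspace G"
    and iso: "\<And>x y. x \<in> \<rho> \<Longrightarrow> y \<in> \<rho> \<Longrightarrow> gdist G (\<phi> x) (\<phi> y) = cdist K x y"
  shows "dim (L ` f ` \<rho>) = dim (L ` P)"
proof -
  let ?g = "f \<circ> inv_into \<rho> \<phi>"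
  have img: "?g ` P = f ` \<rho>" using bij_betw_inv_into[OF bij] unfolding bij_betw_def image_comp[symmetric] by simp
  have "gdist G (?g x) (?g y) = gdist G x y" if "x \<in> P" "y \<in> P" for x y
  proof -
    have *: "inv_into \<rho> \<phi> x \<in> \<rho>" "inv_into \<rho> \<phi> y \<in> \<rho>" "\<phi> (inv_into \<rho> \<phi> x) = x" "\<phi> (inv_into \<rho> \<phi> y) = y"
      using bij that by (auto simp: bij_betw_def inv_into_into f_inv_into_f)
    have "gdist G (?g x) (?g y) = cdist K (inv_into \<rho> \<phi> x) (inv_into \<rho> \<phi> y)"
      using f_isometry[OF assms(1)] *(1,2) assms(2) by (simp add: subset_iff)
    also have "\<dots> = gdist G x y" using iso[OF *(1,2)] * by simp
    finally show ?thesis .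
  qed
  moreover have "?g ` P \<subseteq> gspace G" unfolding img using f_gspace[OF assms(1)] assms(2) by blast
  ultimately have "dim (L ` ?g ` P) = dim (L ` P)" using isometry_dim[of P ?g] P by blast
  then show ?thesis using img by simp
qed

lemma chart_gdim:
  assumes "\<sigma> \<in> cells K" "chart G K' \<sigma> P \<phi>" "cdist K' = cdist K"
  shows "gdim G P = int (dim (L ` f ` \<sigma>)) - 1"
proof -
  have \<phi>: "gpolytope G P" "bij_betw \<phi> \<sigma> P" "\<And>x y. x \<in> \<sigma> \<Longrightarrow> y \<in> \<sigma> \<Longrightarrow> gdist G (\<phi> x) (\<phi> y) = cdist K x y"
    using assms(2,3) unfolding chart_def by auto
  have P: "P \<subseteq> gspace G" "P \<noteq> {}" using \<phi>(1) gpolytope_subset gpolytope_nonempty by auto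
  show ?thesis using gdim_eq[OF P] isometric_chart_dim[OF assms(1) _ \<phi>(2) P(1) \<phi>(3)] by simp
qed

lemma has_cell_dim_iff:
  assumes "\<sigma> \<in> cells K"
  shows "has_cell_dim G K \<sigma> n \<longleftrightarrow> n = int (dim (L ` f ` \<sigma>)) - 1"
  unfolding has_cell_dim_def using chart_gdim[OF assms] chart_f[OF assms] by blast

text \<open>For a vertex \<open>v\<close> the set \<open>U v\<close> contains no other vertex, and
  it is open as each cell has finitely many vertices; a finite subcover therefore names all
  vertices.\<close>

lemma finite_vertices:
  assumes "compact_space (complex_topology K)"
  shows "finite (vertices K)"
proof (cases "vertices K = {}")
  case False
  define U where "U v = \<Union>(cells K) - (vertices K - {v})" for v
  have "complex_open K (U v)" for v
    unfolding complex_open_def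
  proof (intro conjI ballI)
    fix \<sigma> x assume s: "\<sigma> \<in> cells K" and x: "x \<in> U v \<inter> \<sigma>"
    let ?W = "verts \<sigma> - {v}"
    have pos: "0 < cdist K x w" if "w \<in> ?W" for w
    proof -
      have w: "w \<in> \<sigma>" "w \<noteq> x" using that x by (auto simp: U_def)
      then have "f w \<noteq> f x" using f_inj_on_cell[OF s] x by (auto simp: inj_on_def)
      then have "0 < gdist G (f x) (f w)"
        using gdist_nonneg gdist_eq_0 f_gspace[OF s] w x by (metis IntD2 order_le_less)
      then show ?thesis using f_isometry[OF s] w x by simp
    qed
    have fin: "finite ?W" using finite_verts s by blast
    \<comment> \<open>The inserted 1 serves cells with no vertex other than
      \<open>v\<close>.\<close>
    define e where "e = Min (insert 1 (cdist K x ` ?W))"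
    have "0 < e" unfolding e_def using fin pos by simp
    moreover have "y \<in> U v" if "y \<in> \<sigma>" "cdist K x y < e" for y
    proof -
      have "y \<notin> ?W" using that fin unfolding e_def by auto
      then show ?thesis using that s by (auto simp: U_def)
    qed
    ultimately show "\<exists>e>0. \<forall>y\<in>\<sigma>. cdist K x y < e \<longrightarrow> y \<in> U v" by blast
  qed (auto simp: U_def)
  then have "\<forall>W\<in>U ` vertices K. openin (complex_topology K) W" by (simp add: openin_complex_topology)
  moreover have "topspace (complex_topology K) \<subseteq> \<Union>(U ` vertices K)"
    using False by (auto simp: topspace_complex_topology U_def)
  ultimately obtain \<F> where \<F>: "finite \<F>" "\<F> \<subseteq> U ` vertices K" "topspace (complex_topology K) \<subseteq> \<Union>\<F>"
    using assms unfolding compact_space_alt by meson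
  then obtain W where W: "finite W" "W \<subseteq> vertices K" "\<F> = U ` W" using finite_subset_image by metis
  have "vertices K \<subseteq> W"
  proof
    fix v assume v: "v \<in> vertices K"
    then have "v \<in> \<Union>\<F>" using \<F>(3) by (auto simp: topspace_complex_topology vertices_def)
    then obtain w where "w \<in> W" "v \<in> U w" using W(3) by blast
    then show "v \<in> W" using v unfolding U_def by blast
  qed
  then show ?thesis using W(1) finite_subset by blast
qed simp

lemma finite_cells:
  assumes "compact_space (complex_topology K)"
  shows "finite (cells K)"
proof -
  have "cells K \<subseteq> (\<Union>v\<in>vertices K. cells (star {v} K))"
  proof
    fix \<sigma> assume s: "\<sigma> \<in> cells K"
    then obtain v where "v \<in> verts \<sigma>" using ex_vertex by blast
    then show "\<sigma> \<in> (\<Union>v\<in>vertices K. cells (star {v} K))" using s by (auto simp: cells_star vertices_def)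
  qed
  moreover have "finite (\<Union>v\<in>vertices K. cells (star {v} K))"
    using finite_vertices[OF assms] finite_star by (auto simp: vertices_def)
  ultimately show ?thesis using finite_subset by blast
qed

text \<open>A common cell rather than an edge: the vertices of a facet are pairwise adjacent, so a
  path may cross a facet in one step.\<close>

definition adj :: "'p \<Rightarrow> 'p \<Rightarrow> bool" where
  "adj x y \<longleftrightarrow> (\<exists>\<sigma>\<in>cells K. x \<in> verts \<sigma> \<and> y \<in> verts \<sigma>)"

text \<open>Intersecting cells share a vertex, so they are reached together or not at all; the
  unions of reached and of unreached cells are then disjoint and both open.\<close>

lemma vertex_graph_connected:
  assumes conn: "connected_space (complex_topology K)" and xy: "x \<in> vertices K" "y \<in> vertices K"
  shows "adj\<^sup>*\<^sup>* x y"
proof -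
  define reach where "reach \<sigma> \<longleftrightarrow> (\<exists>v\<in>verts \<sigma>. adj\<^sup>*\<^sup>* x v)" for \<sigma>
  define U where "U = \<Union>{\<sigma> \<in> cells K. reach \<sigma>}"
  define W where "W = \<Union>{\<sigma> \<in> cells K. \<not> reach \<sigma>}"
  have reach_all: "adj\<^sup>*\<^sup>* x v" if v: "\<sigma> \<in> cells K" "reach \<sigma>" "v \<in> verts \<sigma>" for \<sigma> v
  proof -
    obtain w where w: "w \<in> verts \<sigma>" "adj\<^sup>*\<^sup>* x w" using v(2) unfolding reach_def by blast
    have "adj w v" unfolding adj_def using v(1,3) w(1) by blast
    then show ?thesis using w(2) by (rule rtranclp.rtrancl_into_rtrancl[rotated])
  qed
  have meet: "reach \<sigma> \<longleftrightarrow> reach \<tau>" if m: "\<sigma> \<in> cells K" "\<tau> \<in> cells K" "\<sigma> \<inter> \<tau> \<noteq> {}" for \<sigma> \<tau>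
  proof -
    obtain v where "v \<in> verts (\<sigma> \<inter> \<tau>)" using ex_vertex[OF cells_Int[OF m]] by blast
    then have "v \<in> verts \<sigma>" "v \<in> verts \<tau>" by auto
    then show ?thesis using reach_all that reach_def by metis
  qed
  have "complex_open K U" unfolding complex_open_def U_def
    using meet by (auto intro!: exI[of _ 1]) blast
  moreover have "complex_open K W" unfolding complex_open_def W_def
    using meet by (auto intro!: exI[of _ 1]) blast
  moreover have "U \<inter> W = {}" unfolding U_def W_def using meet by blast
  moreover have "topspace (complex_topology K) \<subseteq> U \<union> W"
    unfolding topspace_complex_topology U_def W_def by blast
  ultimately have "U = {} \<or> W = {}"
    using conn unfolding connected_space_def openin_complex_topology by blast
  moreover have "x \<in> U"
    using xy unfolding U_def reach_def by (auto simp: vertices_def intro!: exI[of _ "{x}"])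
  ultimately have "W = {}" by blast
  then have "reach {y}" using xy unfolding W_def by (auto simp: vertices_def)
  then show ?thesis unfolding reach_def by blast
qed

end

subsection \<open>Dimension\<close>

text \<open>A segment from a point outside \<open>A\<close> to a point outside the other sets meets
  \<open>A\<close> in its end only. So one of the other sets contains two of its infinitely many
  remaining points, hence also the end. It will be applied to a simplex covered by the affine hulls
  of the cells of a subdivision.\<close>

lemma convex_covered_by_affine:
  fixes S :: "'a::real_vector set"
  assumes "finite \<A>" "\<And>A. A \<in> \<A> \<Longrightarrow> affine A" "convex S" "S \<noteq> {}" "S \<subseteq> \<Union>\<A>"
  shows "\<exists>A\<in>\<A>. S \<subseteq> A"
  using assms(1,2,5)
proof (induction \<A> rule: finite_induct)
  case empty
  then show ?case using assms(4) by simp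
next
  case (insert A \<A>)
  show ?case
  proof (cases "S \<subseteq> A")
    case False
    then obtain p where p: "p \<in> S" "p \<notin> A" by blast
    have "S \<subseteq> \<Union>\<A>"
    proof (rule ccontr)
      assume "\<not> S \<subseteq> \<Union>\<A>"
      then obtain q where q: "q \<in> S" "q \<notin> \<Union>\<A>" by blast
      then have qA: "q \<in> A" using insert.prems by blast
      define x where "x t = p + t *\<^sub>R (q - p)" for t :: real
      have x_conv: "x t = (1 - t) *\<^sub>R p + t *\<^sub>R q" for t by (simp add: x_def algebra_simps)
      have comb: "\<exists>u v. u + v = 1 \<and> x r = u *\<^sub>R x s + v *\<^sub>R x t" if "s \<noteq> t" for r s t
      proof -
        define u where "u = (r - t) / (s - t)"
        have "u * (s - t) = r - t" using that by (simp add: u_def)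
        then have eq: "u * s + (1 - u) * t = r" by (simp add: algebra_simps)
        have "u *\<^sub>R x s + (1 - u) *\<^sub>R x t = p + (u * s + (1 - u) * t) *\<^sub>R (q - p)"
          by (simp add: x_def algebra_simps)
        then have "x r = u *\<^sub>R x s + (1 - u) *\<^sub>R x t" unfolding eq by (simp add: x_def)
        then show ?thesis by (intro exI[of _ u] exI[of _ "1 - u"]) simp
      qed
      have x01: "x 0 = p" "x 1 = q" by (simp_all add: x_def)
      have "\<exists>B\<in>\<A>. x t \<in> B" if t: "t \<in> {0..<1}" for t
      proof -
        have "x t \<in> S" unfolding x_conv using p q t assms(3) by (intro convexD) auto
        moreover have "x t \<notin> A"
        proof
          assume "x t \<in> A"
          moreover obtain u v where "u + v = 1" "x 0 = u *\<^sub>R x t + v *\<^sub>R x 1" using comb[of t 1 0] t by auto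
          ultimately have "x 0 \<in> A" using insert.prems(1)[of A] qA x01 mem_affine by fastforce
          then show False using p x01 by simp
        qed
        ultimately show ?thesis using insert.prems by blast
      qed
      then obtain B where B: "\<And>t. t \<in> {0..<1} \<Longrightarrow> B t \<in> \<A> \<and> x t \<in> B t" by metis
      have "infinite {0..<1::real}" by (simp add: infinite_Ico)
      moreover have "finite (B ` {0..<1})" using insert.hyps(1) B by (meson finite_subset image_subsetI)
      ultimately have "\<not> inj_on B {0..<1}" using finite_imageD by blast
      then obtain s t where st: "s \<in> {0..<1}" "t \<in> {0..<1}" "s \<noteq> t" "B s = B t" unfolding inj_on_def by blast
      obtain u v where "u + v = 1" "x 1 = u *\<^sub>R x s + v *\<^sub>R x t" using comb[OF st(3)] by blast
      then have "x 1 \<in> B s" using B[OF st(1)] B[OF st(2)] st(4) insert.prems(1)[of "B s"] mem_affine by fastforce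
      then show False using q x01 B[OF st(1)] by blast
    qed
    then show ?thesis using insert by blast
  qed simp
qed

text \<open>Obtained by descending through facets. Combinatorial equivalences preserve such chains,
  so their length carries dimension across.\<close>

lemma polytope_face_chain:
  fixes Q :: "'a::euclidean_space set"
  assumes "polytope Q" "int k \<le> aff_dim Q"
  shows "\<exists>c. (\<forall>i\<le>k. c i face_of Q \<and> c i \<noteq> {}) \<and> (\<forall>i<k. c i \<subset> c (Suc i))"
  using assms
proof (induction k arbitrary: Q)
  case 0
  then have "Q \<noteq> {}" by auto
  then show ?case using face_of_refl[OF polytope_imp_convex[OF 0(1)]] by (intro exI[of _ "\<lambda>_. Q"]) simp
next
  case (Suc k)
  then have "0 < aff_dim Q" by simp
  then obtain R where R: "R facet_of Q" using polytope_facet_exists[OF Suc.prems(1)] by blast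
  then have R': "polytope R" "int k \<le> aff_dim R" "R face_of Q" "R \<noteq> Q"
    using Suc.prems face_of_polytope_polytope facet_of_imp_face_of by (auto simp: facet_of_def)
  then obtain c where c: "\<forall>i\<le>k. c i face_of R \<and> c i \<noteq> {}" "\<forall>i<k. c i \<subset> c (Suc i)"
    using Suc.IH[OF R'(1,2)] by auto
  have "c k \<subset> Q" using c(1) R' face_of_imp_subset by blast
  moreover have "Q face_of Q" "Q \<noteq> {}" using face_of_refl polytope_imp_convex Suc.prems by auto
  ultimately show ?case
    using c face_of_trans[OF _ R'(3)]
    by (intro exI[of _ "\<lambda>i. if i \<le> k then c i else Q"]) (auto simp: le_Suc_eq less_Suc_eq)
qed

text \<open>Linear relations are detected by inner products: a combination of points and the same
  combination of their images have equal norm.\<close>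

lemma dim_le_dim_image_inner_preserving:
  fixes g :: "'a::euclidean_space \<Rightarrow> 'b::euclidean_space"
  assumes "\<And>x y. x \<in> A \<Longrightarrow> y \<in> A \<Longrightarrow> g x \<bullet> g y = x \<bullet> y"
  shows "dim A \<le> dim (g ` A)" "inj_on g A"
proof -
  show inj: "inj_on g A"
  proof (rule inj_onI)
    fix x y assume xy: "x \<in> A" "y \<in> A" "g x = g y"
    have "x \<bullet> x = y \<bullet> y" "x \<bullet> y = y \<bullet> y" "y \<bullet> x = y \<bullet> y"
      using assms[of x x] assms[of y y] assms[of x y] assms[of y x] xy by auto
    then have "(x - y) \<bullet> (x - y) = 0" by (simp add: inner_diff_left inner_diff_right)
    then show "x = y" by simp
  qed
  obtain B where B: "B \<subseteq> A" "independent B" "card B = dim A" using basis_exists by metis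
  then have finB: "finite B" using independent_imp_finite by blast
  have injB: "inj_on g B" using inj B inj_on_subset by blast
  have "independent (g ` B)"
  proof
    assume "dependent (g ` B)"
    then obtain u where u: "\<exists>w\<in>g ` B. u w \<noteq> 0" "(\<Sum>w\<in>g ` B. u w *\<^sub>R w) = 0"
      using dependent_finite[of "g ` B"] finB by auto
    then have 0: "(\<Sum>v\<in>B. u (g v) *\<^sub>R g v) = 0" using injB by (simp add: sum.reindex)
    have "(\<Sum>v\<in>B. u (g v) *\<^sub>R v) \<bullet> (\<Sum>v\<in>B. u (g v) *\<^sub>R v)
        = (\<Sum>v\<in>B. u (g v) *\<^sub>R g v) \<bullet> (\<Sum>v\<in>B. u (g v) *\<^sub>R g v)"
      unfolding inner_sum_left inner_sum_right using B(1)
      by (intro sum.cong refl) (auto simp: assms subset_iff)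
    then have "(\<Sum>v\<in>B. u (g v) *\<^sub>R v) = 0" using 0 by simp
    then have "dependent B" unfolding dependent_finite[OF finB]
      using u(1) by (intro exI[of _ "\<lambda>v. u (g v)"]) auto
    then show False using B(2) by simp
  qed
  then have "card (g ` B) \<le> dim (g ` A)" using B(1) by (intro independent_card_le_dim) auto
  then show "dim A \<le> dim (g ` A)" using B(3) card_image[OF injB] by simp
qed

lemma dim_image_inner_preserving:
  fixes g :: "'a::euclidean_space \<Rightarrow> 'b::euclidean_space"
  assumes "\<And>x y. x \<in> A \<Longrightarrow> y \<in> A \<Longrightarrow> g x \<bullet> g y = x \<bullet> y"
  shows "dim (g ` A) = dim A"
proof (rule antisym)
  have inj: "inj_on g A" and le: "dim A \<le> dim (g ` A)"
    using dim_le_dim_image_inner_preserving[of A g] assms by blast+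
  have "dim (g ` A) \<le> dim (inv_into A g ` g ` A)"
    by (rule dim_le_dim_image_inner_preserving) (auto simp: inj assms)
  then show "dim (g ` A) \<le> dim A" using inj by simp
  show "dim A \<le> dim (g ` A)" by (rule le)
qed

text \<open>After moving a point of \<open>A\<close> and its image to the origin, polarization
  recovers inner products from distances.\<close>

lemma aff_dim_image_isometry:
  fixes g :: "'a::euclidean_space \<Rightarrow> 'b::euclidean_space"
  assumes "\<And>x y. x \<in> A \<Longrightarrow> y \<in> A \<Longrightarrow> dist (g x) (g y) = dist x y"
  shows "aff_dim (g ` A) = aff_dim A"
proof (cases "A = {}")
  case False
  then obtain a where a: "a \<in> A" by blast
  let ?h = "\<lambda>y. g (y + a) - g a"
  have "dim (?h ` (\<lambda>x. x - a) ` A) = dim ((\<lambda>x. x - a) ` A)"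
  proof (rule dim_image_inner_preserving, clarsimp)
    fix x y assume xy: "x \<in> A" "y \<in> A"
    show "(g x - g a) \<bullet> (g y - g a) = (x - a) \<bullet> (y - a)"
      unfolding dot_norm_neg using assms[OF xy(1) a] assms[OF xy(2) a] assms[OF xy] by (simp add: dist_norm)
  qed
  moreover have "?h ` (\<lambda>x. x - a) ` A = (\<lambda>x. x - g a) ` g ` A" by (simp add: image_image)
  moreover have "aff_dim A = int (dim ((\<lambda>x. x - a) ` A))"
    by (rule aff_dim_eq_dim_subtract[OF hull_inc[OF a]])
  moreover have "aff_dim (g ` A) = int (dim ((\<lambda>x. x - g a) ` g ` A))"
    by (rule aff_dim_eq_dim_subtract[OF hull_inc[OF imageI[OF a]]])
  ultimately show ?thesis by simp
qed simp

context lifted_geometry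
begin

text \<open>The functional cutting out a face is nonzero somewhere on a strictly larger one, so each
  step raises the dimension of the cone, which is at least 1 at the start because \<open>L\<close>
  does not vanish.\<close>

lemma gface_chain_dim:
  assumes P: "gpolytope G P" and c: "\<And>i. i \<le> k \<Longrightarrow> gface G (c i) P" "\<And>i. i < k \<Longrightarrow> c i \<subset> c (Suc i)"
  shows "k + 1 \<le> dim (L ` P)"
proof -
  have sub: "c i \<subseteq> P" if "i \<le> k" for i using gface_subset[OF P c(1)[OF that]] .
  have "i + 1 \<le> dim (L ` c i)" if "i \<le> k" for i
    using that
  proof (induction i)
    case 0
    obtain x where x: "x \<in> c 0" using c(1)[of 0] gface_iff[OF P] by auto
    then have "L x \<noteq> 0" using polytope_section[OF P] sub[of 0] by (metis inner_zero_right less_irrefl subsetD le0)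
    then have "dim (L ` c 0) \<noteq> 0" using x dim_eq_0[of "L ` c 0"] by auto
    then show ?case by linarith
  next
    case (Suc i)
    obtain a where a: "c i = {y \<in> P. a \<bullet> L y = 0}" using gfaceE[OF P c(1)] Suc.prems by (metis Suc_leD)
    obtain x where x: "x \<in> c (Suc i)" "x \<notin> c i" using c(2)[of i] Suc.prems by auto
    then have "a \<bullet> L x \<noteq> 0" using a sub[OF Suc.prems] by blast
    moreover have "span (L ` c i) \<subseteq> {y. a \<bullet> y = 0}" using a by (intro span_minimal) (auto simp: subspace_hyperplane)
    ultimately have "L x \<notin> span (L ` c i)" by blast
    then have "dim (insert (L x) (L ` c i)) = dim (L ` c i) + 1" by (simp add: dim_insert)
    moreover have "dim (insert (L x) (L ` c i)) \<le> dim (L ` c (Suc i))"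
      using x c(2)[of i] Suc.prems by (intro dim_subset) auto
    ultimately show ?case using Suc by simp
  qed
  then have "k + 1 \<le> dim (L ` c k)" by simp
  also have "\<dots> \<le> dim (L ` P)" using sub[of k] by (intro dim_subset) auto
  finally show ?thesis .
qed

end

context lifted_precomplex
begin

text \<open>\<open>pl_homeomorphic\<close> relates subdivisions combinatorially, not metrically. The
  dimension is carried by a chain of \<open>m + 1\<close> nested faces: it exists in a cell of
  \<open>T\<close> spanning \<Delta>, is moved to \<open>S\<close> by the equivalence, and bounds
  the dimension there from below.\<close>

lemma ex_full_dimensional_cell:
  assumes pl: "pl_homeomorphic G (star {v} K) (euclidean_geometry :: 'b::euclidean_space geometry) (simplex_complex \<Delta>)"
    and \<Delta>: "int m simplex \<Delta>"
  shows "\<exists>\<tau>\<in>cells (star {v} K). m + 1 \<le> dim (L ` f ` \<tau>)"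
proof -
  obtain S T where S: "simplicial_subdivision G (star {v} K) S"
    and T: "simplicial_subdivision (euclidean_geometry :: 'b geometry) (simplex_complex \<Delta>) T" and ST: "comb_equiv S T"
    using pl unfolding pl_homeomorphic_def by blast
  have \<Delta>': "convex \<Delta>" "\<Delta> \<noteq> {}" "aff_dim \<Delta> = int m"
    using \<Delta> convex_simplex aff_dim_simplex by (auto dest: aff_dim_simplex)
  have "\<Union>(cells (simplex_complex \<Delta>)) = \<Delta>"
    using face_of_refl[OF \<Delta>'(1)] \<Delta>'(2) face_of_imp_subset unfolding simplex_complex_def by fastforce
  then have UT: "\<Union>T = \<Delta>" and finT: "finite T" using T unfolding simplicial_subdivision_def by auto
  have "\<exists>A\<in>(\<lambda>t. affine hull t) ` T. \<Delta> \<subseteq> A"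
  proof (rule convex_covered_by_affine)
    show "\<Delta> \<subseteq> \<Union>((\<lambda>t. affine hull t) ` T)" unfolding UT[symmetric] using hull_subset by fast
  qed (use finT \<Delta>' in auto)
  then obtain t where t: "t \<in> T" "\<Delta> \<subseteq> affine hull t" by blast
  then have "int m \<le> aff_dim t" using aff_dim_subset[of \<Delta> "affine hull t"] \<Delta>'(3) by simp
  obtain Q \<psi> where "chart (euclidean_geometry :: 'b geometry) ((simplex_complex \<Delta>)\<lparr>cells := T\<rparr>) t Q \<psi>"
    using T t(1) unfolding simplicial_subdivision_def abstract_complex_def by auto
  then have Q: "polytope Q" "bij_betw \<psi> t Q" "\<And>x y. x \<in> t \<Longrightarrow> y \<in> t \<Longrightarrow> dist (\<psi> x) (\<psi> y) = dist x y"
    "\<And>\<tau>. \<tau> \<subseteq> t \<Longrightarrow> \<psi> ` \<tau> face_of Q \<Longrightarrow> \<psi> ` \<tau> \<noteq> {} \<Longrightarrow> \<tau> \<in> T"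
    unfolding chart_def by (simp_all add: euclidean_geometry_def simplex_complex_def)
  have "aff_dim Q = aff_dim t" using aff_dim_image_isometry[of t \<psi>] Q(2,3) by (simp add: bij_betw_def)
  then have mQ: "int m \<le> aff_dim Q" using \<open>int m \<le> aff_dim t\<close> by simp
  obtain c where c: "\<forall>i\<le>m. c i face_of Q \<and> c i \<noteq> {}" "\<forall>i<m. c i \<subset> c (Suc i)"
    using polytope_face_chain[OF Q(1) mQ] by auto
  define r where "r i = {x \<in> t. \<psi> x \<in> c i}" for i
  have \<psi>r: "\<psi> ` r i = c i" if "i \<le> m" for i
  proof -
    have "c i \<subseteq> \<psi> ` t" using c(1) that face_of_imp_subset Q(2) unfolding bij_betw_def by blast
    then show ?thesis unfolding r_def by blast
  qed
  have rT: "r i \<in> T" if "i \<le> m" for i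
    by (rule Q(4)) (use \<psi>r[OF that] c(1) that in \<open>auto simp: r_def\<close>)
  have r_strict: "r i \<subset> r (Suc i)" if "i < m" for i
  proof -
    have "r i \<subseteq> r (Suc i)" using c(2) that unfolding r_def by blast
    moreover have "r i \<noteq> r (Suc i)" using \<psi>r[of i] \<psi>r[of "Suc i"] c(2) that by auto
    ultimately show ?thesis by blast
  qed
  obtain h where h: "bij_betw h S T" "\<And>\<sigma> \<tau>. \<sigma> \<in> S \<Longrightarrow> \<tau> \<in> S \<Longrightarrow> \<sigma> \<subseteq> \<tau> \<longleftrightarrow> h \<sigma> \<subseteq> h \<tau>"
    using ST unfolding comb_equiv_def by auto
  define s where "s i = inv_into S h (r i)" for i
  have s: "s i \<in> S" "h (s i) = r i" if "i \<le> m" for i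
    using rT[OF that] h(1) unfolding s_def bij_betw_def by (simp_all add: inv_into_into f_inv_into_f)
  have s_strict: "s i \<subset> s (Suc i)" if "i < m" for i
  proof -
    have "s i \<subseteq> s (Suc i)" "\<not> s (Suc i) \<subseteq> s i"
      using h(2)[of "s i" "s (Suc i)"] h(2)[of "s (Suc i)" "s i"] s[of i] s[of "Suc i"] r_strict[OF that] that by auto
    then show ?thesis by blast
  qed
  have s_sub: "s i \<subseteq> s m" if "i \<le> m" for i
    using that by (induction rule: inc_induct) (use s_strict in blast)+
  obtain P \<phi> where "chart G ((star {v} K)\<lparr>cells := S\<rparr>) (s m) P \<phi>"
    using S s(1)[of m] unfolding simplicial_subdivision_def abstract_complex_def by auto
  then have P: "gpolytope G P" "bij_betw \<phi> (s m) P"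
    "\<And>x y. x \<in> s m \<Longrightarrow> y \<in> s m \<Longrightarrow> gdist G (\<phi> x) (\<phi> y) = cdist K x y"
    "\<And>\<tau>. \<tau> \<subseteq> s m \<Longrightarrow> \<tau> \<in> S \<Longrightarrow> gface G (\<phi> ` \<tau>) P"
    unfolding chart_def by (simp_all add: star_def)
  have inj: "inj_on \<phi> (s m)" using P(2) by (simp add: bij_betw_def)
  have "m + 1 \<le> dim (L ` P)"
  proof (rule gface_chain_dim[OF P(1), of m "\<lambda>i. \<phi> ` s i"])
    show "gface G (\<phi> ` s i) P" if "i \<le> m" for i using P(4) s_sub s(1) that by blast
    show "\<phi> ` s i \<subset> \<phi> ` s (Suc i)" if "i < m" for i
      using s_strict[OF that] inj_on_image_eq_iff[OF inj s_sub[of i] s_sub[of "Suc i"]] that by auto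
  qed
  moreover obtain \<tau> where \<tau>: "\<tau> \<in> cells (star {v} K)" "s m \<subseteq> \<tau>"
    using S s(1)[of m] unfolding simplicial_subdivision_def by auto
  moreover have "dim (L ` f ` s m) = dim (L ` P)"
    using isometric_chart_dim[OF _ \<tau>(2) P(2) gpolytope_subset[OF P(1)] P(3)] \<tau>(1) by (simp add: cells_star)
  moreover have "dim (L ` f ` s m) \<le> dim (L ` f ` \<tau>)" using \<tau>(2) by (intro dim_subset image_mono)
  ultimately show ?thesis by (intro bexI[of _ \<tau>]) auto
qed

end

subsection \<open>Closed premanifolds in locally convex position\<close>

locale closed_locally_convex_premanifold = lifted_precomplex G L K f
  for G :: "'a::euclidean_space geometry" and L :: "'a \<Rightarrow> 'e::euclidean_space"
    and K :: "'p polycomplex" and f :: "'p \<Rightarrow> 'a" +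
  fixes d :: nat
  assumes dim_E: "DIM('e) = d + 1" and d3: "3 \<le> d"
    and manifold: "pl_manifold G (d - 1) K"
    and connected_K: "connected_space (complex_topology K)"
    and closed_K: "closed_complex G (d - 1) K"
    and locally_convex: "locally_convex_position G K f"
begin

section \<open>Facets, their normals and the facets across their ridges\<close>

lemma compact_K: "compact_space (complex_topology K)"
  using closed_K by (simp add: closed_complex_def)

lemma facet_cell: "\<sigma> \<in> facets K \<Longrightarrow> \<sigma> \<in> cells K"
  by (simp add: facets_def)

lemma ex_facet:
  assumes "\<sigma> \<in> cells K"
  obtains \<tau> where "\<tau> \<in> facets K" "\<sigma> \<subseteq> \<tau>"
proof -
  obtain \<tau> where "\<tau> \<in> cells K" "\<sigma> \<subseteq> \<tau>" "\<And>\<rho>. \<rho> \<in> cells K \<Longrightarrow> \<tau> \<subseteq> \<rho> \<Longrightarrow> \<tau> = \<rho>"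
    using finite_has_maximal2[OF finite_cells[OF compact_K] assms] by metis
  then have "\<tau> \<in> facets K" "\<sigma> \<subseteq> \<tau>" by (auto simp: facets_def)
  then show thesis by (rule that)
qed

lemma facets_star:
  assumes "\<sigma> \<in> facets K" "v \<in> \<sigma>"
  shows "\<sigma> \<in> facets (star {v} K)"
  using assms unfolding facets_def by (auto simp: cells_star)

lemma vertices_star: "v \<in> vertices K \<Longrightarrow> y \<in> vertices (star {v} K) \<longleftrightarrow> adj v y"
  unfolding vertices_def adj_def by (auto simp: cells_star)

lemma vertex_cell: "v \<in> vertices K \<Longrightarrow> {v} \<in> cells K"
  by (simp add: vertices_def)

text \<open>Local convexity in linear form. Strictness off \<sigma> rests on injectivity of
  \<open>f\<close> on the star: otherwise a vertex outside \<sigma> could share its image with one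
  of \<sigma>.\<close>

lemma facet_normal:
  assumes \<sigma>: "\<sigma> \<in> facets K" and v: "v \<in> verts \<sigma>"
  obtains n where "n \<noteq> 0" "\<And>y. y \<in> verts \<sigma> \<Longrightarrow> n \<bullet> F y = 0"
    "\<And>y. adj v y \<Longrightarrow> y \<notin> \<sigma> \<Longrightarrow> n \<bullet> F y < 0"
proof -
  have vK: "v \<in> vertices K" and vc: "{v} \<in> cells K" using v by (auto simp: vertices_def)
  have \<sigma>s: "\<sigma> \<in> cells (star {v} K)" using \<sigma> v facet_cell by (auto simp: cells_star)
  have "convex_position G (star {v} K) f"
    using locally_convex vK unfolding locally_convex_position_def by blast
  then obtain H B where HB: "ghalfspace G H B" "f ` \<Union>(cells (star {v} K)) \<subseteq> H"
    "f ` vertices (star {v} K) \<inter> B = f ` (vertices (star {v} K) \<inter> \<sigma>)"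
    using facets_star \<sigma> v unfolding convex_position_def by blast
  obtain n where n: "n \<noteq> 0" "H = {x \<in> gspace G. n \<bullet> L x \<le> 0}" "B = {x \<in> gspace G. n \<bullet> L x = 0}"
    using ghalfspaceD[OF HB(1)] by blast
  show thesis
  proof (rule that[OF n(1)])
    fix y assume y: "y \<in> verts \<sigma>"
    then have "adj v y" using v facet_cell[OF \<sigma>] unfolding adj_def by blast
    then have "f y \<in> f ` (vertices (star {v} K) \<inter> \<sigma>)" using vertices_star[OF vK] y by blast
    then have "f y \<in> B" using HB(3) by blast
    then show "n \<bullet> F y = 0" using n(3) by (simp add: F_def)
  next
    fix y assume y: "adj v y" "y \<notin> \<sigma>"
    then have yv: "y \<in> vertices (star {v} K)" using vertices_star[OF vK] by blast
    then have yc: "{y} \<in> cells (star {v} K)" by (simp add: vertices_def)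
    then have le: "f y \<in> H" using HB(2) by blast
    have "f y \<notin> B"
    proof
      assume "f y \<in> B"
      then have "f y \<in> f ` (vertices (star {v} K) \<inter> \<sigma>)" using HB(3) yv by blast
      then obtain z where "z \<in> \<sigma>" "f y = f z" by blast
      then have "y = z" using f_inj_on_star[OF vc yc \<sigma>s] by blast
      then show False using \<open>z \<in> \<sigma>\<close> y by simp
    qed
    then show "n \<bullet> F y < 0" using le n by (auto simp: F_def)
  qed
qed

lemma zero_on_cell:
  assumes "\<sigma> \<in> cells K" "\<And>y. y \<in> verts \<sigma> \<Longrightarrow> n \<bullet> F y = 0" "x \<in> \<sigma>"
  shows "n \<bullet> F x = 0"
proof -
  obtain c where "F x = (\<Sum>v\<in>verts \<sigma>. c v *\<^sub>R F v)"
    using cell_conic_span[OF assms(1,3)] by (rule conic_spanE) blast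
  then show ?thesis using assms(2) by (simp add: inner_sum_right)
qed

lemma nonpos_on_cell:
  assumes "\<sigma> \<in> cells K" "\<And>y. y \<in> verts \<sigma> \<Longrightarrow> n \<bullet> F y \<le> 0" "x \<in> \<sigma>"
  shows "n \<bullet> F x \<le> 0"
proof -
  obtain c where c: "\<And>v. v \<in> verts \<sigma> \<Longrightarrow> (0::real) \<le> c v" "F x = (\<Sum>v\<in>verts \<sigma>. c v *\<^sub>R F v)"
    using cell_conic_span[OF assms(1,3)] by (rule conic_spanE) blast
  then have "n \<bullet> F x = (\<Sum>v\<in>verts \<sigma>. c v * (n \<bullet> F v))" by (simp add: inner_sum_right)
  also have "\<dots> \<le> 0" using c(1) assms(2) by (intro sum_nonpos mult_nonneg_nonpos) auto
  finally show ?thesis .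
qed

text \<open>Linear dimension \<open>d\<close> is cell dimension \<open>d - 1\<close>. The hyperplane
  of the normal bounds it from above. From below, the PL type of the star of a vertex provides one
  cell of sufficient dimension, and purity transfers the bound to every facet there.\<close>

lemma facet_dim:
  assumes \<sigma>: "\<sigma> \<in> facets K"
  shows "dim (L ` f ` \<sigma>) = d"
proof (rule antisym)
  note \<sigma>c = facet_cell[OF \<sigma>]
  obtain v where v: "v \<in> verts \<sigma>" using ex_vertex \<sigma>c by blast
  obtain n where n: "n \<noteq> 0" "\<And>y. y \<in> verts \<sigma> \<Longrightarrow> n \<bullet> F y = 0" "\<And>y. adj v y \<Longrightarrow> y \<notin> \<sigma> \<Longrightarrow> n \<bullet> F y < 0"
    using facet_normal[OF \<sigma> v] by metis
  have "L ` f ` \<sigma> \<subseteq> {x. n \<bullet> x = 0}" using zero_on_cell[OF \<sigma>c n(2)] by (auto simp: F_def)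
  then have "dim (L ` f ` \<sigma>) \<le> dim {x. n \<bullet> x = 0}" by (rule dim_subset)
  then show "dim (L ` f ` \<sigma>) \<le> d" using dim_hyperplane[OF n(1)] dim_E by simp
  have vK: "v \<in> vertices K" using v by blast
  have "\<exists>\<Delta>::'a set. int (d - 1) simplex \<Delta> \<and>
      pl_homeomorphic G (star {v} K) (euclidean_geometry :: 'a geometry) (simplex_complex \<Delta>)"
    using manifold vK unfolding pl_manifold_def by simp
  then obtain \<Delta> :: "'a set" where \<Delta>: "int (d - 1) simplex \<Delta>"
    "pl_homeomorphic G (star {v} K) (euclidean_geometry :: 'a geometry) (simplex_complex \<Delta>)"
    by (elim exE conjE)
  obtain \<tau>0 where \<tau>0: "\<tau>0 \<in> cells (star {v} K)" "d - 1 + 1 \<le> dim (L ` f ` \<tau>0)"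
    using ex_full_dimensional_cell[OF \<Delta>(2,1)] by blast
  then obtain \<rho> where "\<rho> \<in> cells K" "v \<in> \<rho>" "\<tau>0 \<subseteq> \<rho>" by (auto simp: cells_star)
  then obtain \<tau> where \<tau>: "\<tau> \<in> facets K" "v \<in> \<tau>" "\<tau>0 \<subseteq> \<tau>" using ex_facet by (metis subset_iff)
  then have "dim (L ` f ` \<tau>0) \<le> dim (L ` f ` \<tau>)" by (intro dim_subset image_mono)
  then have d\<tau>: "d \<le> dim (L ` f ` \<tau>)" using \<tau>0(2) d3 by simp
  have "pure G (star {v} K)"
    using locally_convex vK unfolding locally_convex_position_def convex_position_def by blast
  then obtain k where k: "has_cell_dim G (star {v} K) \<sigma> k" "has_cell_dim G (star {v} K) \<tau> k"
    using facets_star[OF \<sigma>] facets_star[OF \<tau>(1,2)] v unfolding pure_def by blast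
  have "k = int (dim (L ` f ` \<rho>)) - 1" if "\<rho> \<in> cells K" "has_cell_dim G (star {v} K) \<rho> k" for \<rho>
    using that chart_gdim[OF that(1)] unfolding has_cell_dim_def by (auto simp: star_def)
  from this[OF \<sigma>c k(1)] this[OF facet_cell[OF \<tau>(1)] k(2)] show "d \<le> dim (L ` f ` \<sigma>)" using d\<tau> by simp
qed

text \<open>By dimension, a facet spans the hyperplane of its normal; so normals found at different
  vertices of a facet have the same kernel.\<close>

lemma facet_span:
  assumes \<sigma>: "\<sigma> \<in> facets K" and n: "n \<noteq> 0" "\<And>y. y \<in> verts \<sigma> \<Longrightarrow> n \<bullet> F y = 0"
  shows "span (L ` f ` \<sigma>) = {x. n \<bullet> x = 0}"
proof -
  have "span (L ` f ` \<sigma>) \<subseteq> {x. n \<bullet> x = 0}"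
    using zero_on_cell[OF facet_cell[OF \<sigma>] n(2)] by (intro span_minimal) (auto simp: F_def subspace_hyperplane)
  then show ?thesis
    by (intro subspace_dim_equal) (auto simp: subspace_hyperplane facet_dim[OF \<sigma>] dim_hyperplane[OF n(1)] dim_E)
qed

lemma adjacent_facet:
  assumes \<sigma>: "\<sigma> \<in> facets K" and \<rho>: "\<rho> \<in> cells K" "\<rho> \<subseteq> \<sigma>" "dim (L ` f ` \<rho>) + 1 = d"
  obtains \<tau> where "\<tau> \<in> facets K" "\<rho> \<subseteq> \<tau>" "\<tau> \<noteq> \<sigma>"
proof -
  \<comment> \<open>Linear dimension \<open>d - 1\<close> is cell dimension \<open>d - 2\<close>,
    one less than that of a facet.\<close>
  have "has_cell_dim G K \<rho> (int (d - 1) - 1)" using has_cell_dim_iff[OF \<rho>(1)] \<rho>(3) d3 by simp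
  moreover have "\<rho> \<notin> boundary_complex G (d - 1) K" using closed_K by (simp add: closed_complex_def)
  ultimately have "\<not> (\<exists>!\<tau>. \<tau> \<in> facets K \<and> \<rho> \<subseteq> \<tau>)" using \<rho> unfolding boundary_complex_def by blast
  then show thesis using that \<sigma> \<rho> by blast
qed

lemma ex_vertex_not_in_facet:
  assumes "\<sigma> \<in> facets K" "\<tau> \<in> facets K" "\<tau> \<noteq> \<sigma>"
  obtains y where "y \<in> verts \<tau>" "y \<notin> \<sigma>"
proof -
  have "\<not> \<tau> \<subseteq> \<sigma>" using assms by (auto simp: facets_def)
  then have "\<not> verts \<tau> \<subseteq> \<sigma>" using cell_subset_if_verts_subset facet_cell assms by blast
  then show thesis using that by blast
qed

lemma adj_iff_facet: "adj x y \<longleftrightarrow> (\<exists>\<tau>\<in>facets K. x \<in> verts \<tau> \<and> y \<in> verts \<tau>)"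
proof
  assume "adj x y"
  then obtain \<sigma> where \<sigma>: "\<sigma> \<in> cells K" "x \<in> verts \<sigma>" "y \<in> verts \<sigma>" unfolding adj_def by blast
  obtain \<tau> where "\<tau> \<in> facets K" "\<sigma> \<subseteq> \<tau>" using ex_facet[OF \<sigma>(1)] by blast
  then show "\<exists>\<tau>\<in>facets K. x \<in> verts \<tau> \<and> y \<in> verts \<tau>" using \<sigma> by blast
next
  assume "\<exists>\<tau>\<in>facets K. x \<in> verts \<tau> \<and> y \<in> verts \<tau>"
  then show "adj x y" unfolding adj_def using facet_cell by blast
qed

text \<open>As there is no boundary, a ridge through \<open>x\<close> lies in a second
  facet.\<close>

lemma opposite_vertex:
  assumes \<sigma>: "\<sigma> \<in> facets K" and x: "x \<in> verts \<sigma>"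
  obtains \<tau> y where "\<tau> \<in> facets K" "x \<in> \<tau>" "y \<in> verts \<tau>" "y \<notin> \<sigma>"
proof -
  note \<sigma>c = facet_cell[OF \<sigma>]
  have "gface G {f x} (f ` \<sigma>)" using gface_vertices[OF \<sigma>c] x by blast
  then obtain R where R: "gface G R (f ` \<sigma>)" "f x \<in> R" "dim (L ` R) + 1 = dim (L ` f ` \<sigma>)"
    using ex_ridge_at_vertex[OF gpolytope_cell[OF \<sigma>c]] facet_dim[OF \<sigma>] d3 by auto
  obtain \<rho> where \<rho>: "\<rho> \<in> cells K" "\<rho> \<subseteq> \<sigma>" "R = f ` \<rho>" using gface_cellE[OF \<sigma>c R(1)] by blast
  have "x \<in> \<rho>" using R(2) \<rho> f_inj_on_cell[OF \<sigma>c] x by (auto simp: inj_on_def)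
  obtain \<tau> where \<tau>: "\<tau> \<in> facets K" "\<rho> \<subseteq> \<tau>" "\<tau> \<noteq> \<sigma>"
    using adjacent_facet[OF \<sigma> \<rho>(1,2)] R(3) \<rho>(3) facet_dim[OF \<sigma>] by auto
  obtain y where "y \<in> verts \<tau>" "y \<notin> \<sigma>" using ex_vertex_not_in_facet[OF \<sigma> \<tau>(1,3)] by blast
  then show thesis using that \<tau> \<open>x \<in> \<rho>\<close> by blast
qed

text \<open>At each ridge through \<open>x\<close>, the functional that
  \<open>tangent_cone_cover\<close> asks for is the normal of the facet on the other side, which
  exists by closedness.\<close>

lemma facet_tangent_cone_cover:
  assumes \<tau>: "\<tau> \<in> facets K" and x: "x \<in> verts \<tau>" and q: "q \<in> span (L ` f ` \<tau>)"
    and n: "\<And>\<sigma>. \<sigma> \<in> facets K \<Longrightarrow> x \<in> \<sigma> \<Longrightarrow> (\<forall>y\<in>verts \<sigma>. n \<sigma> \<bullet> F y = 0) \<and>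
      (\<forall>y. adj x y \<longrightarrow> y \<notin> \<sigma> \<longrightarrow> n \<sigma> \<bullet> F y < 0) \<and> n \<sigma> \<bullet> q \<le> 0"
  shows "\<exists>l\<ge>0. q + l *\<^sub>R F x \<in> conic_span F (verts \<tau>)"
proof -
  note \<tau>c = facet_cell[OF \<tau>]
  have "\<exists>l\<ge>0. \<exists>t\<ge>0. \<exists>y\<in>f ` \<tau>. q + l *\<^sub>R L (f x) = t *\<^sub>R L y"
  proof (rule tangent_cone_cover[OF gpolytope_cell[OF \<tau>c] _ q])
    show "f x \<in> f ` \<tau>" using x by blast
    fix R assume R: "gface G R (f ` \<tau>)" "f x \<in> R" "dim (L ` R) + 1 = dim (L ` f ` \<tau>)"
    obtain \<rho> where \<rho>: "\<rho> \<in> cells K" "\<rho> \<subseteq> \<tau>" "R = f ` \<rho>" using gface_cellE[OF \<tau>c R(1)] by blast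
    have x\<rho>: "x \<in> \<rho>" using R(2) \<rho> f_inj_on_cell[OF \<tau>c] x by (auto simp: inj_on_def)
    obtain \<sigma> where \<sigma>: "\<sigma> \<in> facets K" "\<rho> \<subseteq> \<sigma>" "\<sigma> \<noteq> \<tau>"
      using adjacent_facet[OF \<tau> \<rho>(1,2)] R(3) \<rho>(3) facet_dim[OF \<tau>] by auto
    have n\<sigma>: "\<And>y. y \<in> verts \<sigma> \<Longrightarrow> n \<sigma> \<bullet> F y = 0" "\<And>y. adj x y \<Longrightarrow> y \<notin> \<sigma> \<Longrightarrow> n \<sigma> \<bullet> F y < 0" "n \<sigma> \<bullet> q \<le> 0"
      using n[OF \<sigma>(1)] x\<rho> \<sigma>(2) by auto
    have adj: "adj x y" if "y \<in> verts \<tau>" for y unfolding adj_def using \<tau>c x that by blast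
    have "n \<sigma> \<bullet> F y = 0" if "y \<in> \<rho>" for y
      using zero_on_cell[OF facet_cell[OF \<sigma>(1)] n\<sigma>(1)] that \<sigma>(2) by blast
    moreover have "n \<sigma> \<bullet> F y \<le> 0" if "y \<in> \<tau>" for y
    proof (rule nonpos_on_cell[OF \<tau>c _ that])
      fix w assume "w \<in> verts \<tau>"
      then show "n \<sigma> \<bullet> F w \<le> 0" using n\<sigma>(1)[of w] n\<sigma>(2)[of w] adj[of w] by (cases "w \<in> \<sigma>") auto
    qed
    moreover obtain y where y: "y \<in> verts \<tau>" "y \<notin> \<sigma>" using ex_vertex_not_in_facet[OF \<sigma>(1) \<tau>] \<sigma>(3) by metis
    moreover have "\<exists>y\<in>\<tau>. n \<sigma> \<bullet> F y < 0" using n\<sigma>(2)[OF adj[OF y(1)] y(2)] y(1) by blast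
    ultimately show "\<exists>n. (\<forall>y\<in>R. n \<bullet> L y = 0) \<and> (\<forall>y\<in>f ` \<tau>. n \<bullet> L y \<le> 0) \<and> (\<exists>y\<in>f ` \<tau>. n \<bullet> L y < 0) \<and> n \<bullet> q \<le> 0"
      using n\<sigma>(3) \<rho>(3) by (intro exI[of _ "n \<sigma>"]) (simp add: F_def)
  qed
  then obtain l t y where l: "l \<ge> 0" "t \<ge> 0" "y \<in> \<tau>" "q + l *\<^sub>R F x = t *\<^sub>R F y" by (auto simp: F_def)
  then have "q + l *\<^sub>R F x \<in> conic_span F (verts \<tau>)" using cell_conic_span[OF \<tau>c l(3)] conic_span_scaleR by metis
  then show ?thesis using l(1) by blast
qed

text \<open>A nonzero common point lies on a ray over both images; the ray determines its point, so
  the claim reduces to intersecting two cells of one star.\<close>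

lemma facet_cones_Int:
  assumes "\<sigma> \<in> facets K" "\<tau> \<in> facets K" "x \<in> verts \<sigma>" "x \<in> verts \<tau>"
    and p: "p \<in> conic_span F (verts \<sigma>)" "p \<in> conic_span F (verts \<tau>)"
  shows "p \<in> conic_span F (verts \<sigma> \<inter> verts \<tau>)"
proof (cases "p = 0")
  case True
  then show ?thesis unfolding conic_span_def by (intro CollectI exI[of _ "\<lambda>_. 0"]) simp
next
  case False
  have c: "\<sigma> \<in> cells K" "\<tau> \<in> cells K" using assms facet_cell by auto
  have xc: "{x} \<in> cells K" using assms by (simp add: vertices_def)
  have st: "\<sigma> \<in> cells (star {x} K)" "\<tau> \<in> cells (star {x} K)" using c assms by (auto simp: cells_star)
  have p': "p \<in> conic_span (\<lambda>v. L (f v)) (verts \<sigma>)" "p \<in> conic_span (\<lambda>v. L (f v)) (verts \<tau>)"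
    using p unfolding F_def[abs_def] by auto
  obtain s y where y: "s > 0" "y \<in> f ` \<sigma>" "p = s *\<^sub>R L y"
    using conic_span_in_gpolytope[OF gpolytope_cell[OF c(1)] finite_verts[OF c(1)] _ p'(1) False] by blast
  obtain t z where z: "t > 0" "z \<in> f ` \<tau>" "p = t *\<^sub>R L z"
    using conic_span_in_gpolytope[OF gpolytope_cell[OF c(2)] finite_verts[OF c(2)] _ p'(2) False] by blast
  have "(1 / s) *\<^sub>R s *\<^sub>R L y = (1 / s) *\<^sub>R t *\<^sub>R L z" using y z by simp
  then have "L y = (t / s) *\<^sub>R L z" using y by simp
  then have "y = z" using ray_inj[of y z "t / s"] y z f_gspace c by auto
  then have "y \<in> f ` (\<sigma> \<inter> \<tau>)" using star_image_Int[OF xc st] y z by blast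
  then obtain w where w: "w \<in> \<sigma> \<inter> \<tau>" "y = f w" by blast
  have "\<sigma> \<inter> \<tau> \<in> cells K" using cells_Int c assms by blast
  then have "F w \<in> conic_span F (verts (\<sigma> \<inter> \<tau>))" using cell_conic_span w by blast
  then have "p \<in> conic_span F (verts (\<sigma> \<inter> \<tau>))" using conic_span_scaleR[of "F w" F _ s] y w by (simp add: F_def)
  moreover have "verts (\<sigma> \<inter> \<tau>) = verts \<sigma> \<inter> verts \<tau>" by blast
  ultimately show ?thesis by simp
qed

lemma upper_link_joined:
  assumes x: "x \<in> vertices K" "g \<bullet> F x = 0" and g: "\<And>y. adj x y \<Longrightarrow> y \<noteq> x \<Longrightarrow> g \<bullet> F y \<noteq> 0"
    and ab: "adj x a" "adj x b" "0 < g \<bullet> F a" "0 < g \<bullet> F b"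
  shows "(\<lambda>u w. adj u w \<and> 0 < g \<bullet> F u \<and> 0 < g \<bullet> F w)\<^sup>*\<^sup>* a b"
proof -
  let ?fac = "{\<tau> \<in> facets K. x \<in> \<tau>}"
  let ?T = "(\<lambda>\<tau>. verts \<tau>) ` ?fac"
  have "\<forall>\<tau>\<in>?fac. \<exists>n. n \<noteq> 0 \<and> (\<forall>y\<in>verts \<tau>. n \<bullet> F y = 0) \<and> (\<forall>y. adj x y \<longrightarrow> y \<notin> \<tau> \<longrightarrow> n \<bullet> F y < 0)"
  proof
    fix \<tau> assume "\<tau> \<in> ?fac"
    then have "\<tau> \<in> facets K" "x \<in> verts \<tau>" using x by auto
    from facet_normal[OF this]
    show "\<exists>n. n \<noteq> 0 \<and> (\<forall>y\<in>verts \<tau>. n \<bullet> F y = 0) \<and> (\<forall>y. adj x y \<longrightarrow> y \<notin> \<tau> \<longrightarrow> n \<bullet> F y < 0)" by metis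
  qed
  then obtain n where n: "\<forall>\<tau>\<in>?fac. n \<tau> \<noteq> 0 \<and> (\<forall>y\<in>verts \<tau>. n \<tau> \<bullet> F y = 0) \<and>
    (\<forall>y. adj x y \<longrightarrow> y \<notin> \<tau> \<longrightarrow> n \<tau> \<bullet> F y < 0)" using bchoice by metis
  \<comment> \<open>\<open>upper_link_connected\<close> knows facets only as vertex sets, so the
    normals are indexed by these; \<open>verts_inj\<close> makes this well defined.\<close>
  define m where "m t = n (inv_into ?fac (\<lambda>\<tau>. verts \<tau>) t)" for t
  have verts_inj: "\<sigma> = \<tau>" if "\<sigma> \<in> facets K" "\<tau> \<in> facets K" "verts \<sigma> = verts \<tau>" for \<sigma> \<tau>
  proof -
    have "\<sigma> \<subseteq> \<tau>" by (rule cell_subset_if_verts_subset) (use that facet_cell in auto)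
    then show ?thesis using that by (simp add: facets_def)
  qed
  have m: "m (verts \<tau>) = n \<tau>" if "\<tau> \<in> ?fac" for \<tau>
  proof -
    have "inj_on (\<lambda>\<tau>. verts \<tau>) ?fac" using verts_inj by (auto simp: inj_on_def)
    from inv_into_f_f[OF this that] show ?thesis by (simp add: m_def)
  qed
  have UT: "y \<in> \<Union>?T \<longleftrightarrow> adj x y" for y using x(1) unfolding adj_iff_facet by auto
  have "(\<lambda>u w. (\<exists>t\<in>?T. u \<in> t \<and> w \<in> t) \<and> 0 < g \<bullet> F u \<and> 0 < g \<bullet> F w)\<^sup>*\<^sup>* a b"
  proof (rule upper_link_connected[where x = x and n = m])
    show "4 \<le> DIM('e)" using dim_E d3 by simp
    have "?fac \<subseteq> cells K" using facet_cell by blast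
    then show "finite ?T" using finite_cells[OF compact_K] finite_subset by blast
    show "finite t" if "t \<in> ?T" for t using that finite_verts facet_cell by blast
    show "x \<in> t" if "t \<in> ?T" for t using that x by blast
    show "m t \<bullet> F y = 0" if "t \<in> ?T" "y \<in> t" for t y using that m n by auto
    show "m t \<bullet> F y < 0" if t: "t \<in> ?T" "y \<in> \<Union>?T" "y \<notin> t" for t y
    proof -
      obtain \<tau> where \<tau>: "\<tau> \<in> ?fac" "t = verts \<tau>" using t(1) by blast
      have "adj x y" using UT t(2) by blast
      moreover have "y \<notin> \<tau>" using t(3) \<tau>(2) \<open>adj x y\<close> unfolding adj_def by blast
      ultimately show ?thesis using n m \<tau> by auto
    qed
    show "\<exists>y\<in>\<Union>?T. y \<notin> t" if t: "t \<in> ?T" for t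
    proof -
      obtain \<tau> where \<tau>: "\<tau> \<in> facets K" "x \<in> verts \<tau>" "t = verts \<tau>" using t x by blast
      obtain \<sigma> y where "\<sigma> \<in> facets K" "x \<in> \<sigma>" "y \<in> verts \<sigma>" "y \<notin> \<tau>" using opposite_vertex[OF \<tau>(1,2)] by blast
      then show ?thesis using \<tau>(3) by blast
    qed
    show "\<exists>l\<ge>0. q + l *\<^sub>R F x \<in> conic_span F t"
      if t: "t \<in> ?T" "m t \<bullet> q = 0" "\<And>t'. t' \<in> ?T \<Longrightarrow> m t' \<bullet> q \<le> 0" for t q
    proof -
      obtain \<tau> where \<tau>: "\<tau> \<in> ?fac" "t = verts \<tau>" using t(1) by blast
      have \<tau>': "\<tau> \<in> facets K" "x \<in> verts \<tau>" using \<tau>(1) x by auto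
      have n\<tau>: "n \<tau> \<noteq> 0" "\<And>y. y \<in> verts \<tau> \<Longrightarrow> n \<tau> \<bullet> F y = 0" using n \<tau>(1) by auto
      have "n \<tau> \<bullet> q = 0" using t(2) m[OF \<tau>(1)] \<tau>(2) by simp
      then have "q \<in> span (L ` f ` \<tau>)" using facet_span[OF \<tau>'(1) n\<tau>] by blast
      moreover have "n \<sigma> \<bullet> q \<le> 0" if "\<sigma> \<in> ?fac" for \<sigma> using t(3)[of "verts \<sigma>"] m[OF that] that by simp
      ultimately show ?thesis unfolding \<tau>(2)
        by (intro facet_tangent_cone_cover[OF \<tau>', where n = n]) (use n in auto)
    qed
    show "p \<in> conic_span F (t \<inter> t')"
      if "t \<in> ?T" "t' \<in> ?T" "p \<in> conic_span F t" "p \<in> conic_span F t'" for t t' p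
      using that facet_cones_Int[of _ _ x p] x(1) by auto
    show "g \<bullet> F x = 0" by (rule x(2))
    show "g \<bullet> F y \<noteq> 0" if "y \<in> \<Union>?T" "y \<noteq> x" for y using g UT that by blast
    show "a \<in> \<Union>?T" "b \<in> \<Union>?T" using UT ab by blast+
    show "0 < g \<bullet> F a" "0 < g \<bullet> F b" by (fact ab)+
  qed
  then show ?thesis
  proof (rule rtranclp_mono[THEN predicate2D, rotated], intro predicate2I)
    fix u w assume *: "(\<exists>t\<in>?T. u \<in> t \<and> w \<in> t) \<and> 0 < g \<bullet> F u \<and> 0 < g \<bullet> F w"
    then have "adj u w" unfolding adj_iff_facet by blast
    then show "adj u w \<and> 0 < g \<bullet> F u \<and> 0 < g \<bullet> F w" using * by blast
  qed
qed

text \<open>\<open>n\<close> is negative on the star outside \<sigma>, and \<open>a\<close> exposes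
  \<open>v\<close> within \<sigma>; adding a small multiple of \<open>a\<close> combines the two.
  The last conclusion stands in for a limit: a vertex with \<open>n > 0\<close> would contradict
  \<open>exposed_neg\<close> for \<open>h\<close>.\<close>

lemma tilted_normal_exposes:
  assumes \<sigma>: "\<sigma> \<in> facets K" and v: "v \<in> verts \<sigma>"
    and n: "\<And>y. y \<in> verts \<sigma> \<Longrightarrow> n \<bullet> F y = 0" "\<And>y. adj v y \<Longrightarrow> y \<notin> \<sigma> \<Longrightarrow> n \<bullet> F y < 0"
  obtains h where "h \<bullet> F v = 0" "\<And>y. adj v y \<Longrightarrow> y \<noteq> v \<Longrightarrow> h \<bullet> F y < 0"
    "\<And>y. y \<in> vertices K \<Longrightarrow> 0 < n \<bullet> F y \<Longrightarrow> 0 < h \<bullet> F y"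
proof -
  note \<sigma>c = facet_cell[OF \<sigma>]
  have "gface G {f v} (f ` \<sigma>)" using gface_vertices[OF \<sigma>c] v by blast
  then obtain a where a: "\<And>y. y \<in> f ` \<sigma> \<Longrightarrow> a \<bullet> L y \<le> 0" "{f v} = {y \<in> f ` \<sigma>. a \<bullet> L y = 0}"
    using gfaceE[OF gpolytope_cell[OF \<sigma>c]] by metis
  have av: "a \<bullet> F v = 0" using a(2) unfolding F_def by blast
  have a_neg: "a \<bullet> F y < 0" if "y \<in> \<sigma>" "y \<noteq> v" for y
  proof -
    have "f y \<noteq> f v" using f_inj_on_cell[OF \<sigma>c] that v by (auto simp: inj_on_def)
    then have "a \<bullet> F y \<noteq> 0" using a(2) that unfolding F_def by blast
    moreover have "a \<bullet> F y \<le> 0" using a(1) that unfolding F_def by blast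
    ultimately show ?thesis by simp
  qed
  obtain e where e: "e > 0" "\<And>x. x \<in> vertices K \<Longrightarrow> 0 < n \<bullet> F x \<Longrightarrow> 0 < (n + e *\<^sub>R a) \<bullet> F x"
    "\<And>x. x \<in> vertices K \<Longrightarrow> n \<bullet> F x < 0 \<Longrightarrow> (n + e *\<^sub>R a) \<bullet> F x < 0"
    using ex_small_perturbation_same_signs[OF finite_vertices[OF compact_K]] by metis
  show thesis
  proof (rule that[of "n + e *\<^sub>R a"])
    show "(n + e *\<^sub>R a) \<bullet> F v = 0" using n(1)[OF v] av by (simp add: inner_add_left)
    fix y assume y: "adj v y" "y \<noteq> v"
    then have yK: "y \<in> vertices K" unfolding adj_def by blast
    show "(n + e *\<^sub>R a) \<bullet> F y < 0"
    proof (cases "y \<in> \<sigma>")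
      case True
      then show ?thesis using n(1)[of y] yK a_neg[OF True y(2)] e(1)
        by (simp add: inner_add_left mult_pos_neg)
    next
      case False
      then show ?thesis using e(3)[OF yK] n(2)[OF y(1)] by blast
    qed
  qed (use e(2) in blast)
qed

sublocale locally_convex_graph "vertices K" F adj
proof
  show "finite (vertices K)" by (rule finite_vertices[OF compact_K])
  show "adj x y \<Longrightarrow> x \<in> vertices K \<and> y \<in> vertices K" for x y unfolding adj_def by blast
  show "adj x y \<Longrightarrow> adj y x" for x y unfolding adj_def by blast
  show "F x \<noteq> 0" if "x \<in> vertices K" for x
  proof -
    have "gpolytope G (f ` {x})" by (rule gpolytope_cell[OF vertex_cell[OF that]])
    from polytope_section[OF this] show ?thesis unfolding F_def
      by (metis image_insert inner_zero_right insertI1 less_irrefl)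
  qed
  show "\<exists>h. h \<bullet> F x = 0 \<and> (\<forall>y. adj x y \<longrightarrow> y \<noteq> x \<longrightarrow> h \<bullet> F y < 0)" if x: "x \<in> vertices K" for x
  proof -
    obtain \<sigma> where \<sigma>: "\<sigma> \<in> facets K" "{x} \<subseteq> \<sigma>" using ex_facet[OF vertex_cell[OF x]] by blast
    then have v: "x \<in> verts \<sigma>" using x by blast
    obtain n where n: "n \<noteq> 0" "\<And>y. y \<in> verts \<sigma> \<Longrightarrow> n \<bullet> F y = 0" "\<And>y. adj x y \<Longrightarrow> y \<notin> \<sigma> \<Longrightarrow> n \<bullet> F y < 0"
      using facet_normal[OF \<sigma>(1) v] by metis
    from tilted_normal_exposes[OF \<sigma>(1) v n(2,3)] show ?thesis by metis
  qed
  show "adj\<^sup>*\<^sup>* x y" if "x \<in> vertices K" "y \<in> vertices K" for x y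
    by (rule vertex_graph_connected[OF connected_K that])
qed (rule upper_link_joined)

text \<open>The tilted normals give only \<open>n \<le> 0\<close>. Strictness comes from
  \<open>exposed_set_neg\<close> for the vertex set of \<sigma>, once the neighbours of that set are
  known to be off the hyperplane.\<close>

lemma facet_normal_neg:
  assumes \<sigma>: "\<sigma> \<in> facets K" and v: "v \<in> verts \<sigma>" and "n \<noteq> 0"
    and n: "\<And>y. y \<in> verts \<sigma> \<Longrightarrow> n \<bullet> F y = 0" "\<And>y. adj v y \<Longrightarrow> y \<notin> \<sigma> \<Longrightarrow> n \<bullet> F y < 0"
    and w: "w \<in> vertices K" "w \<notin> \<sigma>"
  shows "n \<bullet> F w < 0"
proof (rule exposed_set_neg[of "verts \<sigma>" v])
  have le: "n \<bullet> F y \<le> 0" if y: "y \<in> vertices K" for y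
  proof (cases "y = v")
    case True
    then show ?thesis using n(1) v by simp
  next
    case False
    obtain h where h: "h \<bullet> F v = 0" "\<And>y. adj v y \<Longrightarrow> y \<noteq> v \<Longrightarrow> h \<bullet> F y < 0"
      "\<And>y. y \<in> vertices K \<Longrightarrow> 0 < n \<bullet> F y \<Longrightarrow> 0 < h \<bullet> F y"
      using tilted_normal_exposes[OF \<sigma> v n] by blast
    have "h \<bullet> F y < 0" using exposed_neg[of v y h] v y False h(1,2) by blast
    then show ?thesis using h(3)[OF y] by linarith
  qed
  show "n \<bullet> F y < 0" if xy: "x \<in> verts \<sigma>" "adj x y" "y \<notin> verts \<sigma>" for x y
  proof -
    have yK: "y \<in> vertices K" "y \<notin> \<sigma>" using xy unfolding adj_def by auto
    obtain n' where n': "n' \<noteq> 0" "\<And>y. y \<in> verts \<sigma> \<Longrightarrow> n' \<bullet> F y = 0" "\<And>y. adj x y \<Longrightarrow> y \<notin> \<sigma> \<Longrightarrow> n' \<bullet> F y < 0"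
      using facet_normal[OF \<sigma> xy(1)] by metis
    \<comment> \<open>\<open>n\<close> was chosen at \<open>v\<close>; at another vertex
      \<open>x\<close> of \<sigma> the local normal \<open>n'\<close> has the same kernel and is
      nonzero at \<open>y\<close>.\<close>
    have eq: "{z. n \<bullet> z = 0} = {z. n' \<bullet> z = 0}"
      using facet_span[OF \<sigma> \<open>n \<noteq> 0\<close> n(1)] facet_span[OF \<sigma> n'(1,2)] by simp
    have "F y \<notin> {z. n \<bullet> z = 0}" unfolding eq using n'(3)[OF xy(2) yK(2)] by simp
    then have "n \<bullet> F y \<noteq> 0" by simp
    then show ?thesis using le[OF yK(1)] by simp
  qed
qed (use assms in auto)

theorem in_convex_position: "convex_position G K f"
  unfolding convex_position_def
proof (intro conjI ballI)
  have "has_cell_dim G K \<sigma> (int d - 1)" if "\<sigma> \<in> facets K" for \<sigma>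
    using has_cell_dim_iff[OF facet_cell[OF that]] facet_dim[OF that] by simp
  then show "pure G K" unfolding pure_def by blast
  fix \<sigma> assume \<sigma>: "\<sigma> \<in> facets K"
  obtain v where v: "v \<in> verts \<sigma>" using ex_vertex[OF facet_cell[OF \<sigma>]] by blast
  obtain n where n: "n \<noteq> 0" "\<And>y. y \<in> verts \<sigma> \<Longrightarrow> n \<bullet> F y = 0" "\<And>y. adj v y \<Longrightarrow> y \<notin> \<sigma> \<Longrightarrow> n \<bullet> F y < 0"
    using facet_normal[OF \<sigma> v] by metis
  have neg: "n \<bullet> F w < 0" if "w \<in> vertices K" "w \<notin> \<sigma>" for w
    by (rule facet_normal_neg[OF \<sigma> v n that])
  have le: "n \<bullet> F y \<le> 0" if "y \<in> vertices K" for y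
    using neg[OF that] n(2)[of y] that by (cases "y \<in> \<sigma>") auto
  let ?H = "{x \<in> gspace G. n \<bullet> L x \<le> 0}" and ?B = "{x \<in> gspace G. n \<bullet> L x = 0}"
  have "f v \<in> gspace G" using f_gspace facet_cell[OF \<sigma>] v by blast
  then have "ghalfspace G ?H ?B" using ghalfspaceI[OF n(1)] n(2)[OF v] unfolding F_def by blast
  moreover have "f ` \<Union>(cells K) \<subseteq> ?H"
  proof clarify
    fix x \<tau> assume "\<tau> \<in> cells K" "x \<in> \<tau>"
    then show "f x \<in> gspace G \<and> n \<bullet> L (f x) \<le> 0"
      using nonpos_on_cell[of \<tau> n x] le f_gspace unfolding F_def by blast
  qed
  moreover have "f ` vertices K \<inter> ?B = f ` verts \<sigma>"
  proof (intro equalityI subsetI)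
    fix p assume "p \<in> f ` vertices K \<inter> ?B"
    then obtain w where "w \<in> vertices K" "p = f w" "n \<bullet> F w = 0" unfolding F_def by blast
    moreover then have "w \<in> \<sigma>" using neg[of w] by fastforce
    ultimately show "p \<in> f ` verts \<sigma>" by blast
  next
    fix p assume "p \<in> f ` verts \<sigma>"
    then obtain w where "w \<in> verts \<sigma>" "p = f w" by blast
    then show "p \<in> f ` vertices K \<inter> ?B"
      using n(2)[of w] f_gspace[OF facet_cell[OF \<sigma>], of w] unfolding F_def by blast
  qed
  ultimately show "\<exists>H B. ghalfspace G H B \<and> f ` \<Union>(cells K) \<subseteq> H \<and> f ` vertices K \<inter> B = f ` (vertices K \<inter> \<sigma>)"
    by blast
qed

end

subsection \<open>The two geometries\<close>

lemma dim_lift: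
  fixes P :: "'a::euclidean_space set"
  shows "int (dim ((\<lambda>x. (x, 1::real)) ` P)) = aff_dim P + 1"
proof -
  let ?i = "\<lambda>x::'a. (x, 0::real)"
  have "linear ?i" by (auto intro!: linearI)
  moreover have "inj ?i" by (auto simp: inj_on_def)
  ultimately have "aff_dim (?i ` P) = aff_dim P" by (rule aff_dim_injective_linear_image)
  moreover have "(\<lambda>x. (x, 1::real)) ` P = (+) (0, 1) ` ?i ` P" by (auto simp: image_image)
  then have "aff_dim ((\<lambda>x. (x, 1::real)) ` P) = aff_dim (?i ` P)" by (simp only: aff_dim_translation_eq)
  moreover have "aff_dim ((\<lambda>x. (x, 1::real)) ` P) = int (dim ((\<lambda>x. (x, 1::real)) ` P)) - 1"
    by (rule aff_dim_eq_dim_minus_1[of _ "(0, 1)"]) auto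
  ultimately show ?thesis by simp
qed

lemma lifted_euclidean_geometry:
  "lifted_geometry (euclidean_geometry :: 'a::euclidean_space geometry) (\<lambda>x. (x, 1::real))"
proof
  fix P :: "'a set"
  assume "gpolytope euclidean_geometry P"
  then have P: "polytope P" "P \<noteq> {}" by (auto simp: euclidean_geometry_def)
  show "\<exists>u Q. polytope Q \<and> Q \<noteq> {} \<and> (\<forall>q\<in>Q. u \<bullet> q = 1) \<and>
      (\<forall>x\<in>P. 0 < u \<bullet> (x, 1) \<and> (x, 1) /\<^sub>R (u \<bullet> (x, 1)) \<in> Q) \<and> (\<forall>q\<in>Q. \<exists>x\<in>P. \<exists>t>0. (x, 1::real) = t *\<^sub>R q)"
  proof (intro exI[of _ "(0, 1)"] exI[of _ "P \<times> {1}"] conjI)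
    show "polytope (P \<times> {1::real})" using P by (intro polytope_Times polytope_sing)
    show "\<forall>q\<in>P \<times> {1}. \<exists>x\<in>P. \<exists>t>0. (x, 1::real) = t *\<^sub>R q" by (auto intro!: exI[of _ 1])
  qed (use P in auto)
  fix R
  show "gface euclidean_geometry R P \<longleftrightarrow>
      R \<noteq> {} \<and> (\<exists>a. (\<forall>x\<in>P. a \<bullet> (x, 1::real) \<le> 0) \<and> R = {x \<in> P. a \<bullet> (x, 1) = 0})" (is "?L \<longleftrightarrow> ?R")
  proof
    assume ?L
    then have R: "R face_of P" "R \<noteq> {}" by (auto simp: euclidean_geometry_def)
    then have "R exposed_face_of P" using P exposed_face_of_polyhedron polytope_imp_polyhedron by blast
    then obtain a b where ab: "P \<subseteq> {x. a \<bullet> x \<le> b}" "R = P \<inter> {x. a \<bullet> x = b}" unfolding exposed_face_of_def by blast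
    then show ?R using R(2) by (intro conjI exI[of _ "(a, - b)"]) auto
  next
    assume ?R
    then obtain a b where ab: "R \<noteq> {}" "\<And>x. x \<in> P \<Longrightarrow> a \<bullet> x \<le> - b" "R = {x \<in> P. a \<bullet> x + b = 0}" by (force simp: inner_prod_def)
    have "P \<inter> {x. a \<bullet> x = - b} face_of P"
      using ab(2) P polytope_imp_convex by (intro face_of_Int_supporting_hyperplane_le) auto
    moreover have "P \<inter> {x. a \<bullet> x = - b} = R" unfolding ab(3) by auto
    ultimately show ?L using ab(1) by (simp add: euclidean_geometry_def)
  qed
next
  fix P :: "'a set"
  show "gdim euclidean_geometry P = int (dim ((\<lambda>x. (x, 1::real)) ` P)) - 1"
    by (simp add: euclidean_geometry_def dim_lift)
next
  fix A :: "'a set" and g :: "'a \<Rightarrow> 'a"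
  assume "\<And>x y. x \<in> A \<Longrightarrow> y \<in> A \<Longrightarrow> gdist euclidean_geometry (g x) (g y) = gdist euclidean_geometry x y"
  then have "aff_dim (g ` A) = aff_dim A" by (intro aff_dim_image_isometry) (auto simp: euclidean_geometry_def)
  then show "dim ((\<lambda>x. (x, 1::real)) ` g ` A) = dim ((\<lambda>x. (x, 1::real)) ` A)"
    using dim_lift[of "g ` A"] dim_lift[of A] by linarith
next
  fix H B :: "'a set" assume "ghalfspace euclidean_geometry H B"
  then obtain u c where "u \<noteq> 0" "H = {x. u \<bullet> x \<le> c}" "B = {x. u \<bullet> x = c}" by (auto simp: euclidean_geometry_def)
  then show "\<exists>n. n \<noteq> 0 \<and> H = {x \<in> gspace euclidean_geometry. n \<bullet> (x, 1::real) \<le> 0} \<and>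
      B = {x \<in> gspace euclidean_geometry. n \<bullet> (x, 1) = 0}"
    by (intro exI[of _ "(u, - c)"]) (auto simp: euclidean_geometry_def zero_prod_def)
next
  fix n :: "'a \<times> real" and x :: 'a
  assume n: "n \<noteq> 0" "n \<bullet> (x, 1) = 0"
  obtain u c where uc: "n = (u, c)" by fastforce
  \<comment> \<open>The boundary point excludes \<open>u = 0\<close>, since
    \<open>n \<bullet> (x, 1) = 0\<close> would then force \<open>c = 0\<close>.\<close>
  then have "u \<noteq> 0" using n by (auto simp: zero_prod_def)
  moreover have "{x \<in> gspace euclidean_geometry. n \<bullet> (x, 1) \<le> 0} = {x. u \<bullet> x \<le> - c}"
    "{x \<in> gspace euclidean_geometry. n \<bullet> (x, 1) = 0} = {x. u \<bullet> x = - c}"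
    by (auto simp: euclidean_geometry_def uc)
  ultimately show "ghalfspace euclidean_geometry {x \<in> gspace euclidean_geometry. n \<bullet> (x, 1) \<le> 0}
      {x \<in> gspace euclidean_geometry. n \<bullet> (x, 1) = 0}"
    by (auto simp: euclidean_geometry_def)
qed (auto simp: euclidean_geometry_def)

text \<open>\<open>Q\<close> is the section at \<open>u = 1\<close> of the cone over
  \<open>V\<close>. To compare it with the hull of \<open>V\<close> in either direction, the vectors
  with a suitable rescaling in the other set are shown to form a convex set containing the
  generators.\<close>

lemma spherical_hull_section:
  fixes V :: "'a::euclidean_space set"
  assumes V: "finite V" "V \<noteq> {}" and u: "\<And>v. v \<in> V \<Longrightarrow> 0 < u \<bullet> v"
  defines "Q \<equiv> convex hull ((\<lambda>v. v /\<^sub>R (u \<bullet> v)) ` V)"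
  shows "polytope Q" "Q \<noteq> {}" "\<And>q. q \<in> Q \<Longrightarrow> u \<bullet> q = 1"
    "\<And>x. x \<in> spherical_hull V \<Longrightarrow> 0 < u \<bullet> x \<and> x /\<^sub>R (u \<bullet> x) \<in> Q"
    "\<And>q. q \<in> Q \<Longrightarrow> \<exists>x\<in>spherical_hull V. \<exists>t>0. x = t *\<^sub>R q"
proof -
  show "polytope Q" unfolding Q_def polytope_def using V by blast
  show "Q \<noteq> {}" unfolding Q_def using V by simp
  have "Q \<subseteq> {q. u \<bullet> q = 1}" unfolding Q_def
  proof (rule hull_minimal)
    show "(\<lambda>v. v /\<^sub>R (u \<bullet> v)) ` V \<subseteq> {q. u \<bullet> q = 1}" using u by force
  qed (rule convex_hyperplane)
  then show uQ: "u \<bullet> q = 1" if "q \<in> Q" for q using that by blast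
  have convQ: "convex Q" unfolding Q_def by simp
  have pos: "0 < u \<bullet> y" if "y \<in> convex hull V" for y
  proof -
    have "convex hull V \<subseteq> {y. u \<bullet> y > 0}" using u by (intro hull_minimal) (auto simp: convex_halfspace_gt)
    then show ?thesis using that by blast
  qed
  have "convex hull V \<subseteq> {y. 0 < u \<bullet> y \<and> y /\<^sub>R (u \<bullet> y) \<in> Q}" (is "_ \<subseteq> ?A")
  proof (rule hull_minimal)
    show "V \<subseteq> ?A" using u unfolding Q_def by (auto intro!: hull_inc)
    show "convex ?A"
    proof (rule convexI)
      fix y z and a b :: real assume yz: "y \<in> ?A" "z \<in> ?A" and ab: "0 \<le> a" "0 \<le> b" "a + b = 1"
      define w where "w = a *\<^sub>R y + b *\<^sub>R z"
      have uw: "u \<bullet> w = a * (u \<bullet> y) + b * (u \<bullet> z)" by (simp add: w_def inner_add_right)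
      have w: "0 < u \<bullet> w"
      proof (cases "a = 0")
        case True
        then show ?thesis using yz ab by (simp add: uw)
      next
        case False
        then have "0 < a * (u \<bullet> y)" "0 \<le> b * (u \<bullet> z)" using yz ab by auto
        then show ?thesis unfolding uw by linarith
      qed
      have "(a * (u \<bullet> y) / (u \<bullet> w)) *\<^sub>R (y /\<^sub>R (u \<bullet> y)) + (b * (u \<bullet> z) / (u \<bullet> w)) *\<^sub>R (z /\<^sub>R (u \<bullet> z)) \<in> Q"
      proof (rule convexD[OF convQ])
        show "a * (u \<bullet> y) / (u \<bullet> w) + b * (u \<bullet> z) / (u \<bullet> w) = 1" using w by (simp add: uw add_divide_distrib[symmetric])
      qed (use yz ab w in auto)
      moreover have "(a * (u \<bullet> y) / (u \<bullet> w)) *\<^sub>R (y /\<^sub>R (u \<bullet> y)) = (a / (u \<bullet> w)) *\<^sub>R y"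
        "(b * (u \<bullet> z) / (u \<bullet> w)) *\<^sub>R (z /\<^sub>R (u \<bullet> z)) = (b / (u \<bullet> w)) *\<^sub>R z"
        using yz by auto
      moreover have "w /\<^sub>R (u \<bullet> w) = (a / (u \<bullet> w)) *\<^sub>R y + (b / (u \<bullet> w)) *\<^sub>R z"
        unfolding w_def by (simp add: scaleR_add_right divide_inverse mult.commute)
      ultimately have "w /\<^sub>R (u \<bullet> w) \<in> Q" by (simp only:)
      then have "w \<in> ?A" using w by simp
      then show "a *\<^sub>R y + b *\<^sub>R z \<in> ?A" by (simp only: w_def)
    qed
  qed
  then show "0 < u \<bullet> x \<and> x /\<^sub>R (u \<bullet> x) \<in> Q" if x: "x \<in> spherical_hull V" for x
  proof -
    obtain y where y: "y \<in> convex hull V" "x = sgn y" using x unfolding spherical_hull_def by blast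
    have y0: "y \<noteq> 0" using pos[OF y(1)] by auto
    have "sgn y /\<^sub>R (u \<bullet> sgn y) = (norm y * inverse (u \<bullet> y) * inverse (norm y)) *\<^sub>R y"
      by (simp add: sgn_div_norm)
    also have "\<dots> = y /\<^sub>R (u \<bullet> y)" using y0 by simp
    also have "\<dots> \<in> Q" using \<open>convex hull V \<subseteq> ?A\<close> y(1) by blast
    finally have "x /\<^sub>R (u \<bullet> x) \<in> Q" unfolding y(2) .
    moreover have "0 < u \<bullet> x" using pos[OF y(1)] y0 by (simp add: y(2) sgn_div_norm)
    ultimately show ?thesis by blast
  qed
  have "Q \<subseteq> {q. \<exists>t>0. t *\<^sub>R q \<in> convex hull V}" (is "_ \<subseteq> ?B") unfolding Q_def
  proof (rule hull_minimal)
    show "(\<lambda>v. v /\<^sub>R (u \<bullet> v)) ` V \<subseteq> ?B"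
    proof (rule image_subsetI)
      fix v assume "v \<in> V"
      then show "v /\<^sub>R (u \<bullet> v) \<in> ?B"
        using u[of v] by (intro CollectI exI[of _ "u \<bullet> v"]) (auto intro: hull_inc)
    qed
    show "convex ?B"
    proof (rule convexI)
      fix y z and a b :: real assume yz: "y \<in> ?B" "z \<in> ?B" and ab: "0 \<le> a" "0 \<le> b" "a + b = 1"
      then obtain s t where st: "s > 0" "s *\<^sub>R y \<in> convex hull V" "t > 0" "t *\<^sub>R z \<in> convex hull V" by blast
      define r where "r = a / s + b / t"
      have r: "r > 0"
      proof (cases "a = 0")
        case True
        then show ?thesis using ab st by (simp add: r_def)
      next
        case False
        then show ?thesis unfolding r_def using ab st by (intro add_pos_nonneg) auto
      qed
      have "(a / s / r) *\<^sub>R s *\<^sub>R y + (b / t / r) *\<^sub>R t *\<^sub>R z \<in> convex hull V"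
      proof (rule convexD[OF convex_convex_hull st(2,4)])
        have "a / s / r + b / t / r = r / r" unfolding add_divide_distrib[symmetric] r_def ..
        then show "a / s / r + b / t / r = 1" using r by simp
      qed (use ab st r in auto)
      moreover have "(a / s / r) *\<^sub>R s *\<^sub>R y + (b / t / r) *\<^sub>R t *\<^sub>R z = (1 / r) *\<^sub>R (a *\<^sub>R y + b *\<^sub>R z)"
        using st by (simp add: scaleR_add_right)
      ultimately show "a *\<^sub>R y + b *\<^sub>R z \<in> ?B" using r by (intro CollectI exI[of _ "1 / r"]) auto
    qed
  qed
  then show "\<exists>x\<in>spherical_hull V. \<exists>t>0. x = t *\<^sub>R q" if q: "q \<in> Q" for q
  proof -
    obtain t where t: "t > 0" "t *\<^sub>R q \<in> convex hull V" using \<open>Q \<subseteq> ?B\<close> q by blast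
    have "q \<noteq> 0" using uQ[OF q] by auto
    then have "sgn (t *\<^sub>R q) = (1 / norm q) *\<^sub>R q" "0 < 1 / norm q" using t by (auto simp: sgn_div_norm divide_inverse)
    moreover have "sgn (t *\<^sub>R q) \<in> spherical_hull V" using t(2) unfolding spherical_hull_def by blast
    ultimately show ?thesis by blast
  qed
qed

lemma lifted_spherical_geometry:
  "lifted_geometry (spherical_geometry :: 'a::euclidean_space geometry) (\<lambda>x. x)"
proof
  have abs_le: "\<bar>x \<bullet> y\<bar> \<le> 1" if "x \<in> gspace spherical_geometry" "y \<in> gspace spherical_geometry" for x y :: 'a
    using that Cauchy_Schwarz_ineq2[of x y] by (simp add: spherical_geometry_def)
  {
    fix P :: "'a set" assume "gpolytope spherical_geometry P"
    then obtain V u where V: "finite V" "V \<noteq> {}" "\<And>v. v \<in> V \<Longrightarrow> 0 < u \<bullet> v" "P = spherical_hull V"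
      by (auto simp: spherical_geometry_def)
    note section_V = spherical_hull_section[OF V(1-3)]
    show "P \<subseteq> gspace spherical_geometry"
    proof
      fix x assume x: "x \<in> P"
      then obtain y where "x = sgn y" unfolding V(4) spherical_hull_def by blast
      moreover have "x \<noteq> 0" using section_V(4)[of x] x V(4) by auto
      ultimately show "x \<in> gspace spherical_geometry" by (auto simp: spherical_geometry_def norm_sgn)
    qed
    show "\<exists>u Q. polytope Q \<and> Q \<noteq> {} \<and> (\<forall>q\<in>Q. u \<bullet> q = 1) \<and>
      (\<forall>x\<in>P. 0 < u \<bullet> x \<and> x /\<^sub>R (u \<bullet> x) \<in> Q) \<and> (\<forall>q\<in>Q. \<exists>x\<in>P. \<exists>t>0. x = t *\<^sub>R q)"
      unfolding V(4) using section_V by (intro exI conjI ballI) (assumption | blast)+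
  }
  fix x y :: 'a assume xy: "x \<in> gspace spherical_geometry" "y \<in> gspace spherical_geometry"
  show "0 \<le> gdist spherical_geometry x y"
    using abs_le[OF xy] by (simp add: spherical_geometry_def arccos_lbound)
  have norms: "norm x = 1" "norm y = 1" using xy by (auto simp: spherical_geometry_def)
  show "gdist spherical_geometry x y = 0 \<longleftrightarrow> x = y"
  proof
    assume "gdist spherical_geometry x y = 0"
    then have "x \<bullet> y = 1" using cos_arccos_abs[OF abs_le[OF xy]] by (simp add: spherical_geometry_def)
    then show "x = y" using norm_cauchy_schwarz_eq[of x y] norms by simp
  next
    assume "x = y"
    then show "gdist spherical_geometry x y = 0"
      using norms by (simp add: spherical_geometry_def dot_square_norm)
  qed
  show "x = y" if "0 < t" "x = t *\<^sub>R y" for t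
  proof -
    have "norm x = t * norm y" using that by simp
    then show ?thesis using norms that by simp
  qed
next
  fix A :: "'a set" and g :: "'a \<Rightarrow> 'a"
  assume A: "A \<subseteq> gspace spherical_geometry" "g ` A \<subseteq> gspace spherical_geometry"
    and iso: "\<And>x y. x \<in> A \<Longrightarrow> y \<in> A \<Longrightarrow> gdist spherical_geometry (g x) (g y) = gdist spherical_geometry x y"
  have "g x \<bullet> g y = x \<bullet> y" if xy: "x \<in> A" "y \<in> A" for x y
  proof -
    have "norm x = 1" "norm y = 1" "norm (g x) = 1" "norm (g y) = 1"
      using A xy by (auto simp: spherical_geometry_def)
    then have "\<bar>x \<bullet> y\<bar> \<le> 1" "\<bar>g x \<bullet> g y\<bar> \<le> 1"
      using Cauchy_Schwarz_ineq2[of x y] Cauchy_Schwarz_ineq2[of "g x" "g y"] by auto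
    then show ?thesis using iso[OF xy] by (simp add: spherical_geometry_def arccos_eq_iff)
  qed
  then have "dim (g ` A) = dim A" by (rule dim_image_inner_preserving)
  then show "dim ((\<lambda>x. x) ` g ` A) = dim ((\<lambda>x. x) ` A)" by simp
qed (auto simp: spherical_geometry_def)

theorem theoremA5:
  fixes G :: "'a::euclidean_space geometry"
    and K :: "'p polycomplex"
    and f :: "'p \<Rightarrow> 'a"
    and d :: nat
  assumes "G = euclidean_geometry \<and> DIM('a) = d \<or> G = spherical_geometry \<and> DIM('a) = d + 1"
    and "d \<ge> 3"
    and "premanifold G (d - 1) K f"
    and "connected_space (complex_topology K)"
    and "closed_complex G (d - 1) K"
    and "locally_convex_position G K f"
  shows "convex_position G K f"
  using assms(1)
proof (elim disjE conjE)
  have pre: "precomplex G K f" "pl_manifold G (d - 1) K" using assms(3) by (auto simp: premanifold_def)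
  assume G: "G = euclidean_geometry" and d: "DIM('a) = d"
  interpret closed_locally_convex_premanifold G "\<lambda>x. (x, 1::real)" K f d
    unfolding G
    by (intro closed_locally_convex_premanifold.intro lifted_precomplex.intro lifted_euclidean_geometry
        lifted_precomplex_axioms.intro closed_locally_convex_premanifold_axioms.intro)
      (use pre assms(2-) G d in auto)
  show ?thesis by (rule in_convex_position)
next
  have pre: "precomplex G K f" "pl_manifold G (d - 1) K" using assms(3) by (auto simp: premanifold_def)
  assume G: "G = spherical_geometry" and d: "DIM('a) = d + 1"
  interpret closed_locally_convex_premanifold G "\<lambda>x. x" K f d
    unfolding G
    by (intro closed_locally_convex_premanifold.intro lifted_precomplex.intro lifted_spherical_geometry
        lifted_precomplex_axioms.intro closed_locally_convex_premanifold_axioms.intro)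
      (use pre assms(2-) G d in auto)
  show ?thesis by (rule in_convex_position)
qed

end
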